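(* Let $n>5$. Every saturated blocker $B$ for triangulations of a convex $n$-gon having exactly $n-1$ edges is, up to a cyclic rotation of the vertex labels $0,\dots,n-1$, of one of the following three types. Type 1: $B=B_{\mathrm{Sea}}\cup B_1\cup B_2$, where for some $4\le m\le n-3$ and some $2<\ell<m$: $B_{\mathrm{Sea}}=\{(\ell-2,\ell),(\ell-2,\ell+1),(\ell-1,\ell+2),(\ell,\ell+2)\}$; $B_1=\{(0,2),(1,3),\dots,(\ell-3,\ell-1),(\ell+1,\ell+3),\dots,(m,m+2)\}$; and $B_2=\{(m+3,i_1),(m+4,i_2),\dots,(n-1,i_{n-3-m})\}$ with all $i_j\in\{1,\dots,\ell-1,\ell+1,\dots,m+1\}$, such that whenever $|i_{j_1}-i_{j_2}|\ge 2$, the diagonals $(m+2+j_1,i_{j_1})$ and $(m+2+j_2,i_{j_2})$ do not cross. Type 2: $B=B_{\mathrm{Buf}}\cup B_1\cup B_2$, where for some $5\le m\le n-3$ and some $2<\ell<m-1$: $B_{\mathrm{Buf}}=\{(\ell-2,\ell),(\ell-2,\ell+1),(\ell-1,\ell+2),(\ell,\ell+3),(\ell+1,\ell+3)\}$; $B_1=\{(0,2),\dots,(\ell-3,\ell-1),(\ell+2,\ell+4),\dots,(m,m+2)\}$; and $B_2=\{(m+3,i_1),(m+4,i_2),\dots,(n-1,i_{n-3-m})\}$ with all $i_j\in\{1,\dots,\ell-1,\ell+2,\dots,m+1\}$, such that whenever $|i_{j_1}-i_{j_2}|\ge 2$, the diagonals $(m+2+j_1,i_{j_1})$ and $(m+2+j_2,i_{j_2})$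 do not cross. Type 3: $B=B_{\mathrm{Bouq}}\cup B_{1,L}\cup B_{1,R}\cup B_{2,L}\cup B_{2,R}$, where for integers $\ell,m,k,t$ with $0<\ell<m+2<k<k+1<k+t\le n-1$: $B_{\mathrm{Bouq}}=\{(\ell-1,\ell+1),(k,\ell-1),(k+t,\ell+1),(k,k+t),(k+1,\ell),(k+2,\ell),\dots,(k+t-1,\ell)\}$; $B_{1,L}=\{(\ell,\ell+2),\dots,(m,m+2)\}$ if $\ell<m+1$ and $B_{1,L}=\emptyset$ if $\ell=m+1$; $B_{1,R}=\{(0,2),\dots,(\ell-2,\ell)\}$ if $\ell>1$ and $B_{1,R}=\emptyset$ if $\ell=1$; $B_{2,L}=\{(m+3,i_1),\dots,(k-1,i_{k-m-3})\}$ if $k>m+3$ and $B_{2,L}=\emptyset$ if $k=m+3$; $B_{2,R}=\{(k+t+1,i_{k+t-m-1}),\dots,(n-1,i_{n-3-m})\}$ if $k+t<n-1$ and $B_{2,R}=\emptyset$ if $k+t=n-1$; where $i_1,\dots,i_{k-m-3}\in\{\ell,\dots,m+1\}$ and $i_{k+t-m-1},\dots,i_{n-3-m}\in\{1,\dots,\ell\}$, and whenever $|i_{j_1}-i_{j_2}|\ge 2$, the diagonals $(m+2+j_1,i_{j_1})$ and $(m+2+j_2,i_{j_2})$ do not cross.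
   Context: Let $P$ be a convex polygon with $n$ vertices labeled $0,1,\dots,n-1$ in cyclic order (indices modulo $n$). An edge $(i,j)$ is the segment between vertices $i$ and $j$; boundary edges are $(i,i+1)$, and diagonals are the other edges. Two edges cross if they share an interior point. A triangulation of $P$ is a maximal set of pairwise non-crossing diagonals of $P$. A blocker (for triangulations) is a set $B$ of diagonals having at least one diagonal in common with every triangulation of $P$. A blocker $B$ is saturated if for every $e\in B$ the set $B\setminus\{e\}$ is not a blocker. *)

theory Defs
  imports Main
begin

text \<open>Vertices of the convex n-gon are 0..n-1; an edge (i,j) is the unordered pair {i,j}.\<close>

definition edge :: "nat \<Rightarrow> nat \<Rightarrow> nat set" where
  "edge i j = {i, j}"

definition is_diagonal :: "nat \<Rightarrow> nat set \<Rightarrow> bool" where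
  "is_diagonal n e \<longleftrightarrow>
     (\<exists>i j. e = {i, j} \<and> i < j \<and> j < n \<and> j \<noteq> i + 1 \<and> \<not> (i = 0 \<and> j = n - 1))"

definition diagonals :: "nat \<Rightarrow> nat set set" where
  "diagonals n = {e. is_diagonal n e}"

text \<open>Two chords of a convex polygon share an interior point iff their endpoints interleave.\<close>
definition interleave :: "nat set \<Rightarrow> nat set \<Rightarrow> bool" where
  "interleave e f \<longleftrightarrow> (\<exists>a b c d. e = {a, b} \<and> f = {c, d} \<and> a < c \<and> c < b \<and> b < d)"

definition crosses :: "nat set \<Rightarrow> nat set \<Rightarrow> bool" where
  "crosses e f \<longleftrightarrow> interleave e f \<or> interleave f e"

definition non_crossing :: "nat set set \<Rightarrow> bool" where
  "non_crossing S \<longleftrightarrow> (\<forall>e\<in>S. \<forall>f\<in>S. \<not> crosses e f)"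

definition triangulation :: "nat \<Rightarrow> nat set set \<Rightarrow> bool" where
  "triangulation n T \<longleftrightarrow> T \<subseteq> diagonals n \<and> non_crossing T \<and>
     (\<forall>e \<in> diagonals n. e \<notin> T \<longrightarrow> \<not> non_crossing (insert e T))"

definition blocker :: "nat \<Rightarrow> nat set set \<Rightarrow> bool" where
  "blocker n B \<longleftrightarrow> B \<subseteq> diagonals n \<and> (\<forall>T. triangulation n T \<longrightarrow> B \<inter> T \<noteq> {})"

definition saturated_blocker :: "nat \<Rightarrow> nat set set \<Rightarrow> bool" where
  "saturated_blocker n B \<longleftrightarrow> blocker n B \<and> (\<forall>e\<in>B. \<not> blocker n (B - {e}))"

definition rotate_edges :: "nat \<Rightarrow> nat \<Rightarrow> nat set set \<Rightarrow> nat set set" where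
  "rotate_edges n r B = (\<lambda>e. (\<lambda>v. (v + r) mod n) ` e) ` B"

definition B2_set :: "nat \<Rightarrow> (nat \<Rightarrow> nat) \<Rightarrow> nat set \<Rightarrow> nat set set" where
  "B2_set m i J = {edge (m + 2 + j) (i j) | j. j \<in> J}"

definition B2_cond :: "nat \<Rightarrow> (nat \<Rightarrow> nat) \<Rightarrow> nat set \<Rightarrow> bool" where
  "B2_cond m i J \<longleftrightarrow> (\<forall>j1\<in>J. \<forall>j2\<in>J.
      \<bar>int (i j1) - int (i j2)\<bar> \<ge> 2 \<longrightarrow>
      \<not> crosses (edge (m + 2 + j1) (i j1)) (edge (m + 2 + j2) (i j2)))"

definition type1 :: "nat \<Rightarrow> nat set set \<Rightarrow> bool" where
  "type1 n B \<longleftrightarrow> (\<exists>m l i.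
     4 \<le> m \<and> m \<le> n - 3 \<and> 2 < l \<and> l < m \<and>
     (\<forall>j\<in>{1..n-3-m}. i j \<in> {1..l-1} \<union> {l+1..m+1}) \<and>
     B2_cond m i {1..n-3-m} \<and>
     B = {edge (l-2) l, edge (l-2) (l+1), edge (l-1) (l+2), edge l (l+2)}
         \<union> ({edge s (s+2) | s. s \<le> l - 3} \<union> {edge s (s+2) | s. l + 1 \<le> s \<and> s \<le> m})
         \<union> B2_set m i {1..n-3-m})"

definition type2 :: "nat \<Rightarrow> nat set set \<Rightarrow> bool" where
  "type2 n B \<longleftrightarrow> (\<exists>m l i.
     5 \<le> m \<and> m \<le> n - 3 \<and> 2 < l \<and> l + 1 < m \<and>
     (\<forall>j\<in>{1..n-3-m}. i j \<in> {1..l-1} \<union> {l+2..m+1}) \<and>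
     B2_cond m i {1..n-3-m} \<and>
     B = {edge (l-2) l, edge (l-2) (l+1), edge (l-1) (l+2), edge l (l+3), edge (l+1) (l+3)}
         \<union> ({edge s (s+2) | s. s \<le> l - 3} \<union> {edge s (s+2) | s. l + 2 \<le> s \<and> s \<le> m})
         \<union> B2_set m i {1..n-3-m})"

definition type3 :: "nat \<Rightarrow> nat set set \<Rightarrow> bool" where
  "type3 n B \<longleftrightarrow> (\<exists>l m k t i.
     0 < l \<and> l < m + 2 \<and> m + 2 < k \<and> k + 1 < k + t \<and> k + t \<le> n - 1 \<and>
     (\<forall>j\<in>{1..k-m-3}. i j \<in> {l..m+1}) \<and>
     (\<forall>j\<in>{k+t-m-1..n-3-m}. i j \<in> {1..l}) \<and>
     B2_cond m i ({1..k-m-3} \<union> {k+t-m-1..n-3-m}) \<and>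
     B = ({edge (l-1) (l+1), edge k (l-1), edge (k+t) (l+1), edge k (k+t)}
           \<union> {edge (k+s) l | s. 1 \<le> s \<and> s \<le> t - 1})
         \<union> {edge s (s+2) | s. l \<le> s \<and> s \<le> m}
         \<union> {edge s (s+2) | s. s + 2 \<le> l}
         \<union> B2_set m i {1..k-m-3}
         \<union> B2_set m i {k+t-m-1..n-3-m})"

end

theory Submission
  imports Defs
begin

text \<open>Every sub-polygon cut out by chords outside a blocker \<open>B\<close> is blocked again, and every vertex
  \<open>v\<close> of a blocked polygon meets \<open>B\<close> (otherwise the fan at \<open>v\<close> avoids \<open>B\<close>). Cutting off vertices
  \<open>v\<close> whose ear \<open>(v - 1, v + 1)\<close> is not in \<open>B\<close> therefore shows \<open>|B| \<ge> n - 2\<close>, and for \<open>|B| = n - 2\<close> that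
  such vertices have degree one and are pairwise not joined by \<open>B\<close>. Two fans then show that the ears in \<open>B\<close>
  are consecutive, and the remaining edges form a nearly non-crossing family.

  If \<open>|B| = n - 1\<close> and \<open>B\<close> is saturated, some vertex \<open>y\<close> without ear in \<open>B\<close> has degree two, as otherwise \<open>B\<close>
  would properly contain a blocker of the above form. Cutting off \<open>y\<close> leaves a blocker of minimum size. The
  position of \<open>y\<close> relative to its consecutive ears decides the type: well inside the run of ears one
  finds types 1 and 2, in all other positions \<open>B\<close> still contains a run of ears together with one edge from
  each remaining vertex to that run, which forces type 3.\<close>

text \<open>The counting has a slack of exactly one edge. If two vertices without ears are cut off
  in succession and each takes at least two edges with it, at most \<open>n - 5\<close> edges remain
  for an \<open>(n - 2)\<close>-gon, which needs \<open>n - 4\<close>. Most contradictions in the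
  case analysis are of this kind; others name the second neighbour that a vertex must have because
  the polygon stays blocked when a vertex without ear is cut off, or exhibit a triangulation made of
  a few fans. Saturation enters only through edges whose deletion would leave a run of ears with a
  \<open>tame\<close> family of remaining edges, which is still a blocker. The obstacle is
  \<open>y\<close> near an end of the run. The ears over \<open>y\<close> are stretched to chords
  \<open>{i, i + 3}\<close>, so the run of the smaller polygon breaks there. The way out is that a
  run in \<open>B\<close> need not be the one found in the smaller polygon: it may begin or end at
  \<open>y\<close> or next to it, vertices dropped from the run being counted among the remaining
  ones. Type 3 follows from any such run.\<close>

section \<open>Triangulable arcs\<close>

text \<open>\<open>good R i j\<close>: the polygon with vertices \<open>i, \<dots>, j\<close> has a triangulation that avoids \<open>R\<close>, where the closing
  chord \<open>{i, j}\<close> must avoid \<open>R\<close> as well; for \<open>tri\<close> the closing edge is a side and is unrestricted.\<close>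

inductive good :: "(nat \<Rightarrow> nat \<Rightarrow> bool) \<Rightarrow> nat \<Rightarrow> nat \<Rightarrow> bool" for R where
  good_side: "good R i (Suc i)"
| good_split: "\<not> R i j \<Longrightarrow> good R i k \<Longrightarrow> good R k j \<Longrightarrow> good R i j"

definition tri :: "(nat \<Rightarrow> nat \<Rightarrow> bool) \<Rightarrow> nat \<Rightarrow> bool" where
  "tri R n \<longleftrightarrow> (\<exists>k. good R 0 k \<and> good R k (n - 1))"

lemma good_less: "good R i j \<Longrightarrow> i < j"
  by (induction rule: good.induct) auto

lemma good_side': "j = Suc i \<Longrightarrow> good R i j"
  by (simp add: good_side)

lemma good_not: "good R i j \<Longrightarrow> j = Suc i \<or> \<not> R i j"
  by (erule good.cases) auto

text \<open>One induction serves both the monotonicity in \<open>R\<close> and the relabelling in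
  \<open>tri_rot1\<close>. Only pairs with \<open>Suc a < b\<close> are compared, since sides are
  never obstructed; the sides themselves turn into arcs that are good for \<open>S\<close>.\<close>

lemma good_embed:
  assumes "good R i j"
    and "\<And>t. i \<le> t \<Longrightarrow> t < j \<Longrightarrow> good S (e t) (e (Suc t))"
    and "\<And>a b. i \<le> a \<Longrightarrow> Suc a < b \<Longrightarrow> b \<le> j \<Longrightarrow> S (e a) (e b) \<Longrightarrow> R a b"
  shows "good S (e i) (e j)"
  using assms
proof (induction rule: good.induct)
  case (good_split i j k)
  have ik: "i < k" and kj: "k < j" using good_split.hyps good_less by auto
  have "good S (e i) (e k)" by (rule good_split.IH(1)) (use kj good_split.prems in auto)
  moreover have "good S (e k) (e j)" by (rule good_split.IH(2)) (use ik good_split.prems in auto)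
  moreover have "\<not> S (e i) (e j)" using good_split.hyps(1) good_split.prems(2)[of i j] ik kj by auto
  ultimately show ?case using good.good_split by blast
qed auto

lemma good_mono:
  assumes "good R i j"
    and "\<And>a b. i \<le> a \<Longrightarrow> Suc a < b \<Longrightarrow> b \<le> j \<Longrightarrow> S a b \<Longrightarrow> R a b"
  shows "good S i j"
  using good_embed[of R i j S "\<lambda>x. x"] assms good_side by auto

lemma tri_mono:
  assumes "tri R n" "\<And>a b. a < b \<Longrightarrow> b < n \<Longrightarrow> S a b \<Longrightarrow> R a b"
  shows "tri S n"
proof -
  obtain k where k: "good R 0 k" "good R k (n - 1)" using assms(1) tri_def by auto
  have "k < n - 1" using good_less[OF k(2)] .
  then have "good S 0 k" "good S k (n - 1)"
    using good_mono[OF k(1), of S] good_mono[OF k(2), of S] assms(2) by auto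
  then show ?thesis using tri_def by auto
qed

text \<open>The triangles \<open>i, j, j + 1\<close> with \<open>b \<le> j < c\<close> are glued on
  one after the other.\<close>

lemma good_extend_right:
  assumes "good R i b" "b \<le> c" "\<And>j. b < j \<Longrightarrow> j \<le> c \<Longrightarrow> \<not> R i j"
  shows "good R i c"
  using assms(2,3)
proof (induction c rule: dec_induct)
  case base then show ?case using assms(1) by simp
next
  case (step c)
  then show ?case using good_split[of R i "Suc c" c] good_side by auto
qed

lemma good_extend_left:
  assumes "good R b c" "a \<le> b" "\<And>j. a \<le> j \<Longrightarrow> j < b \<Longrightarrow> \<not> R j c"
  shows "good R a c"
  using assms(2,3)
proof (induction a rule: inc_induct)
  case base then show ?case using assms(1) by simp
next
  case (step a)
  then have "good R (Suc a) c" "\<not> R a c" by auto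
  then show ?case using good_split[of R a c "Suc a"] good_side by auto
qed

lemma good_fan_left: "i < c \<Longrightarrow> (\<And>j. Suc i < j \<Longrightarrow> j \<le> c \<Longrightarrow> \<not> R i j) \<Longrightarrow> good R i c"
  using good_extend_right[of R i "Suc i" c] good_side by auto

lemma good_fan_right: "a < c \<Longrightarrow> (\<And>j. a \<le> j \<Longrightarrow> Suc j < c \<Longrightarrow> \<not> R j c) \<Longrightarrow> good R a c"
  using good_extend_left[of R "c - 1" c a] good_side'[of c "c - 1" R] by fastforce

section \<open>Rotating the labels and cutting off the last vertex\<close>

definition rot :: "nat \<Rightarrow> nat \<Rightarrow> (nat \<Rightarrow> nat \<Rightarrow> bool) \<Rightarrow> nat \<Rightarrow> nat \<Rightarrow> bool" where
  "rot n r R i j \<longleftrightarrow> i < n \<and> j < n \<and> R ((i + r) mod n) ((j + r) mod n)"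

text \<open>Only the label \<open>n - 1\<close> is ever removed, so that the other labels stay as
  they are; \<open>rot n (x + 1)\<close> brings an arbitrary vertex \<open>x\<close> to that place
  beforehand.\<close>

definition cut :: "nat \<Rightarrow> (nat \<Rightarrow> nat \<Rightarrow> bool) \<Rightarrow> nat \<Rightarrow> nat \<Rightarrow> bool" where
  "cut n R i j \<longleftrightarrow> i < n - 1 \<and> j < n - 1 \<and> R i j"

definition chords :: "nat \<Rightarrow> (nat \<Rightarrow> nat \<Rightarrow> bool) \<Rightarrow> bool" where
  "chords n R \<longleftrightarrow> (\<forall>i j. R i j \<longrightarrow> R j i \<and> i < n \<and> j < n \<and> i \<noteq> j \<and> (i + 1) mod n \<noteq> j)"

definition edges :: "(nat \<Rightarrow> nat \<Rightarrow> bool) \<Rightarrow> nat set set" where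
  "edges R = {{i, j} | i j. R i j}"

text \<open>This chord becomes a side when \<open>x\<close> is cut off. Hence \<open>x\<close> may
  be cut off only if the chord lies outside \<open>R\<close>, see \<open>chords_cut\<close> and
  \<open>tri_cut\<close>.\<close>

definition ear :: "nat \<Rightarrow> (nat \<Rightarrow> nat \<Rightarrow> bool) \<Rightarrow> nat \<Rightarrow> bool" where
  "ear n R x \<longleftrightarrow> R ((x + n - 1) mod n) ((x + 1) mod n)"

lemma chordsD:
  assumes "chords n R" "R i j"
  shows "R j i" "i < n" "j < n" "i \<noteq> j" "j \<noteq> Suc i" "i \<noteq> Suc j" "i = 0 \<Longrightarrow> j \<noteq> n - 1" "j = 0 \<Longrightarrow> i \<noteq> n - 1"
proof -
  have *: "R j i" "i < n" "j < n" "i \<noteq> j" "(i + 1) mod n \<noteq> j"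
    using assms(1)[unfolded chords_def, rule_format, OF assms(2)] by auto
  have **: "(j + 1) mod n \<noteq> i"
    using assms(1)[unfolded chords_def, rule_format, OF *(1)] by auto
  show "R j i" "i < n" "j < n" "i \<noteq> j" by fact+
  show "j \<noteq> Suc i" using * by auto
  show "i \<noteq> Suc j" using * ** by auto
  show "i = 0 \<Longrightarrow> j \<noteq> n - 1" using * ** by auto
  show "j = 0 \<Longrightarrow> i \<noteq> n - 1" using * ** by auto
qed

lemma chordsI:
  assumes "\<And>i j. R i j \<Longrightarrow> R j i \<and> i < n \<and> j < n \<and> i \<noteq> j \<and> j \<noteq> Suc i \<and> (i = n - 1 \<longrightarrow> j \<noteq> 0)"
  shows "chords n R"
  unfolding chords_def
proof (intro allI impI)
  fix i j assume "R i j"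
  from assms[OF this] show "R j i \<and> i < n \<and> j < n \<and> i \<noteq> j \<and> (i + 1) mod n \<noteq> j"
    by (cases "i + 1 < n") (auto simp: not_less le_Suc_eq)
qed

lemma rot_add: "n > 0 \<Longrightarrow> rot n a (rot n b R) = rot n (a + b) R"
  by (auto simp: rot_def fun_eq_iff mod_simps add.assoc)

lemma rot_mod: "rot n (r mod n) R = rot n r R"
  by (auto simp: rot_def fun_eq_iff mod_simps)

lemma rot_self: "chords n R \<Longrightarrow> rot n n R = R"
  using chordsD(2,3)[of n R] by (auto simp: rot_def fun_eq_iff)

lemma rot_0: "chords n R \<Longrightarrow> rot n 0 R = R"
  using chordsD(2,3)[of n R] by (auto simp: rot_def fun_eq_iff)

lemma mod_add_right_eq_iff: "i < n \<Longrightarrow> j < n \<Longrightarrow> ((i + r) mod n = (j + r) mod n) \<longleftrightarrow> i = (j::nat)"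
proof -
  assume ij: "i < n" "j < n"
  have key: "((z + r) mod n + (n - r mod n)) mod n = z" if "z < n" for z
  proof -
    have "r mod n < n" using that by simp
    then have "z + r + (n - r mod n) = z + n * (r div n) + n" using mult_div_mod_eq[of n r] by linarith
    then have "((z + r) mod n + (n - r mod n)) mod n = (z + n * (r div n) + n) mod n"
      by (simp only: mod_add_left_eq)
    then show ?thesis using that by simp
  qed
  show ?thesis using key[OF ij(1)] key[OF ij(2)] by metis
qed

lemma chords_rot:
  assumes "chords n R" shows "chords n (rot n r R)"
  unfolding chords_def
proof (intro allI impI)
  fix i j assume a: "rot n r R i j"
  then have n: "i < n" "j < n" "R ((i + r) mod n) ((j + r) mod n)" by (auto simp: rot_def)
  have *: "((i + r) mod n + 1) mod n \<noteq> (j + r) mod n" "R ((j + r) mod n) ((i + r) mod n)"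
      "(i + r) mod n \<noteq> (j + r) mod n"
    using assms[unfolded chords_def, rule_format, OF n(3)] chordsD(4)[OF assms n(3)] by auto
  have "((i + r) mod n + 1) mod n = ((i + 1) mod n + r) mod n" by (simp add: mod_simps ac_simps)
  then have "(i + 1) mod n \<noteq> j" using *(1) by auto
  then show "rot n r R j i \<and> i < n \<and> j < n \<and> i \<noteq> j \<and> (i + 1) mod n \<noteq> j"
    using n * by (auto simp: rot_def)
qed

lemma ear_rot:
  assumes "x < n" shows "ear n (rot n r R) x \<longleftrightarrow> ear n R ((x + r) mod n)"
proof -
  have n: "n > 0" using assms by auto
  have "((x + n - 1) mod n + r) mod n = ((x + r) mod n + n - 1) mod n"
  proof -
    have "((x + n - 1) mod n + r) mod n = (x + n - 1 + r) mod n" by (simp add: mod_simps)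
    also have "\<dots> = ((x + r) + (n - 1)) mod n" using n by (simp add: algebra_simps)
    also have "\<dots> = ((x + r) mod n + (n - 1)) mod n" by (simp add: mod_simps)
    finally show ?thesis using n by simp
  qed
  moreover have "((x + 1) mod n + r) mod n = ((x + r) mod n + 1) mod n" by (simp add: mod_simps ac_simps)
  ultimately show ?thesis using n unfolding ear_def rot_def by simp
qed

lemma ear_mid: "0 < x \<Longrightarrow> Suc x < n \<Longrightarrow> ear n R x \<longleftrightarrow> R (x - 1) (Suc x)"
proof -
  assume x: "0 < x" "Suc x < n"
  then have "x + n - 1 = (x - 1) + n" by simp
  then have "(x + n - 1) mod n = x - 1" using x by (simp only: mod_add_self2) simp
  then show ?thesis using x by (simp add: ear_def)
qed

lemma ear_0: "1 < n \<Longrightarrow> ear n R 0 \<longleftrightarrow> R (n - 1) 1"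
  by (simp add: ear_def)

lemma ear_last: "1 < n \<Longrightarrow> ear n R (n - 1) \<longleftrightarrow> R (n - 2) 0"
proof -
  assume n: "1 < n"
  then have "n - 1 + n - 1 = (n - 2) + n" by simp
  then have "(n - 1 + n - 1) mod n = n - 2" using n by (simp only: mod_add_self2) simp
  then show ?thesis using n by (simp add: ear_def)
qed

text \<open>The triangulation is re-rooted from the side \<open>{0, n - 1}\<close> to the side
  \<open>{0, 1}\<close> by passing through the triangles at vertex \<open>0\<close>, whose new label
  is \<open>n - 1\<close>.\<close>

lemma tri_rot1:
  assumes c: "chords n R" and "tri R n"
  shows "tri (rot n 1 R) n"
proof -
  obtain k where k: "good R 0 k" "good R k (n - 1)" using assms(2) tri_def by auto
  have kn: "0 < k" "k < n - 1" using good_less k by auto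
  let ?R = "rot n 1 R"
  have shift: "good ?R (a - 1) (b - 1)" if "good R a b" "0 < a" "b < n" for a b
  proof -
    have ab: "a < b" using that good_less by auto
    show ?thesis
      by (rule good_embed[OF that(1), of ?R "\<lambda>x. x - 1"]) (use that ab in \<open>simp_all add: rot_def good_side' Suc_diff_le\<close>)
  qed
  \<comment> \<open>Invariant: the chord \<open>{0, j}\<close> has been reached, and the triangle
    behind it, with apex \<open>l\<close> in new labels, has its two further arcs already
    transferred. Initially \<open>l = n - 2\<close> is the old \<open>n - 1\<close>.\<close>
  have main: "tri ?R n" if "good R a j" "a = 0" "j < n" "good ?R (j - 1) l" "good ?R l (n - 1)" for a j l
    using that
  proof (induction arbitrary: l rule: good.induct)
    case (good_side i)
    then show ?case by (auto simp: tri_def)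
  next
    case (good_split i j k)
    have kj: "0 < k" "k < j" using good_split good_less by auto
    have "\<not> ?R (j - 1) (n - 1)"
      using good_split.hyps(1) good_split.prems kj chordsD(1)[OF c, of j 0]
      by (auto simp: rot_def)
    then have g: "good ?R (j - 1) (n - 1)" using good_split.prems good.good_split by blast
    have "good ?R (k - 1) (j - 1)" using shift good_split kj by auto
    then show ?case using good_split.IH(1)[of "j - 1"] good_split.prems kj g by auto
  qed
  have "good ?R (k - 1) (n - 2)" using shift[OF k(2)] kn by (simp add: numeral_2_eq_2)
  moreover have "good ?R (n - 2) (n - 1)" using kn by (intro good_side') simp
  ultimately show ?thesis using main[OF k(1), of "n - 2"] kn by simp
qed

lemma tri_rot_imp:
  assumes c: "chords n R" and "tri R n" shows "tri (rot n r R) n"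
proof (induction r)
  case 0 then show ?case using assms rot_0 by simp
next
  case (Suc r)
  obtain k where "good R k (n - 1)" using assms(2) unfolding tri_def by auto
  then have "n > 0" using good_less by (cases n) auto
  then show ?case using tri_rot1[OF chords_rot[OF c] Suc] rot_add[of n 1 r R] by simp
qed

lemma rot_inverse: "chords n R \<Longrightarrow> r < n \<Longrightarrow> rot n (n - r) (rot n r R) = R"
  using rot_add[of n "n - r" r R] rot_self by auto

lemma tri_rot: "chords n R \<Longrightarrow> n > 0 \<Longrightarrow> tri (rot n r R) n \<longleftrightarrow> tri R n"
  using tri_rot_imp[of n R r] tri_rot_imp[of n "rot n (r mod n) R" "n - r mod n"]
    rot_inverse[of n R "r mod n"] chords_rot[of n R "r mod n"] rot_mod[of n r R] by auto

text \<open>\<open>rot n r\<close> reads the label \<open>i\<close> as \<open>i + r\<close>, so it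
  is the inverse of the rotation of edges in the statement.\<close>

lemma edges_rot:
  assumes c: "chords n R" and n: "n > 0"
  shows "rotate_edges n r (edges (rot n r R)) = edges R" "card (edges (rot n r R)) = card (edges R)"
proof -
  let ?s = "\<lambda>v. (v + r) mod n"
  have inj: "inj_on ?s {..<n}" by (auto simp: inj_on_def mod_add_right_eq_iff)
  have surj: "?s ` {..<n} = {..<n}"
    by (rule endo_inj_surj) (use inj n in auto)
  show eq: "rotate_edges n r (edges (rot n r R)) = edges R"
  proof (intro set_eqI iffI)
    fix e assume "e \<in> rotate_edges n r (edges (rot n r R))"
    then show "e \<in> edges R" unfolding rotate_edges_def edges_def rot_def by auto
  next
    fix e assume "e \<in> edges R"
    then obtain i j where ij: "e = {i, j}" "R i j" unfolding edges_def by auto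
    then have "i < n" "j < n" using c chordsD by auto
    then obtain i' j' where "i' < n" "j' < n" "i = ?s i'" "j = ?s j'"
      using surj by (metis (no_types, lifting) image_iff lessThan_iff)
    then have "rot n r R i' j'" "e = ?s ` {i', j'}" using ij by (auto simp: rot_def)
    then show "e \<in> rotate_edges n r (edges (rot n r R))" unfolding rotate_edges_def edges_def by blast
  qed
  have "inj_on ((`) ?s) (edges (rot n r R))"
    by (rule inj_on_subset[OF inj_on_image_Pow[OF inj]]) (auto simp: edges_def rot_def)
  then show "card (edges (rot n r R)) = card (edges R)"
    using card_image[of "(`) ?s" "edges (rot n r R)"] eq unfolding rotate_edges_def by simp
qed

lemma finite_edges:
  assumes "chords n R" shows "finite (edges R)"
  by (rule finite_subset[of _ "Pow {..<n}"]) (use chordsD(2,3)[OF assms] in \<open>auto simp: edges_def\<close>)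

lemma finite_nbrs:
  assumes "chords n R" shows "finite {j. R x j}"
  by (rule finite_subset[of _ "{..<n}"]) (use chordsD(3)[OF assms] in auto)

lemma edges_cut:
  assumes c: "chords n R"
  shows "card (edges R) = card (edges (cut n R)) + card {j. R (n - 1) j}"
proof -
  have eq: "edges R = edges (cut n R) \<union> (\<lambda>j. {n - 1, j}) ` {j. R (n - 1) j}"
  proof (intro set_eqI iffI)
    fix e assume "e \<in> edges R"
    then obtain i j where ij: "e = {i, j}" "R i j" unfolding edges_def by auto
    then have d: "i < n" "j < n" "R j i" using c chordsD by auto
    consider "i = n - 1" | "j = n - 1" | "i < n - 1" "j < n - 1" using d by linarith
    then show "e \<in> edges (cut n R) \<union> (\<lambda>j. {n - 1, j}) ` {j. R (n - 1) j}"
      by cases (use ij d in \<open>auto simp: edges_def cut_def\<close>)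
  qed (auto simp: edges_def cut_def)
  have "edges (cut n R) \<inter> (\<lambda>j. {n - 1, j}) ` {j. R (n - 1) j} = {}"
    by (auto simp: edges_def cut_def doubleton_eq_iff)
  moreover have "finite (edges (cut n R))"
    by (rule finite_subset[OF _ finite_edges[OF c]]) (auto simp: edges_def cut_def)
  moreover have "inj_on (\<lambda>j. {n - 1, j}) {j. R (n - 1) j}"
    by (auto simp: inj_on_def doubleton_eq_iff)
  ultimately show ?thesis
    unfolding eq using finite_nbrs[OF c] by (simp add: card_Un_disjoint card_image)
qed

lemma chords_cut:
  assumes c: "chords n R" and "\<not> ear n R (n - 1)" and "n \<ge> 2"
  shows "chords (n - 1) (cut n R)"
proof (rule chordsI)
  fix i j assume "cut n R i j"
  then have *: "i < n - 1" "j < n - 1" "R i j" by (auto simp: cut_def)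
  have "\<not> R (n - 2) 0" using assms ear_last[of n R] by auto
  moreover have "n - 1 - 1 = n - 2" by simp
  ultimately have "i = n - 1 - 1 \<longrightarrow> j \<noteq> 0" using *(3) by metis
  then show "cut n R j i \<and> i < n - 1 \<and> j < n - 1 \<and> i \<noteq> j \<and> j \<noteq> Suc i \<and> (i = n - 1 - 1 \<longrightarrow> j \<noteq> 0)"
    using * chordsD[OF c *(3)] by (auto simp: cut_def)
qed

text \<open>The ear chord \<open>{0, n - 2}\<close> is free, so the deleted vertex is put back as a
  triangle on it.\<close>

lemma tri_cut:
  assumes c: "chords n R" and e: "\<not> ear n R (n - 1)" and n: "n \<ge> 2" and t: "tri (cut n R) (n - 1)"
  shows "tri R n"
proof -
  obtain k where "good (cut n R) 0 k" "good (cut n R) k (n - 1 - 1)" using t tri_def by auto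
  then have k: "good (cut n R) 0 k" "good (cut n R) k (n - 2)" by (auto simp: numeral_2_eq_2)
  have kn: "k < n - 2" using good_less k by auto
  have "good R 0 k" by (rule good_mono[OF k(1)]) (use kn in \<open>auto simp: cut_def\<close>)
  moreover have "good R k (n - 2)" by (rule good_mono[OF k(2)]) (use kn in \<open>auto simp: cut_def\<close>)
  moreover have "\<not> R 0 (n - 2)" using e ear_last[of n R] chordsD(1)[OF c, of 0 "n - 2"] n by auto
  ultimately have "good R 0 (n - 2)" using good_split by blast
  moreover have "good R (n - 2) (n - 1)" using kn by (intro good_side') auto
  ultimately show ?thesis using tri_def by auto
qed

lemma isolated_tri:
  assumes c: "chords n R" and "n \<ge> 3" "x < n" "\<And>j. \<not> R x j"
  shows "tri R n"
proof -
  let ?R = "rot n x R"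
  have "\<not> ?R 0 j" for j using assms by (auto simp: rot_def)
  then have "good ?R 0 (n - 2)" using good_fan_left[of 0 "n - 2" ?R] assms(2) by auto
  moreover have "good ?R (n - 2) (n - 1)" using assms(2) by (intro good_side') auto
  ultimately have "tri ?R n" using tri_def by auto
  then show ?thesis using tri_rot c assms(2) by auto
qed

lemma rot_to_last: "x < n \<Longrightarrow> (n - 1 + (x + 1)) mod n = (x::nat)"
  by simp

text \<open>From \<open>n = 5\<close> on, different vertices have different ear chords; in a
  quadrilateral opposite vertices share theirs.\<close>

lemma all_ears_card:
  assumes c: "chords n R" and "n \<ge> 5" "\<And>x. x < n \<Longrightarrow> ear n R x"
  shows "n \<le> card (edges R)"
proof -
  let ?f = "\<lambda>x. {(x + n - 1) mod n, (x + 1) mod n}"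
  have "inj_on ?f {..<n}"
  proof (rule inj_onI)
    fix x y assume xy: "x \<in> {..<n}" "y \<in> {..<n}" "?f x = ?f y"
    have *: "(z + n - 1) mod n = (if z = 0 then n - 1 else z - 1)" if "z < n" for z
      using that by (cases z) auto
    have **: "(z + 1) mod n = (if z = n - 1 then 0 else Suc z)" if "z < n" for z
      using that by auto
    have xn: "x < n" "y < n" using xy by auto
    show "x = y" using xy(3) xn \<open>n \<ge> 5\<close>
      unfolding *[OF xn(1)] *[OF xn(2)] **[OF xn(1)] **[OF xn(2)] doubleton_eq_iff
      by (auto split: if_splits)
  qed
  then have "n = card (?f ` {..<n})" by (simp add: card_image)
  also have "\<dots> \<le> card (edges R)"
    by (rule card_mono[OF finite_edges[OF c]]) (use assms(3) in \<open>auto simp: edges_def ear_def\<close>)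
  finally show ?thesis .
qed

lemma blocked_card:
  assumes "chords n R" "n \<ge> 3" "\<not> tri R n"
  shows "n - 2 \<le> card (edges R)"
  using assms(2,1,3)
proof (induction n arbitrary: R rule: dec_induct)
  case base
  have "tri R 3" using good_side[of R 0] good_side[of R 1] unfolding tri_def
    by (intro exI[of _ 1]) (simp add: numeral_2_eq_2)
  then show ?case using base by simp
next
  case (step n)
  show ?case
  proof (cases "\<exists>x < Suc n. \<not> ear (Suc n) R x")
    case True
    then obtain x where x: "x < Suc n" "\<not> ear (Suc n) R x" by auto
    let ?R = "rot (Suc n) (x + 1) R"
    have c: "chords (Suc n) ?R" using step.prems chords_rot by auto
    have e: "\<not> ear (Suc n) ?R (Suc n - 1)"
      using ear_rot[of "Suc n - 1" "Suc n" "x + 1" R] x rot_to_last[OF x(1)] by simp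
    have t: "\<not> tri ?R (Suc n)" using tri_rot step.prems by auto
    have "chords n (cut (Suc n) ?R)" using chords_cut[OF c e] step.hyps by simp
    moreover have "\<not> tri (cut (Suc n) ?R) n" using tri_cut[OF c e] t step.hyps by auto
    ultimately have "n - 2 \<le> card (edges (cut (Suc n) ?R))" using step.IH by auto
    moreover have "{j. ?R n j} \<noteq> {}"
    proof
      assume "{j. ?R n j} = {}"
      then have "\<not> ?R n j" for j by blast
      then show False using isolated_tri[OF c, of n] t step.hyps by simp
    qed
    then have "card {j. ?R n j} > 0" using finite_nbrs[OF c] by (simp add: card_gt_0_iff)
    ultimately have "Suc n - 2 \<le> card (edges ?R)" using edges_cut[OF c] by simp
    then show ?thesis using edges_rot(2)[OF step.prems(1)] by simp
  next
    case False
    then have E: "\<And>x. x < Suc n \<Longrightarrow> ear (Suc n) R x" by auto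
    show ?thesis
    proof (cases "Suc n \<ge> 5")
      case True
      then show ?thesis using all_ears_card[OF step.prems(1) True E] by simp
    next
      case False
      \<comment> \<open>In the quadrilateral the four ears are only two chords, which still reaches
        the bound.\<close>
      then have n: "n = 3" using step.hyps by simp
      have "R 0 (Suc (Suc 0))" "R (Suc 0) (Suc (Suc (Suc 0)))" 
        using E[of "Suc 0"] E[of "Suc (Suc 0)"] n ear_mid[of "Suc 0" "Suc n" R] ear_mid[of "Suc (Suc 0)" "Suc n" R]
        by auto
      then have "{0, 2} \<in> edges R" "{1, 3} \<in> edges R" unfolding edges_def numeral_2_eq_2 numeral_3_eq_3 by auto
      then have "{{0, 2}, {1, 3}} \<subseteq> edges R" by simp
      then have "card {{0, 2}, {1, 3::nat}} \<le> card (edges R)"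
        by (rule card_mono[OF finite_edges[OF step.prems(1)]])
      moreover have "card {{0, 2}, {1, 3::nat}} = 2" by (auto simp: doubleton_eq_iff)
      ultimately show ?thesis using n by simp
    qed
  qed
qed

section \<open>Blockers as relations\<close>

definition adj :: "nat set set \<Rightarrow> nat \<Rightarrow> nat \<Rightarrow> bool" where
  "adj B i j \<longleftrightarrow> {i, j} \<in> B"

lemma interleave_iff:
  assumes "a < b" "c < d"
  shows "interleave {a, b} {c, d} \<longleftrightarrow> a < c \<and> c < b \<and> b < d"
proof
  assume "interleave {a, b} {c, d}"
  then obtain a' b' c' d' where "{a, b} = {a', b'}" "{c, d} = {c', d'}" "a' < c'" "c' < b'" "b' < d'"
    unfolding interleave_def by blast
  then show "a < c \<and> c < b \<and> b < d" using assms by (auto simp: doubleton_eq_iff)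
next
  assume "a < c \<and> c < b \<and> b < d"
  then show "interleave {a, b} {c, d}" unfolding interleave_def
    by (intro exI[of _ a] exI[of _ b] exI[of _ c] exI[of _ d]) simp
qed

lemma crosses_iff:
  "a < b \<Longrightarrow> c < d \<Longrightarrow> crosses {a, b} {c, d} \<longleftrightarrow> a < c \<and> c < b \<and> b < d \<or> c < a \<and> a < d \<and> d < b"
  unfolding crosses_def by (simp add: interleave_iff)

lemma crosses_sym: "crosses e f \<longleftrightarrow> crosses f e"
  unfolding crosses_def by blast

lemma diagonals_iff:
  assumes "a < b"
  shows "{a, b} \<in> diagonals n \<longleftrightarrow> Suc a < b \<and> b < n \<and> \<not> (a = 0 \<and> b = n - 1)"
proof
  assume "{a, b} \<in> diagonals n"
  then obtain i j where "{a, b} = {i, j}" "i < j" "j < n" "j \<noteq> i + 1" "\<not> (i = 0 \<and> j = n - 1)"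
    unfolding diagonals_def is_diagonal_def by (elim CollectE exE conjE)
  then show "Suc a < b \<and> b < n \<and> \<not> (a = 0 \<and> b = n - 1)" using assms by (auto simp: doubleton_eq_iff)
next
  assume "Suc a < b \<and> b < n \<and> \<not> (a = 0 \<and> b = n - 1)"
  then show "{a, b} \<in> diagonals n" unfolding diagonals_def is_diagonal_def
    by (intro CollectI exI[of _ a] exI[of _ b]) auto
qed

lemma diagonalsE:
  assumes "e \<in> diagonals n"
  obtains a b where "e = {a, b}" "a < b" "Suc a < b" "b < n" "\<not> (a = 0 \<and> b = n - 1)"
proof -
  from assms obtain i j where "e = {i, j}" "i < j" "j < n" "j \<noteq> i + 1" "\<not> (i = 0 \<and> j = n - 1)"
    unfolding diagonals_def is_diagonal_def by blast
  then show ?thesis using that[of i j] by simp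
qed

lemma chords_adj:
  assumes "B \<subseteq> diagonals n" shows "chords n (adj B)"
proof (rule chordsI)
  fix i j assume "adj B i j"
  then have B: "{i, j} \<in> B" by (simp add: adj_def)
  then have "{i, j} \<in> diagonals n" using assms by auto
  then obtain a b where "{i, j} = {a, b}" "a < b" "Suc a < b" "b < n" "\<not> (a = 0 \<and> b = n - 1)"
    by (rule diagonalsE)
  then have "i < n \<and> j < n \<and> i \<noteq> j \<and> j \<noteq> Suc i \<and> (i = n - 1 \<longrightarrow> j \<noteq> 0)"
    by (auto simp: doubleton_eq_iff)
  then show "adj B j i \<and> i < n \<and> j < n \<and> i \<noteq> j \<and> j \<noteq> Suc i \<and> (i = n - 1 \<longrightarrow> j \<noteq> 0)"
    using B by (simp add: adj_def insert_commute)
qed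

lemma edges_adj:
  assumes "B \<subseteq> diagonals n" shows "edges (adj B) = B"
proof
  show "edges (adj B) \<subseteq> B" by (auto simp: edges_def adj_def)
  show "B \<subseteq> edges (adj B)"
  proof
    fix e assume e: "e \<in> B"
    then obtain i j where "e = {i, j}" using assms by (meson diagonalsE subsetD)
    then show "e \<in> edges (adj B)" using e by (auto simp: edges_def adj_def)
  qed
qed

text \<open>The closing edge \<open>{i, j}\<close> is exempt from maximality: it is a side of the
  arc's polygon, so \<open>T\<close> may contain it or not. This freedom is what makes arcs
  glueable.\<close>

definition spans :: "nat set set \<Rightarrow> nat \<Rightarrow> nat \<Rightarrow> bool" where
  "spans T i j \<longleftrightarrow> (\<forall>e\<in>T. \<exists>a b. e = {a, b} \<and> i \<le> a \<and> Suc a < b \<and> b \<le> j) \<and> non_crossing T \<and>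
     (\<forall>a b. i \<le> a \<longrightarrow> Suc a < b \<longrightarrow> b \<le> j \<longrightarrow> (a, b) \<noteq> (i, j) \<longrightarrow> {a, b} \<notin> T \<longrightarrow> (\<exists>f\<in>T. crosses {a, b} f))"

lemma spansD:
  assumes "spans T i j"
  shows "non_crossing T"
    and "e \<in> T \<Longrightarrow> \<exists>a b. e = {a, b} \<and> i \<le> a \<and> Suc a < b \<and> b \<le> j"
    and "i \<le> a \<Longrightarrow> Suc a < b \<Longrightarrow> b \<le> j \<Longrightarrow> (a, b) \<noteq> (i, j) \<Longrightarrow> {a, b} \<notin> T \<Longrightarrow> \<exists>f\<in>T. crosses {a, b} f"
  using assms unfolding spans_def by blast+

lemma non_crossing_Un:
  assumes "non_crossing T" "non_crossing U" "\<And>e f. e \<in> T \<Longrightarrow> f \<in> U \<Longrightarrow> \<not> crosses e f"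
  shows "non_crossing (T \<union> U)"
  using assms crosses_sym unfolding non_crossing_def by blast

text \<open>Maximality for a chord over \<open>k\<close> other than \<open>{i, j}\<close>: it starts
  after \<open>i\<close> or ends before \<open>j\<close>, and so crosses \<open>{i, k}\<close> or
  \<open>{k, j}\<close>.\<close>

lemma spans_Un:
  assumes T: "spans T i k" and U: "spans U k j" and "i < k" "k < j"
    and "Suc i < k \<Longrightarrow> {i, k} \<in> T" "Suc k < j \<Longrightarrow> {k, j} \<in> U"
  shows "spans (T \<union> U) i j"
  unfolding spans_def
proof (intro conjI allI impI ballI)
  fix e assume "e \<in> T \<union> U"
  then show "\<exists>a b. e = {a, b} \<and> i \<le> a \<and> Suc a < b \<and> b \<le> j"
  proof
    assume "e \<in> T"
    then obtain a b where "e = {a, b}" "i \<le> a" "Suc a < b" "b \<le> k" using T unfolding spans_def by blast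
    then show ?thesis using \<open>k < j\<close> by (intro exI[of _ a] exI[of _ b]) auto
  next
    assume "e \<in> U"
    then obtain a b where "e = {a, b}" "k \<le> a" "Suc a < b" "b \<le> j" using U unfolding spans_def by blast
    then show ?thesis using \<open>i < k\<close> by (intro exI[of _ a] exI[of _ b]) auto
  qed
next
  show "non_crossing (T \<union> U)"
  proof (rule non_crossing_Un)
    show "non_crossing T" "non_crossing U" using T U unfolding spans_def by auto
    fix e f assume "e \<in> T" "f \<in> U"
    then obtain a b c d where "e = {a, b}" "Suc a < b" "b \<le> k" "f = {c, d}" "k \<le> c" "Suc c < d"
      using spansD(2)[OF T, of e] spansD(2)[OF U, of f] by blast
    then show "\<not> crosses e f" by (auto simp: crosses_iff)
  qed
next
  fix a b assume ab: "i \<le> a" "Suc a < b" "b \<le> j" "(a, b) \<noteq> (i, j)" "{a, b} \<notin> T \<union> U"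
  consider "b \<le> k" | "k \<le> a" | "a < k" "k < b" by linarith
  then show "\<exists>f\<in>T \<union> U. crosses {a, b} f"
  proof cases
    case 1
    have "(a, b) \<noteq> (i, k)" using 1 ab assms(5) by auto
    then show ?thesis using spansD(3)[OF T, of a b] ab 1 by blast
  next
    case 2
    have "(a, b) \<noteq> (k, j)" using 2 ab assms(6) by auto
    then show ?thesis using spansD(3)[OF U, of a b] ab 2 by blast
  next
    case 3
    show ?thesis
    proof (cases "a = i")
      case True
      then have "crosses {a, b} {k, j}" "{k, j} \<in> U" using 3 ab assms(6) by (auto simp: crosses_iff)
      then show ?thesis by blast
    next
      case False
      then have "crosses {a, b} {i, k}" "{i, k} \<in> T" using 3 ab assms(5) by (auto simp: crosses_iff)
      then show ?thesis by blast
    qed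
  qed
qed

lemma spans_insert:
  assumes T: "spans T i j" and ij: "Suc i < j"
  shows "spans (insert {i, j} T) i j"
  unfolding spans_def
proof (intro conjI allI impI ballI)
  fix e assume "e \<in> insert {i, j} T"
  then show "\<exists>a b. e = {a, b} \<and> i \<le> a \<and> Suc a < b \<and> b \<le> j"
    using T ij unfolding spans_def by blast
next
  have "non_crossing ({{i, j}} \<union> T)"
  proof (rule non_crossing_Un)
    show "non_crossing {{i, j}}" using ij by (simp add: non_crossing_def crosses_iff)
    show "non_crossing T" using T unfolding spans_def by auto
    fix e f assume "e \<in> {{i, j}}" "f \<in> T"
    then obtain c d where "e = {i, j}" "f = {c, d}" "i \<le> c" "Suc c < d" "d \<le> j"
      using spansD(2)[OF T, of f] by blast
    then show "\<not> crosses e f" using ij by (auto simp: crosses_iff)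
  qed
  then show "non_crossing (insert {i, j} T)" by simp
next
  fix a b assume "i \<le> a" "Suc a < b" "b \<le> j" "(a, b) \<noteq> (i, j)" "{a, b} \<notin> insert {i, j} T"
  then show "\<exists>f\<in>insert {i, j} T. crosses {a, b} f" using T unfolding spans_def by blast
qed

lemma good_spans:
  assumes "good (adj B) i j"
  shows "\<exists>T. spans T i j \<and> T \<inter> B = {} \<and> (Suc i < j \<longrightarrow> {i, j} \<in> T)"
  using assms
proof (induction rule: good.induct)
  case (good_side i)
  have "spans {} i (Suc i)" by (auto simp: spans_def non_crossing_def)
  then show ?case by (intro exI[of _ "{}"]) simp
next
  case (good_split i j k)
  then obtain T U where TU: "spans T i k" "T \<inter> B = {}" "Suc i < k \<longrightarrow> {i, k} \<in> T"
    "spans U k j" "U \<inter> B = {}" "Suc k < j \<longrightarrow> {k, j} \<in> U" by blast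
  have k: "i < k" "k < j" using good_split good_less by auto
  have "spans (T \<union> U) i j" using spans_Un TU k by simp
  then have "spans (insert {i, j} (T \<union> U)) i j" using spans_insert k by simp
  moreover have "insert {i, j} (T \<union> U) \<inter> B = {}" using TU good_split.hyps(1) by (auto simp: adj_def)
  ultimately show ?case by blast
qed

lemma tri_triangulation:
  assumes "tri (adj B) n"
  shows "\<exists>T. triangulation n T \<and> B \<inter> T = {}"
proof -
  obtain k where k: "good (adj B) 0 k" "good (adj B) k (n - 1)" using assms tri_def by auto
  then have kn: "0 < k" "k < n - 1" using good_less by auto
  obtain T U where TU: "spans T 0 k" "T \<inter> B = {}" "Suc 0 < k \<longrightarrow> {0, k} \<in> T"
    "spans U k (n - 1)" "U \<inter> B = {}" "Suc k < n - 1 \<longrightarrow> {k, n - 1} \<in> U" using good_spans[OF k(1)] good_spans[OF k(2)] by blast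
  let ?T = "T \<union> U"
  have s: "spans ?T 0 (n - 1)" using spans_Un TU kn by simp
  have "?T \<subseteq> diagonals n"
  proof
    fix e assume e: "e \<in> ?T"
    then obtain a b where ab: "e = {a, b}" "Suc a < b" "b \<le> n - 1" using spansD(2)[OF s e] by blast
    have "\<not> (a = 0 \<and> b = n - 1)"
    proof
      assume *: "a = 0 \<and> b = n - 1"
      from e show False
      proof
        assume "e \<in> T"
        then obtain c d where "e = {c, d}" "Suc c < d" "d \<le> k" using spansD(2)[OF TU(1), of e] by blast
        then show False using ab * kn by (auto simp: doubleton_eq_iff)
      next
        assume "e \<in> U"
        then obtain c d where "e = {c, d}" "k \<le> c" "Suc c < d" using spansD(2)[OF TU(4), of e] by blast
        then show False using ab * kn by (auto simp: doubleton_eq_iff)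
      qed
    qed
    then show "e \<in> diagonals n" using ab kn by (simp add: diagonals_iff)
  qed
  moreover have "\<not> non_crossing (insert e ?T)" if e: "e \<in> diagonals n" "e \<notin> ?T" for e
  proof -
    obtain a b where ab: "e = {a, b}" "a < b" "Suc a < b" "b < n" "\<not> (a = 0 \<and> b = n - 1)"
      by (rule diagonalsE[OF e(1)])
    then have "\<exists>f\<in>?T. crosses {a, b} f" using spansD(3)[OF s, of a b] e(2) by auto
    then obtain f where "f \<in> ?T" "crosses e f" using ab by blast
    then show ?thesis unfolding non_crossing_def by blast
  qed
  ultimately have "triangulation n ?T" using spansD(1)[OF s] unfolding triangulation_def by blast
  moreover have "B \<inter> ?T = {}" using TU(2,5) by blast
  ultimately show ?thesis by blast
qed

text \<open>The apex is the greatest \<open>k\<close> joined to \<open>i\<close> below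
  \<open>j\<close>. If \<open>{k, j}\<close> were missing, some edge of \<open>T\<close> would cross
  it; as that edge crosses neither \<open>{i, j}\<close> nor \<open>{i, k}\<close>, it would start
  at \<open>i\<close> and end beyond \<open>k\<close>.\<close>

lemma triangulation_apex:
  assumes T: "triangulation n T"
    and ij: "Suc i < j" "j < n" "{i, j} \<in> T \<or> i = 0 \<and> j = n - 1"
  shows "\<exists>k. i < k \<and> k < j \<and> ({i, k} \<in> T \<or> k = Suc i) \<and> ({k, j} \<in> T \<or> j = Suc k)"
proof -
    define P where "P k \<longleftrightarrow> k < j \<and> i < k \<and> ({i, k} \<in> T \<or> k = Suc i)" for k
    have P1: "P (Suc i)" using ij by (simp add: P_def)
    have bound: "\<And>k. P k \<Longrightarrow> k \<le> j" by (simp add: P_def)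
    define k where "k = Greatest P"
    have Pk: "P k" unfolding k_def by (rule GreatestI_nat[of P, OF P1 bound])
    have max: "\<And>l. P l \<Longrightarrow> l \<le> k" unfolding k_def by (rule Greatest_le_nat[of P _ j]) (use bound in auto)
    have "{k, j} \<in> T \<or> j = Suc k"
    proof (rule ccontr)
      assume neg: "\<not> ({k, j} \<in> T \<or> j = Suc k)"
      have kj: "Suc k < j" "i < k" using Pk neg by (auto simp: P_def)
      then have "{k, j} \<in> diagonals n" using ij by (auto simp: diagonals_iff)
      then have "\<not> non_crossing (insert {k, j} T)" using T neg unfolding triangulation_def by blast
      moreover have "non_crossing T" using T unfolding triangulation_def by blast
      moreover have "\<not> crosses {k, j} {k, j}" using kj by (simp add: crosses_iff)
      ultimately obtain f where f: "f \<in> T" "crosses {k, j} f"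
        unfolding non_crossing_def using crosses_sym by (metis insert_iff)
      then have "f \<in> diagonals n" using T unfolding triangulation_def by blast
      then obtain a b where ab: "f = {a, b}" "a < b" "Suc a < b" "b < n" "\<not> (a = 0 \<and> b = n - 1)"
        by (rule diagonalsE)
      have cr: "k < a \<and> a < j \<and> j < b \<or> a < k \<and> k < b \<and> b < j"
        using f(2) ab kj by (auto simp: crosses_iff)
      have ncij: "\<not> (i < a \<and> a < j \<and> j < b)" "\<not> (a < i \<and> i < b \<and> b < j)"
      proof -
        have "\<not> crosses {i, j} {a, b} \<or> (i = 0 \<and> j = n - 1)"
          using ij(3) f(1) ab \<open>non_crossing T\<close> unfolding non_crossing_def by blast
        then show "\<not> (i < a \<and> a < j \<and> j < b)" "\<not> (a < i \<and> i < b \<and> b < j)"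
          using ij ab by (auto simp: crosses_iff)
      qed
      have ncik: "\<not> (i < a \<and> a < k \<and> k < b)"
      proof -
        have "\<not> crosses {i, k} {a, b} \<or> k = Suc i"
          using Pk f(1) ab \<open>non_crossing T\<close> unfolding non_crossing_def P_def by blast
        then show ?thesis using kj ab by (auto simp: crosses_iff)
      qed
      have "a = i" "k < b" "b < j" using cr ncij ncik kj by auto
      then have "P b" using f(1) ab by (simp add: P_def)
      then show False using max[of b] \<open>k < b\<close> by simp
    qed
    then show ?thesis using Pk unfolding P_def by blast
  qed

lemma triangulation_good:
  assumes T: "triangulation n T" and B: "B \<inter> T = {}"
    and "i < j" "j < n" "{i, j} \<in> T \<or> j = Suc i"
  shows "good (adj B) i j"
  using assms(3-5)
proof (induction "j - i" arbitrary: i j rule: less_induct)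
  case less
  show ?case
  proof (cases "j = Suc i")
    case True then show ?thesis using good_side by simp
  next
    case False
    then obtain k where k: "i < k" "k < j" "{i, k} \<in> T \<or> k = Suc i" "{k, j} \<in> T \<or> j = Suc k"
      using triangulation_apex[OF T, of i j] less.prems by auto
    have "good (adj B) i k" "good (adj B) k j" using less.hyps[of k i] less.hyps[of j k] k less.prems by auto
    moreover have "\<not> adj B i j" using False less.prems B by (auto simp: adj_def)
    ultimately show ?thesis using good_split by blast
  qed
qed

lemma blocker_iff:
  assumes "n \<ge> 3" "B \<subseteq> diagonals n"
  shows "blocker n B \<longleftrightarrow> \<not> tri (adj B) n"
proof
  assume "blocker n B"
  then show "\<not> tri (adj B) n" using tri_triangulation[of B n] unfolding blocker_def by blast
next
  assume nt: "\<not> tri (adj B) n"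
  have "B \<inter> T \<noteq> {}" if T: "triangulation n T" for T
  proof
    assume B: "B \<inter> T = {}"
    obtain k where k: "0 < k" "k < n - 1" "{0, k} \<in> T \<or> k = Suc 0" "{k, n - 1} \<in> T \<or> n - 1 = Suc k"
    proof -
      have "Suc 0 < n - 1" "n - 1 < n" using assms(1) by auto
      then show ?thesis using triangulation_apex[OF T, of 0 "n - 1"] that by blast
    qed
    have "good (adj B) 0 k" "good (adj B) k (n - 1)"
      using triangulation_good[OF T B] k by auto
    then show False using nt tri_def by blast
  qed
  then show "blocker n B" using assms(2) unfolding blocker_def by blast
qed

section \<open>Blockers of minimum size\<close>

text \<open>A single function \<open>F\<close> encodes both kinds of edges \<open>{F z, z}\<close>: the ears \<open>{z - 2, z}\<close> for \<open>z \<le> m + 2\<close>, and the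
  edge of the vertex \<open>z = m + 2 + j\<close> to \<open>i\<^sub>j\<close> for \<open>z \<ge> m + 3\<close>. As \<open>F z < z\<close>, distinct \<open>z\<close> give distinct edges.
  \<open>tame\<close> is the crossing condition on the latter edges.\<close>

definition arc :: "nat \<Rightarrow> (nat \<Rightarrow> nat \<Rightarrow> bool) \<Rightarrow> nat \<Rightarrow> (nat \<Rightarrow> nat) \<Rightarrow> bool" where
  "arc n R m F \<longleftrightarrow> m + 3 \<le> n \<and> (\<forall>z. 2 \<le> z \<longrightarrow> z \<le> m + 2 \<longrightarrow> F z = z - 2) \<and>
     (\<forall>z. m + 3 \<le> z \<longrightarrow> z < n \<longrightarrow> F z \<le> m + 2) \<and> (\<forall>z. 2 \<le> z \<longrightarrow> z < n \<longrightarrow> R (F z) z)"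

definition tame :: "nat \<Rightarrow> nat \<Rightarrow> (nat \<Rightarrow> nat) \<Rightarrow> bool" where
  "tame n m F \<longleftrightarrow> (\<forall>y z. m + 3 \<le> y \<longrightarrow> y < z \<longrightarrow> z < n \<longrightarrow> F z \<le> F y + 1)"

text \<open>The two inequations say that the run cannot be prolonged: \<open>{m + 1, m + 3}\<close>
  is the ear of \<open>m + 2\<close>, and \<open>{1, n - 1}\<close> is the ear of
  \<open>0\<close>.\<close>

definition proper :: "nat \<Rightarrow> nat \<Rightarrow> (nat \<Rightarrow> nat) \<Rightarrow> bool" where
  "proper n m F \<longleftrightarrow> (\<forall>z. m + 3 \<le> z \<longrightarrow> z < n \<longrightarrow> 1 \<le> F z \<and> F z \<le> m + 1) \<and>
     (m + 3 < n \<longrightarrow> F (m + 3) \<noteq> m + 1 \<and> F (n - 1) \<noteq> 1)"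

lemma arcD:
  assumes "arc n R m F"
  shows "m + 3 \<le> n" "2 \<le> z \<Longrightarrow> z \<le> m + 2 \<Longrightarrow> F z = z - 2" "m + 3 \<le> z \<Longrightarrow> z < n \<Longrightarrow> F z \<le> m + 2"
    "2 \<le> z \<Longrightarrow> z < n \<Longrightarrow> R (F z) z"
  using assms unfolding arc_def by auto

text \<open>A triangulated arc of more than one side contains a triangle on three consecutive
  vertices, and within \<open>0, \<dots>, m + 2\<close> its long side is an ear in
  \<open>R\<close>.\<close>

lemma arc_good:
  assumes "good R p q" "arc n R m F" "q \<le> m + 2"
  shows "q = Suc p"
  using assms(1,3)
proof (induction rule: good.induct)
  case (good_split i j k)
  have "k < j" using good_split good_less by auto
  then have "k = Suc i" "j = Suc k" using good_split by auto
  then have j: "2 \<le> j" "j - 2 = i" by auto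
  have "F j = i" using arcD(2)[OF assms(2) j(1)] good_split.prems j(2) by simp
  moreover have "R (F j) j" using arcD(4)[OF assms(2) j(1)] arcD(1)[OF assms(2)] good_split.prems by simp
  ultimately show ?case using good_split.hyps(1) by simp
qed simp

text \<open>Discrete intermediate value argument: along the triangles of an \<open>R\<close>-free triangulation the sign of \<open>F z - p\<close>
  cannot change, since \<open>F z \<noteq> p\<close> for its chords and \<open>tame\<close> excludes jumps.\<close>

lemma arc_good_outer:
  assumes "good R p z" and c: "chords n R" and a: "arc n R m F" and t: "tame n m F"
    and "p \<le> m + 1" "m + 3 \<le> z" "z < n"
  shows "F z < p"
  using assms(1,5-)
proof (induction rule: good.induct)
  case (good_split i j k)
  have k: "i < k" "k < j" using good_split good_less by auto
  have RF: "R (F j) j" using arcD(4)[OF a, of j] good_split.prems by simp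
  then have ne: "F j \<noteq> i" using good_split.hyps(1) by auto
  have "F j \<le> i"
  proof (cases "k \<le> m + 2")
    case True
    then have k1: "k = Suc i" using arc_good[OF good_split.hyps(2) a] by simp
    show ?thesis
    proof (cases "k \<le> m + 1")
      case True
      then have "F j < k" using good_split.IH(2) good_split.prems by simp
      then show ?thesis using k1 by simp
    next
      case False
      then have km: "k = m + 2" using \<open>k \<le> m + 2\<close> by simp
      have "F j \<noteq> k"
        using good_not[OF good_split.hyps(3)] RF chordsD(5)[OF c, of "F j" j] by auto
      moreover have "F j \<le> m + 2" using arcD(3)[OF a] good_split.prems by simp
      ultimately show ?thesis using km k1 by simp
    qed
  next
    case False
    then have "F k < i" using good_split.IH(1) good_split.prems k by simp
    moreover have "F j \<le> F k + 1" using t False k good_split.prems unfolding tame_def by simp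
    ultimately show ?thesis by simp
  qed
  then show ?case using ne by simp
qed simp

text \<open>Consider the apex \<open>k\<close> over the side \<open>{0, n - 1}\<close>. By
  \<open>arc_good_outer\<close> a \<open>k\<close> outside the run would need
  \<open>F k < 0\<close>, while \<open>k = 1\<close> forces \<open>F (n - 1) = 0\<close>, although
  \<open>{0, n - 1}\<close> is a side.\<close>

lemma arc_blocked:
  assumes c: "chords n R" and a: "arc n R m F" and t: "tame n m F"
  shows "\<not> tri R n"
proof
  assume "tri R n"
  then obtain k where k: "good R 0 k" "good R k (n - 1)" using tri_def by auto
  have kn: "0 < k" "k < n - 1" using good_less k by auto
  show False
  proof (cases "k \<le> m + 2")
    case False
    moreover have "k < n" using kn by linarith
    ultimately show False using arc_good_outer[OF k(1) c a t] by simp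
  next
    case True
    then have k1: "k = Suc 0" using arc_good[OF k(1) a] by simp
    show False
    proof (cases "m + 3 \<le> n - 1")
      case True
      then have "F (n - 1) = 0" using arc_good_outer[OF k(2) c a t] k1 by simp
      then show False using arcD(4)[OF a, of "n - 1"] True chordsD(7)[OF c, of 0 "n - 1"] by simp
    next
      case False
      then have "n - 1 = 2" using arc_good[OF k(2) a] k1 by simp
      then show False using arcD(1)[OF a] arcD(2,4)[OF a, of 2] False chordsD(7)[OF c, of 0 2] by simp
    qed
  qed
qed

text \<open>Meant for a jump \<open>F y + 1 < F z\<close> with \<open>p = F y + 1\<close>: the fans
  at \<open>y\<close> over \<open>p, \<dots>, y\<close> and \<open>y, \<dots>, z\<close> miss
  \<open>F y\<close>, and \<open>z\<close> is joined to \<open>0, \<dots>, p\<close>, all below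
  \<open>F z\<close>. The exception for \<open>j = 0\<close> is the side
  \<open>{0, n - 1}\<close>.\<close>

lemma tri_three_fans:
  assumes "0 < p" "good R p y" "good R y z" "z = n - 1 \<or> good R z (n - 1)" "\<And>j. j \<le> p \<Longrightarrow> j \<noteq> 0 \<or> z \<noteq> n - 1 \<Longrightarrow> \<not> R j z"
  shows "tri R n"
proof -
  have g: "good R p z" using assms good_split[of R p z y] by auto
  show ?thesis
  proof (cases "z = n - 1")
    case True
    have "good R 1 z" by (rule good_extend_left[OF g]) (use assms in auto)
    then show ?thesis unfolding tri_def using True good_side[of R 0] by auto
  next
    case False
    have "good R 0 z" by (rule good_extend_left[OF g]) (use assms False in auto)
    then show ?thesis unfolding tri_def using False assms(4) by auto
  qed
qed

lemma rot_surj: "y < n \<Longrightarrow> \<exists>y' < n. (y' + r) mod n = (y::nat)"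
proof -
  assume y: "y < n"
  have inj: "inj_on (\<lambda>v. (v + r) mod n) {..<n}" by (auto simp: inj_on_def mod_add_right_eq_iff)
  have "(\<lambda>v. (v + r) mod n) ` {..<n} = {..<n}"
    by (rule endo_inj_surj) (use inj y in auto)
  then show ?thesis using y by (metis (no_types, lifting) image_iff lessThan_iff)
qed

lemma nbrs_rot:
  assumes c: "chords n R" and "y < n"
  shows "card {j. rot n r R y j} = card {j. R ((y + r) mod n) j}"
proof -
  have inj: "inj_on (\<lambda>v. (v + r) mod n) {..<n}" by (auto simp: inj_on_def mod_add_right_eq_iff)
  have "{j. R ((y + r) mod n) j} = (\<lambda>v. (v + r) mod n) ` {j. rot n r R y j}"
  proof (intro set_eqI iffI)
    fix j assume "j \<in> {j. R ((y + r) mod n) j}"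
    then have j: "R ((y + r) mod n) j" by simp
    then obtain j' where "j' < n" "(j' + r) mod n = j" using rot_surj chordsD(3)[OF c] by blast
    then show "j \<in> (\<lambda>v. (v + r) mod n) ` {j. rot n r R y j}"
      using j assms(2) by (intro image_eqI[of _ _ j']) (auto simp: rot_def)
  qed (auto simp: rot_def)
  moreover have "inj_on (\<lambda>v. (v + r) mod n) {j. rot n r R y j}"
    by (rule inj_on_subset[OF inj]) (auto simp: rot_def)
  ultimately show ?thesis by (simp add: card_image)
qed

lemma cut_blocked:
  assumes c: "chords n R" and n: "n \<ge> 2" and x: "x < n" "\<not> ear n R x" and t: "\<not> tri R n"
  shows "chords (n - 1) (cut n (rot n (x + 1) R))" "\<not> tri (cut n (rot n (x + 1) R)) (n - 1)"
    "card (edges R) = card (edges (cut n (rot n (x + 1) R))) + card {j. R x j}"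
proof -
  let ?R = "rot n (x + 1) R"
  have c': "chords n ?R" using c chords_rot by auto
  have e: "\<not> ear n ?R (n - 1)" using ear_rot[of "n - 1" n "x + 1" R] x rot_to_last[OF x(1)] by simp
  have t': "\<not> tri ?R n" using tri_rot[OF c, of "x + 1"] t x by simp
  show "chords (n - 1) (cut n ?R)" using chords_cut[OF c' e n] .
  show "\<not> tri (cut n ?R) (n - 1)" using tri_cut[OF c' e n] t' by blast
  have "card {j. ?R (n - 1) j} = card {j. R x j}"
    using nbrs_rot[OF c, of "n - 1" "x + 1"] rot_to_last[OF x(1)] x by simp
  then show "card (edges R) = card (edges (cut n ?R)) + card {j. R x j}"
    using edges_cut[OF c'] edges_rot(2)[OF c, of "x + 1"] x by simp
qed

text \<open>The polygon without \<open>x\<close> is still blocked and needs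
  \<open>(n - 1) - 2\<close> edges of its own.\<close>

lemma deg_le:
  assumes c: "chords n R" and n: "n \<ge> 4" and x: "x < n" "\<not> ear n R x" and t: "\<not> tri R n"
  shows "card {j. R x j} + (n - 3) \<le> card (edges R)"
proof -
  have n2: "n \<ge> 2" "n - 1 \<ge> 3" using n by auto
  show ?thesis
    using blocked_card[OF cut_blocked(1)[OF c n2(1) x t] n2(2) cut_blocked(2)[OF c n2(1) x t]]
      cut_blocked(3)[OF c n2(1) x t] by simp
qed

text \<open>The polygon without \<open>x\<close> is still blocked, so none of its vertices is
  isolated in it.\<close>

lemma other_nbr:
  assumes c: "chords n R" and n: "n \<ge> 4" and x: "x < n" "\<not> ear n R x" and t: "\<not> tri R n"
    and y: "y < n" "y \<noteq> x"
  shows "\<exists>j. R y j \<and> j \<noteq> x"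
proof -
  let ?R = "cut n (rot n (x + 1) R)"
  obtain y' where y': "y' < n" "(y' + (x + 1)) mod n = y" using rot_surj y by blast
  then have "y' \<noteq> n - 1" using y rot_to_last[OF x(1)] by auto
  then have "y' < n - 1" using y' by simp
  have n2: "n \<ge> 2" "n - 1 \<ge> 3" using n by auto
  obtain j where "?R y' j"
    using isolated_tri[OF cut_blocked(1)[OF c n2(1) x t] n2(2) \<open>y' < n - 1\<close>] cut_blocked(2)[OF c n2(1) x t] by blast
  then have j: "j < n - 1" "R y ((j + (x + 1)) mod n)" using y' by (auto simp: cut_def rot_def)
  have "(j + (x + 1)) mod n \<noteq> x"
  proof
    assume "(j + (x + 1)) mod n = x"
    then have "(j + (x + 1)) mod n = (n - 1 + (x + 1)) mod n" using rot_to_last[OF x(1)] by simp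
    then have "j = n - 1" using mod_add_right_eq_iff[of j n "n - 1" "x + 1"] j by linarith
    then show False using j by simp
  qed
  then show ?thesis using j by blast
qed

lemma unique_if_card_le_1: "finite A \<Longrightarrow> card A \<le> 1 \<Longrightarrow> a \<in> A \<Longrightarrow> b \<in> A \<Longrightarrow> a = b"
  by (metis card_le_Suc0_iff_eq One_nat_def)

text \<open>If a further ear followed the run \<open>1, \<dots>, t - 1\<close>, let \<open>b\<close> be the last vertex before it: the fan from \<open>b\<close>
  over \<open>0, \<dots>, b\<close> and the fan from \<open>0\<close> over \<open>b, \<dots>, n - 1\<close> would avoid \<open>R\<close>.\<close>

lemma arc_exists_aux:
  assumes c: "chords n R" and n: "n \<ge> 5" and nt: "\<not> tri R n" and e0: "\<not> ear n R 0" and e1: "ear n R 1"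
    and uniq: "\<And>x i j. x < n \<Longrightarrow> \<not> ear n R x \<Longrightarrow> R x i \<Longrightarrow> R x j \<Longrightarrow> i = j"
    and indep: "\<And>x y. \<not> ear n R x \<Longrightarrow> \<not> ear n R y \<Longrightarrow> \<not> R x y"
  shows "\<exists>m F. 1 \<le> m \<and> arc n R m F \<and> tame n m F \<and> proper n m F"
proof -
  have sym: "R i j \<Longrightarrow> R j i" for i j using chordsD(1)[OF c] .
  have R02: "R 0 2" using e1 ear_mid[of 1 n R] n by (simp add: numeral_2_eq_2)
  define P where "P t \<longleftrightarrow> 2 \<le> t \<and> t < n \<and> \<not> ear n R t" for t
  have "\<exists>t. P t"
  proof (rule ccontr)
    assume "\<not> (\<exists>t. P t)"
    then have "ear n R (n - 1)" using n by (auto simp: P_def)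
    then have "R 0 (n - 2)" using ear_last[of n R] n sym by simp
    then show False using uniq[OF _ e0 R02] n by fastforce
  qed
  define t where "t = Least P"
  have Pt: "P t" unfolding t_def using \<open>\<exists>t. P t\<close> by (rule LeastI_ex)
  have least: "\<And>s. P s \<Longrightarrow> t \<le> s" unfolding t_def by (rule Least_le)
  have tn: "2 \<le> t" "t < n" "\<not> ear n R t" using Pt by (auto simp: P_def)
  have "t \<noteq> 2" using indep[OF e0 tn(3)] R02 by auto
  then have t3: "3 \<le> t" using tn by simp
  have ears: "ear n R s" if "1 \<le> s" "s < t" for s
    using that e1 least[of s] tn unfolding P_def by (cases "s = 1") auto
  have nonears: "\<not> ear n R u" if u: "t \<le> u" "u < n" for u
  proof
    assume eu: "ear n R u"
    define Q where "Q v \<longleftrightarrow> t \<le> v \<and> v < n \<and> ear n R v" for v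
    define v where "v = Least Q"
    have "Q u" using u eu by (simp add: Q_def)
    then have Qv: "Q v" unfolding v_def by (rule LeastI)
    have leastv: "\<And>w. Q w \<Longrightarrow> v \<le> w" unfolding v_def by (rule Least_le)
    define b where "b = v - 1"
    have vt: "t \<noteq> v" using Qv tn by (auto simp: Q_def)
    have vb: "v = Suc b" using vt Qv tn by (auto simp: b_def Q_def)
    have b: "t \<le> b" "b < n" "\<not> ear n R b" "ear n R v" "v < n"
      using vt vb Qv leastv[of b] tn by (auto simp: Q_def)
    show False
    proof (cases "v = n - 1")
      case True
      then have "R (n - 2) 0" using b(4) ear_last[of n R] n by simp
      moreover have "b = n - 2" using True vb by simp
      ultimately show False using indep[OF b(3) e0] by simp
    next
      case False
      then have Rb: "R b (Suc v)" using b vb ear_mid[of v n R] tn by simp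
      \<comment> \<open>The only neighbour of \<open>b\<close> is \<open>Suc v\<close>, and the only
        neighbour of \<open>0\<close> is \<open>2\<close>, which lies below \<open>b\<close>. So
        neither fan meets \<open>R\<close>.\<close>
      have "good R 0 b"
      proof (rule good_fan_right)
        fix j assume "Suc j < b"
        show "\<not> R j b"
        proof
          assume "R j b"
          then have "j = Suc v" using uniq[OF b(2,3) Rb] sym by auto
          then show False using \<open>Suc j < b\<close> vb by simp
        qed
      qed (use b t3 in simp)
      then have "good R 0 (n - 2)"
      proof (rule good_extend_right)
        fix j assume "b < j"
        show "\<not> R 0 j"
        proof
          assume "R 0 j"
          then have "j = 2" using uniq[OF _ e0 R02] n by simp
          then show False using \<open>b < j\<close> b t3 by simp
        qed
      qed (use b False vb in simp)
      moreover have "good R (n - 2) (n - 1)" using n by (intro good_side') simp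
      ultimately show False using nt tri_def by auto
    qed
  qed
  define m where "m = t - 2"
  have m: "1 \<le> m" "t = m + 2" using t3 by (auto simp: m_def)
  define F where "F z = (if z \<le> m + 2 then z - 2 else (SOME j. R z j))" for z
  have RF: "R z (F z)" if "m + 3 \<le> z" "z < n" for z
  proof -
    have "\<exists>j. R z j" using isolated_tri[OF c, of z] nt n that by auto
    then have "R z (SOME j. R z j)" by (rule someI_ex)
    then show ?thesis using that by (simp add: F_def)
  qed
  have Frange: "1 \<le> F z \<and> F z \<le> m + 1" if z: "m + 3 \<le> z" "z < n" for z
  proof -
    have "\<not> ear n R z" using nonears z m by simp
    then have e: "ear n R (F z)" using indep RF[OF z] by blast
    have "F z < n" using chordsD(3)[OF c RF[OF z]] .
    then have "\<not> t \<le> F z" using nonears e by blast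
    moreover have "F z \<noteq> 0" using e e0 by metis
    ultimately show ?thesis using m by simp
  qed
  have Funiq: "\<not> R j z" if "m + 3 \<le> z" "z < n" "j \<noteq> F z" for j z
    using uniq[OF that(2) nonears[OF _ that(2)] RF[OF that(1,2)], of j] sym[of j z] that m by auto
  have "arc n R m F"
    unfolding arc_def
  proof (intro conjI allI impI)
    show "m + 3 \<le> n" using m tn by simp
    show "F z = z - 2" if "2 \<le> z" "z \<le> m + 2" for z using that by (simp add: F_def)
    show "F z \<le> m + 2" if "m + 3 \<le> z" "z < n" for z using Frange[OF that] by simp
    show "R (F z) z" if "2 \<le> z" "z < n" for z
    proof (cases "z \<le> m + 2")
      case True
      then have "ear n R (z - 1)" using ears[of "z - 1"] that m by simp
      then have "R (z - 2) z" using ear_mid[of "z - 1" n R] that by (simp add: numeral_2_eq_2)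
      then show ?thesis using True by (simp add: F_def)
    next
      case False
      then show ?thesis using RF[of z] sym that by simp
    qed
  qed
  moreover have "tame n m F"
    unfolding tame_def
  proof (intro allI impI)
    fix y z assume yz: "m + 3 \<le> y" "y < z" "z < n"
    show "F z \<le> F y + 1"
    proof (rule ccontr)
      assume neg: "\<not> F z \<le> F y + 1"
      define p where "p = F y + 1"
      have Fyz: "F y \<le> m + 1" "F z \<le> m + 1" using Frange[of y] Frange[of z] yz by auto
      have "tri R n"
      proof (rule tri_three_fans)
        show "0 < p" by (simp add: p_def)
        show "good R p y" by (rule good_fan_right) (use Fyz yz p_def Funiq[of y] in auto)
        show "good R y z"
          by (rule good_fan_left) (use Fyz yz p_def Funiq[of y] sym[of y] in fastforce)+
        have "good R z (n - 1)" if "z \<noteq> n - 1"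
          by (rule good_fan_left) (use Fyz yz that Funiq[of z] sym[of z] in fastforce)+
        then show "z = n - 1 \<or> good R z (n - 1)" by blast
        show "\<not> R j z" if "j \<le> p" for j using Funiq[of z j] yz neg that p_def by auto
      qed
      then show False using nt by simp
    qed
  qed
  moreover have "proper n m F"
    unfolding proper_def
  proof (intro conjI allI impI)
    show "1 \<le> F z" "F z \<le> m + 1" if "m + 3 \<le> z" "z < n" for z using Frange[OF that] by auto
    assume mn: "m + 3 < n"
    show "F (m + 3) \<noteq> m + 1"
    proof
      assume "F (m + 3) = m + 1"
      then have "R (m + 1) (m + 3)" using RF[of "m + 3"] sym mn by simp
      then have "ear n R t" using ear_mid[of t n R] m mn by (simp add: numeral_3_eq_3)
      then show False using tn by simp
    qed
    show "F (n - 1) \<noteq> 1"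
    proof
      assume "F (n - 1) = 1"
      then have "R (n - 1) 1" using RF[of "n - 1"] mn by simp
      then show False using e0 ear_0[of n R] n by simp
    qed
  qed
  ultimately show ?thesis using m by blast
qed

text \<open>The labels are rotated so that a vertex without ear is followed by one with an ear. If
  there were no such place, no vertex would have an ear, and independence would isolate
  \<open>x0\<close>.\<close>

lemma arc_exists:
  assumes c: "chords n R" and n: "n \<ge> 5" and nt: "\<not> tri R n" and x0: "x0 < n" "\<not> ear n R x0"
    and uniq: "\<And>x i j. x < n \<Longrightarrow> \<not> ear n R x \<Longrightarrow> R x i \<Longrightarrow> R x j \<Longrightarrow> i = j"
    and indep: "\<And>x y. x < n \<Longrightarrow> y < n \<Longrightarrow> \<not> ear n R x \<Longrightarrow> \<not> ear n R y \<Longrightarrow> \<not> R x y"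
  shows "\<exists>r m F. r < n \<and> 1 \<le> m \<and> arc n (rot n r R) m F \<and> tame n m F \<and> proper n m F"
proof -
  have "\<exists>x < n. \<not> ear n R x \<and> ear n R ((x + 1) mod n)"
  proof (rule ccontr)
    assume neg: "\<not> ?thesis"
    have all: "\<not> ear n R ((x0 + k) mod n)" for k
    proof (induction k)
      case 0 then show ?case using x0 by simp
    next
      case (Suc k)
      have "(x0 + k) mod n < n" using n by simp
      then have "\<not> ear n R (((x0 + k) mod n + 1) mod n)" using Suc neg by blast
      then show ?case by (simp add: mod_simps)
    qed
    have "\<not> ear n R x" if xn: "x < n" for x
    proof -
      obtain k where "(k + x0) mod n = x" using rot_surj[OF xn] by blast
      then show ?thesis using all[of k] by (simp add: add.commute)
    qed
    then have "\<not> R x0 j" for j using indep chordsD(2,3)[OF c, of x0 j] by blast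
    then show False using isolated_tri[OF c _ x0(1)] nt n by simp
  qed
  then obtain x where x: "x < n" "\<not> ear n R x" "ear n R ((x + 1) mod n)" by blast
  let ?R = "rot n x R"
  have "\<exists>m F. 1 \<le> m \<and> arc n ?R m F \<and> tame n m F \<and> proper n m F"
  proof (rule arc_exists_aux)
    show c': "chords n ?R" using chords_rot c by auto
    show "\<not> tri ?R n" using tri_rot[OF c] nt x by simp
    show "\<not> ear n ?R 0" using ear_rot[of 0 n x R] x n by simp
    show "ear n ?R 1" using ear_rot[of 1 n x R] x n by (simp add: add.commute)
    show "i = j" if "y < n" "\<not> ear n ?R y" "?R y i" "?R y j" for y i j
    proof -
      have "\<not> ear n R ((y + x) mod n)" using ear_rot that by blast
      then have "(i + x) mod n = (j + x) mod n" using uniq[of "(y + x) mod n"] that unfolding rot_def by simp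
      then show ?thesis using mod_add_right_eq_iff[of i n j x] that unfolding rot_def by simp
    qed
    show "\<not> ?R y z" if "\<not> ear n ?R y" "\<not> ear n ?R z" for y z
    proof
      assume a: "?R y z"
      then have "y < n" "z < n" "R ((y + x) mod n) ((z + x) mod n)" by (auto simp: rot_def)
      then show False using indep[of "(y + x) mod n" "(z + x) mod n"] ear_rot[of y n x R] ear_rot[of z n x R] that by simp
    qed
  qed (rule n)
  then show ?thesis using x by blast
qed

lemma arc_edges:
  assumes "arc n R m F"
  shows "(\<lambda>z. {F z, z}) ` {2..<n} \<subseteq> edges R" "card ((\<lambda>z. {F z, z}) ` {2..<n}) = n - 2"
proof -
  show "(\<lambda>z. {F z, z}) ` {2..<n} \<subseteq> edges R"
  proof
    fix e assume "e \<in> (\<lambda>z. {F z, z}) ` {2..<n}"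
    then obtain z where "e = {F z, z}" "R (F z) z" using arcD(4)[OF assms] by auto
    then show "e \<in> edges R" unfolding edges_def by blast
  qed
  have less: "F z < z" if "z \<in> {2..<n}" for z
    using that arcD(2,3)[OF assms, of z] by (cases "z \<le> m + 2") auto
  have "inj_on (\<lambda>z. {F z, z}) {2..<n}"
  proof (rule inj_onI)
    fix x y assume "x \<in> {2..<n}" "y \<in> {2..<n}" "{F x, x} = {F y, y}"
    then show "x = y" using less[of x] less[of y] by (auto simp: doubleton_eq_iff)
  qed
  then show "card ((\<lambda>z. {F z, z}) ` {2..<n}) = n - 2" by (simp add: card_image)
qed

text \<open>The arc contributes \<open>n - 2\<close> different edges, so it exhausts
  \<open>R\<close>. Degree one and independence come from \<open>deg_le\<close> and
  \<open>other_nbr\<close>.\<close>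

lemma minimum_blocker_structure:
  assumes c: "chords n R" and n: "n \<ge> 5" and nt: "\<not> tri R n" and card: "card (edges R) = n - 2"
  shows "\<exists>r m F. r < n \<and> 1 \<le> m \<and> arc n (rot n r R) m F \<and> tame n m F \<and> proper n m F \<and>
    (\<forall>i j. i < j \<longrightarrow> (rot n r R i j \<longleftrightarrow> 2 \<le> j \<and> j < n \<and> i = F j))"
proof -
  obtain x0 where x0: "x0 < n" "\<not> ear n R x0" using all_ears_card[OF c n] card n by fastforce
  have uniq: "i = j" if "x < n" "\<not> ear n R x" "R x i" "R x j" for x i j
  proof -
    have "card {j. R x j} \<le> 1" using deg_le[OF c _ that(1,2) nt] n card by simp
    then show ?thesis using unique_if_card_le_1[OF finite_nbrs[OF c]] that by blast
  qed
  have indep: "\<not> R x y" if xy: "x < n" "y < n" "\<not> ear n R x" "\<not> ear n R y" for x y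
  proof
    assume R: "R x y"
    then have "R y x" "y \<noteq> x" using chordsD[OF c R] by auto
    moreover obtain j where "R y j" "j \<noteq> x" using other_nbr[OF c _ xy(1,3) nt xy(2)] n calculation by auto
    ultimately show False using uniq[OF xy(2,4)] by blast
  qed
  obtain r m F where *: "r < n" "1 \<le> m" "arc n (rot n r R) m F" "tame n m F" "proper n m F"
  proof -
    have "\<exists>r m F. r < n \<and> 1 \<le> m \<and> arc n (rot n r R) m F \<and> tame n m F \<and> proper n m F"
      by (rule arc_exists[OF c n nt x0]) (use uniq indep in blast)+
    then show ?thesis using that by blast
  qed
  let ?R = "rot n r R"
  have c': "chords n ?R" using chords_rot c by auto
  have "(\<lambda>z. {F z, z}) ` {2..<n} = edges ?R"
    by (rule card_subset_eq[OF finite_edges[OF c'] arc_edges(1)[OF *(3)]])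
      (use arc_edges(2)[OF *(3)] card edges_rot(2)[OF c, of r] n in simp)
  then have ed: "edges ?R = (\<lambda>z. {F z, z}) ` {2..<n}" by simp
  have "?R i j \<longleftrightarrow> 2 \<le> j \<and> j < n \<and> i = F j" if ij: "i < j" for i j
  proof
    assume "?R i j"
    then have "{i, j} \<in> edges ?R" unfolding edges_def by blast
    then obtain z where z: "2 \<le> z" "z < n" "{i, j} = {F z, z}" unfolding ed by auto
    have "F z < z" using z arcD(2,3)[OF *(3), of z] by (cases "z \<le> m + 2") auto
    then show "2 \<le> j \<and> j < n \<and> i = F j" using z ij by (auto simp: doubleton_eq_iff)
  next
    assume "2 \<le> j \<and> j < n \<and> i = F j"
    then show "?R i j" using arcD(4)[OF *(3)] by simp
  qed
  then show ?thesis using * by blast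
qed

lemma two_le_card: "finite A \<Longrightarrow> a \<in> A \<Longrightarrow> b \<in> A \<Longrightarrow> a \<noteq> b \<Longrightarrow> 2 \<le> card A"
  using unique_if_card_le_1[of A a b] by linarith

text \<open>Both degrees are at least two, and \<open>d\<close>, \<open>e\<close> differ from
  \<open>x\<close> because the degree of the second vertex counts only after \<open>x\<close> is
  gone. The \<open>(n - 1)\<close>-gon then has too few edges for \<open>deg_le\<close>.\<close>

lemma double_removal_last:
  assumes c: "chords n R" and n: "n \<ge> 5" and nt: "\<not> tri R n" and card: "card (edges R) = n - 1"
    and x: "x < n" "\<not> ear n R x" and y: "y < n - 1" "\<not> ear (n - 1) (cut n (rot n (x + 1) R)) y"
    and "R x a" "R x b" "a \<noteq> b" and "R ((y + x + 1) mod n) d" "R ((y + x + 1) mod n) e" "d \<noteq> e" "d \<noteq> x" "e \<noteq> x"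
  shows False
proof -
  let ?R = "cut n (rot n (x + 1) R)"
  have c': "chords (n - 1) ?R" and nt': "\<not> tri ?R (n - 1)" and ce: "card (edges R) = card (edges ?R) + card {j. R x j}"
    using cut_blocked[OF c _ x nt] n by auto
  have "card {j. ?R y j} + (n - 1 - 3) \<le> card (edges ?R)" using deg_le[OF c' _ y nt'] n by simp
  moreover have "2 \<le> card {j. R x j}" using two_le_card[OF finite_nbrs[OF c], of a x b] assms by simp
  moreover have "2 \<le> card {j. ?R y j}"
  proof -
    have "\<exists>d'. ?R y d' \<and> (d' + (x + 1)) mod n = d" if dd: "R ((y + x + 1) mod n) d" "d \<noteq> x" for d
    proof -
      obtain d' where d': "d' < n" "(d' + (x + 1)) mod n = d" using rot_surj[OF chordsD(3)[OF c dd(1)]] by blast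
      then have "d' \<noteq> n - 1" using dd rot_to_last[OF x(1)] by auto
      then have "?R y d'" using d' dd y by (auto simp: cut_def rot_def add.assoc)
      then show ?thesis using d' by blast
    qed
    then obtain d' e' where "?R y d'" "(d' + (x + 1)) mod n = d" "?R y e'" "(e' + (x + 1)) mod n = e"
      using assms by meson
    moreover from this have "d' \<noteq> e'" using \<open>d \<noteq> e\<close> by auto
    ultimately show ?thesis using two_le_card[OF finite_nbrs[OF c']] by simp
  qed
  ultimately show False using ce card n by simp
qed

lemma good_join: "good R i k \<Longrightarrow> good R k j \<Longrightarrow> \<not> R i j \<Longrightarrow> good R i j"
  by (rule good_split)

lemma good_skip: "0 < x \<Longrightarrow> \<not> R (x - 1) (x + 1) \<Longrightarrow> good R (x - 1) (x + 1)"
  by (rule good_join[of R "x - 1" x "x + 1"]) (auto intro: good_side')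

section \<open>Saturated blockers containing an arc\<close>

definition del :: "(nat \<Rightarrow> nat \<Rightarrow> bool) \<Rightarrow> nat \<Rightarrow> nat \<Rightarrow> nat \<Rightarrow> nat \<Rightarrow> bool" where
  "del R a b i j \<longleftrightarrow> R i j \<and> {i, j} \<noteq> {a, b}"

definition sat :: "nat \<Rightarrow> (nat \<Rightarrow> nat \<Rightarrow> bool) \<Rightarrow> bool" where
  "sat n R \<longleftrightarrow> chords n R \<and> 6 \<le> n \<and> card (edges R) = n - 1 \<and> \<not> tri R n \<and>
     (\<forall>a b. R a b \<longrightarrow> tri (del R a b) n)"

lemma satD:
  assumes "sat n R"
  shows "chords n R" "6 \<le> n" "card (edges R) = n - 1" "\<not> tri R n" "R a b \<Longrightarrow> tri (del R a b) n"
  using assms unfolding sat_def by auto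

lemma chords_del:
  assumes c: "chords n R" shows "chords n (del R a b)"
proof (rule chordsI)
  fix i j assume "del R a b i j"
  then have ij: "R i j" "{j, i} \<noteq> {a, b}" by (auto simp: del_def insert_commute)
  then show "del R a b j i \<and> i < n \<and> j < n \<and> i \<noteq> j \<and> j \<noteq> Suc i \<and> (i = n - 1 \<longrightarrow> j \<noteq> 0)"
    using chordsD[OF c ij(1)] unfolding del_def by auto
qed

lemma sat_rot:
  assumes s: "sat n R" shows "sat n (rot n r R)"
  unfolding sat_def
proof (intro conjI allI impI)
  have c: "chords n R" and n: "n > 0" using satD[OF s] by auto
  show "chords n (rot n r R)" using chords_rot[OF c] .
  show "6 \<le> n" using satD[OF s] by simp
  show "card (edges (rot n r R)) = n - 1" using edges_rot(2)[OF c n] satD[OF s] by simp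
  show "\<not> tri (rot n r R) n" using tri_rot[OF c n] satD[OF s] by simp
  fix a b assume ab: "rot n r R a b"
  then have abn: "a < n" "b < n" "R ((a + r) mod n) ((b + r) mod n)" by (auto simp: rot_def)
  let ?D = "del R ((a + r) mod n) ((b + r) mod n)"
  have "tri (rot n r ?D) n" using satD(5)[OF s abn(3)] tri_rot[OF chords_del[OF c] n] by simp
  then show "tri (del (rot n r R) a b) n"
  proof (rule tri_mono)
    fix i j assume "del (rot n r R) a b i j"
    then have ij: "rot n r R i j" "{i, j} \<noteq> {a, b}" by (auto simp: del_def)
    then have "i < n" "j < n" by (auto simp: rot_def)
    then show "rot n r ?D i j" using ij abn
      by (auto simp: rot_def del_def doubleton_eq_iff mod_add_right_eq_iff)
  qed
qed

text \<open>Otherwise \<open>arc_blocked\<close> would show that \<open>R\<close> without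
  \<open>{a, b}\<close> is still a blocker.\<close>

lemma sat_not_tame:
  assumes s: "sat n R" and "arc n (del R a b) m F" "R a b"
  shows "\<not> tame n m F"
  using arc_blocked[OF chords_del[OF satD(1)[OF s]] assms(2)] satD(5)[OF s assms(3)] by blast

text \<open>The arc accounts for \<open>n - 2\<close> of the \<open>n - 1\<close> edges.\<close>

lemma arc_plus_one:
  assumes s: "sat n R" and a: "arc n R m F"
  shows "\<exists>x y. x < y \<and> y < n \<and> R x y \<and> F y \<noteq> x \<and>
    (\<forall>i j. i < j \<longrightarrow> (R i j \<longleftrightarrow> 2 \<le> j \<and> j < n \<and> i = F j \<or> i = x \<and> j = y))"
proof -
  have c: "chords n R" using satD[OF s] by simp
  let ?K = "(\<lambda>z. {F z, z}) ` {2..<n}"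
  have less: "F z < z" if "2 \<le> z" "z < n" for z
    using that arcD(2,3)[OF a, of z] by (cases "z \<le> m + 2") auto
  have "card (edges R - ?K) = 1"
    using card_Diff_subset[OF _ arc_edges(1)[OF a]] arc_edges(2)[OF a] satD(2,3)[OF s] by simp
  then obtain e where e: "edges R - ?K = {e}" using card_1_singletonE by blast
  then have "e \<in> edges R" by blast
  then obtain i j where ij: "e = {i, j}" "R i j" unfolding edges_def by blast
  have "\<exists>x y. e = {x, y} \<and> x < y \<and> R x y"
  proof (cases "i < j")
    case True then show ?thesis using ij by blast
  next
    case False
    then have "j < i" "R j i" "e = {j, i}" using chordsD(1,4)[OF c ij(2)] ij(1) by (simp_all add: insert_commute)
    then show ?thesis by blast
  qed
  then obtain x y where xy0: "e = {x, y}" "x < y" "R x y" by blast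
  then have xy: "e = {x, y}" "x < y" "y < n" "R x y" using chordsD(3)[OF c xy0(3)] by simp_all
  have eK: "e \<notin> ?K" using e by blast
  have 1: "\<not> (2 \<le> y \<and> x = F y)"
  proof
    assume "2 \<le> y \<and> x = F y"
    then have "e = {F y, y}" "y \<in> {2..<n}" using xy by simp_all
    then show False using eK by blast
  qed
  have y2: "2 \<le> y" using chordsD(5)[OF c xy(4)] xy(2) by linarith
  show ?thesis
  proof (rule exI[of _ x], rule exI[of _ y], intro conjI allI impI)
    show "x < y" "y < n" "R x y" by fact+
    show "F y \<noteq> x" using 1 y2 by auto
    fix i j :: nat assume ij: "i < j"
    show "R i j \<longleftrightarrow> 2 \<le> j \<and> j < n \<and> i = F j \<or> i = x \<and> j = y"
    proof
      assume "R i j"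
      then have "{i, j} \<in> edges R" unfolding edges_def by blast
      then have "{i, j} \<in> ?K \<or> {i, j} \<in> edges R - ?K" by simp
      then have "{i, j} \<in> ?K \<or> {i, j} = {x, y}" unfolding e xy(1) by simp
      then show "2 \<le> j \<and> j < n \<and> i = F j \<or> i = x \<and> j = y"
      proof
        assume "{i, j} \<in> ?K"
        then obtain z where z: "2 \<le> z" "z < n" "{i, j} = {F z, z}" by auto
        then show ?thesis using less[OF z(1,2)] ij by (auto simp: doubleton_eq_iff)
      next
        assume "{i, j} = {x, y}"
        then show ?thesis using ij xy(2) by (auto simp: doubleton_eq_iff)
      qed
    next
      assume "2 \<le> j \<and> j < n \<and> i = F j \<or> i = x \<and> j = y"
      then show "R i j" using arcD(4)[OF a, of j] xy(4) by (elim disjE conjE) simp_all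
    qed
  qed
qed

lemma arc_not_tame:
  assumes s: "sat n R" and a: "arc n R m F"
  shows "\<not> tame n m F"
proof -
  obtain x y where "x < y \<and> y < n \<and> R x y \<and> F y \<noteq> x \<and>
    (\<forall>i j. i < j \<longrightarrow> (R i j \<longleftrightarrow> 2 \<le> j \<and> j < n \<and> i = F j \<or> i = x \<and> j = y))"
    using arc_plus_one[OF s a] by (elim exE)
  then have xy: "x < y" "R x y" "F y \<noteq> x" by simp_all
  show ?thesis
  proof (rule sat_not_tame[OF s _ xy(2)])
    show "arc n (del R x y) m F"
      unfolding arc_def
    proof (intro conjI allI impI)
      fix z assume z: "2 \<le> z" "z < n"
      have "F z < z" using z arcD(2,3)[OF a, of z] by (cases "z \<le> m + 2") auto
      then show "del R x y (F z) z" using arcD(4)[OF a z] xy by (auto simp: del_def doubleton_eq_iff)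
    qed (use arcD(1)[OF a] arcD(2,3)[OF a] in auto)
  qed
qed

text \<open>Besides the arc there is exactly one more edge \<open>{x, y}\<close>. If it meets \<open>{0, \<dots>, m + 2}\<close>, fans show that one of
  the edges is superfluous. Otherwise fans show that only the pair \<open>x, y\<close> violates \<open>tame\<close>, and comparing it
  with the vertices between \<open>x\<close> and \<open>y\<close> gives \<open>F y = F x + 2\<close>. Maximality of the arc is needed to triangulate
  around \<open>x\<close> and \<open>y\<close> when they are next to the ends of the arc.\<close>

lemma arc_type3_core:
  assumes s: "sat n R" and a: "arc n R m F"
    and maxr: "m + 3 < n \<Longrightarrow> \<not> R (m + 1) (m + 3)" and maxl: "m + 3 < n \<Longrightarrow> \<not> R (n - 1) 1"
  shows "type3 n (edges R)"
proof -
  have c: "chords n R" and nt: "\<not> tri R n" using satD[OF s] by auto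
  obtain x y where xy0: "x < y \<and> y < n \<and> R x y \<and> F y \<noteq> x \<and>
    (\<forall>i j. i < j \<longrightarrow> (R i j \<longleftrightarrow> 2 \<le> j \<and> j < n \<and> i = F j \<or> i = x \<and> j = y))"
    using arc_plus_one[OF s a] by (elim exE)
  then have xy: "x < y" "y < n" "R x y" "F y \<noteq> x" by simp_all
  have iff: "R i j \<longleftrightarrow> 2 \<le> j \<and> j < n \<and> i = F j \<or> i = x \<and> j = y" if "i < j" for i j
    using xy0 that by simp
  have mn: "m + 3 \<le> n" using arcD(1)[OF a] .
  have Fle: "F z \<le> m + 2" if "m + 3 \<le> z" "z < n" for z using arcD(3)[OF a that] .
  have RF: "R (F z) z" if "2 \<le> z" "z < n" for z using arcD(4)[OF a that] .
  have Fin: "F z = z - 2" if "2 \<le> z" "z \<le> m + 2" for z using arcD(2)[OF a that] .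
  have down: "\<not> R j z" if "j < z" "j \<noteq> F z" "\<not> (j = x \<and> z = y)" for j z using that iff by auto
  have up: "\<not> R z j" if "m + 3 \<le> z" "z < j" "\<not> (z = x \<and> j = y)" for j z
  proof
    assume "R z j"
    then have "j < n" "z = F j" using iff[OF that(2)] that by auto
    then show False using Fle[of j] that by simp
  qed
  have y2: "Suc x < y" using chordsD(5)[OF c xy(3)] xy(1) by linarith
  have Flast: "F (n - 1) \<noteq> 0" if "m + 3 \<le> n - 1"
    using RF[of "n - 1"] chordsD(7)[OF c, of "F (n - 1)" "n - 1"] that by fastforce
  have not_tame: "\<not> tame n m F" using arc_not_tame[OF s a] .
  have outer: "m + 3 \<le> x"
  proof (rule ccontr)
    assume xA: "\<not> m + 3 \<le> x"
    have tame_off: "F v \<le> F u + 1" if uv: "m + 3 \<le> u" "u < v" "v < n" "u \<noteq> y" "v \<noteq> y" for u v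
    proof (rule ccontr)
      assume neg: "\<not> F v \<le> F u + 1"
      have "tri R n"
      proof (rule tri_three_fans[of "F u + 1"])
        show "good R (F u + 1) u"
          by (rule good_fan_right; (intro down)?; use Fle[of u] Fle[of v] neg uv in \<open>auto\<close>)
        show "good R u v" by (rule good_fan_left; (intro up)?; use uv xA in \<open>auto\<close>)
        have "good R v (n - 1)" if "v \<noteq> n - 1"
          by (rule good_fan_left; (intro up)?; use uv that xA in \<open>auto\<close>)
        then show "v = n - 1 \<or> good R v (n - 1)" by blast
        show "\<not> R j v" if "j \<le> F u + 1" for j using that neg uv Fle[of v] by (intro down) auto
      qed simp
      then show False using nt by simp
    qed
    show False
    proof (cases "y \<le> m + 2")
      case True
      then have "tame n m F" unfolding tame_def using tame_off by auto
      then show False using not_tame by simp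
    next
      case False
      define g h where "g = min x (F y)" and "h = max x (F y)"
      have gh: "g < h" "h \<le> m + 2" "{g, h} = {x, F y}"
        using xy(4) xA Fle[of y] xy(2) False by (auto simp: g_def h_def min_def max_def)
      have Ry: "R x y" "R (F y) y" using xy RF[of y] False by auto
      have downy: "\<not> R j y" if "j < y" "j \<noteq> g" "j \<noteq> h" for j
        using that gh(3) iff[of j y] by auto
      \<comment> \<open>Either neighbour of \<open>y\<close> may serve as the value at
        \<open>y\<close>; the arc so obtained survives the deletion of the edge from
        \<open>y\<close> to the other one.\<close>
      have alt: "\<not> tame n m (F(y := w))" if w: "{w, w'} = {g, h}" "w \<noteq> w'" for w w'
      proof (rule sat_not_tame[OF s])
        have "w \<in> {x, F y}" "w' \<in> {x, F y}" using w gh(3) by blast+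
        then have ww: "R w y" "R w' y" "w \<le> m + 2" using Ry xA Fle[of y] False xy(2) by auto
        show "R w' y" by fact
        show "arc n (del R w' y) m (F(y := w))"
          unfolding arc_def
        proof (intro conjI allI impI)
          fix z assume z: "2 \<le> z" "z < n"
          show "del R w' y ((F(y := w)) z) z"
          proof (cases "z = y")
            case True
            then show ?thesis using ww w(2) False by (auto simp: del_def doubleton_eq_iff)
          next
            case zy: False
            have "F z \<noteq> y" using z Fin[of z] Fle[of z] False by (cases "z \<le> m + 2") auto
            then show ?thesis using RF[OF z] zy by (auto simp: del_def doubleton_eq_iff)
          qed
        qed (use mn Fin Fle ww False in auto)
      qed
      have before: "g \<le> F u + 1" if u: "m + 3 \<le> u" "u < y" for u
      proof (rule ccontr)
        assume neg: "\<not> g \<le> F u + 1"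
        have "tri R n"
        proof (rule tri_three_fans[of "F u + 1"])
          show "good R (F u + 1) u"
            by (rule good_fan_right; (intro down)?; use gh neg u xy(2) in \<open>auto\<close>)
          show "good R u y" by (rule good_fan_left; (intro up)?; use u xA in \<open>auto\<close>)
          have "good R y (n - 1)" if "y \<noteq> n - 1"
            by (rule good_fan_left; (intro up)?; use xy that xA u in \<open>auto\<close>)
          then show "y = n - 1 \<or> good R y (n - 1)" by blast
          show "\<not> R j y" if "j \<le> F u + 1" for j using that neg u gh False by (intro downy) auto
        qed simp
        then show False using nt by simp
      qed
      have after: "F v \<le> h + 1" if v: "y < v" "v < n" for v
      proof (rule ccontr)
        assume neg: "\<not> F v \<le> h + 1"
        have "tri R n"
        proof (rule tri_three_fans[of "h + 1"])
          show "good R (h + 1) y"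
            by (rule good_fan_right; (intro downy)?; use gh neg v False Fle[of v] in \<open>auto\<close>)
          show "good R y v" by (rule good_fan_left; (intro up)?; use v xA False in \<open>auto\<close>)
          have "good R v (n - 1)" if "v \<noteq> n - 1"
            by (rule good_fan_left; (intro up)?; use that xA v False in \<open>auto\<close>)
          then show "v = n - 1 \<or> good R v (n - 1)" by blast
          show "\<not> R j v" if "j \<le> h + 1" for j using that neg v gh False by (intro down) auto
        qed simp
        then show False using nt by simp
      qed
      have "\<exists>v. y < v \<and> v < n \<and> g + 1 < F v"
      proof (rule ccontr)
        assume neg: "\<not> ?thesis"
        have small: "F v \<le> g + 1" if "y < v" "v < n" for v
          using neg that by (meson not_less)
        have "tame n m (F(y := g))" unfolding tame_def
        proof (intro allI impI)
          fix u v assume "m + 3 \<le> u" "u < v" "v < n"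
          then show "(F(y := g)) v \<le> (F(y := g)) u + 1"
            using before[of u] small[of v] tame_off[of u v] by auto
        qed
        then show False using alt[of g h] gh by simp
      qed
      then obtain v where v: "y < v" "v < n" "g + 1 < F v" by blast
      have "\<exists>u. m + 3 \<le> u \<and> u < y \<and> F u + 1 < h"
      proof (rule ccontr)
        assume neg: "\<not> ?thesis"
        have large: "h \<le> F u + 1" if "m + 3 \<le> u" "u < y" for u
          using neg that by (meson not_less)
        have "tame n m (F(y := h))" unfolding tame_def
        proof (intro allI impI)
          fix u v assume "m + 3 \<le> u" "u < v" "v < n"
          then show "(F(y := h)) v \<le> (F(y := h)) u + 1"
            using after[of v] large[of u] tame_off[of u v] by auto
        qed
        then show False using alt[of h g] gh by (simp add: insert_commute)
      qed
      then obtain u where u: "m + 3 \<le> u" "u < y" "F u + 1 < h" by blast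
      have Fvu: "F v \<le> F u + 1" using tame_off u v by simp
      \<comment> \<open>Now \<open>g + 1 < F v \<le> F u + 1 < h\<close>. Hence \<open>y\<close> can
        be joined to everything strictly between \<open>g\<close> and \<open>h\<close>, while a fan
        at \<open>u\<close> covers what lies above and the fan at \<open>v\<close> what lies
        below.\<close>
      have "tri R n"
      proof (rule tri_three_fans[of "g + 1"])
        have "good R (h - 1) u"
          by (rule good_fan_right; (intro down)?; use gh u xy in \<open>auto\<close>)
        moreover have "good R u y" by (rule good_fan_left; (intro up)?; use u xA in \<open>auto\<close>)
        moreover have "\<not> R (h - 1) y" by (rule downy) (use gh u v Fvu in auto)
        ultimately have "good R (h - 1) y" using good_split by blast
        then show "good R (g + 1) y"
          by (rule good_extend_left; (intro downy)?; use gh u v Fvu in \<open>auto\<close>)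
        show "good R y v" by (rule good_fan_left; (intro up)?; use v xA False in \<open>auto\<close>)
        have "good R v (n - 1)" if "v \<noteq> n - 1"
          by (rule good_fan_left; (intro up)?; use that xA v False in \<open>auto\<close>)
        then show "v = n - 1 \<or> good R v (n - 1)" by blast
        show "\<not> R j v" if "j \<le> g + 1" for j using that v gh False by (intro down) auto
      qed simp
      then show False using nt by simp
    qed
  qed
  have mn3: "m + 3 < n" using outer xy by simp
  have F3: "F (m + 3) \<le> m"
  proof -
    have "F (m + 3) \<noteq> m + 1" using maxr[OF mn3] RF[of "m + 3"] mn3 by auto
    moreover have "F (m + 3) \<noteq> m + 2" using chordsD(5)[OF c RF[of "m + 3"]] mn3 by auto
    ultimately show ?thesis using Fle[of "m + 3"] mn3 by simp
  qed
  have Fn: "2 \<le> F (n - 1)"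
  proof -
    have "F (n - 1) \<noteq> 1" using maxl[OF mn3] RF[of "n - 1"] chordsD(1)[OF c, of 1 "n - 1"] mn3 by auto
    moreover have "F (n - 1) \<noteq> 0" using Flast mn3 by linarith
    ultimately show ?thesis by linarith
  qed
  \<comment> \<open>Only \<open>u = y\<close> and \<open>v = x\<close> are delicate, as a fan there
    would use \<open>{x, y}\<close>. The fan then steps over the other end of this edge by the
    triangle that cuts this end off. The two side conditions concern those triangles whose chord
    might lie in \<open>R\<close>.\<close>
  have pair1: "F v \<le> F u + 1" if uv: "m + 3 \<le> u" "u < v" "v < n" "u \<noteq> x \<or> v \<noteq> y"
    and left: "u = y \<Longrightarrow> \<not> R (x - 1) (x + 1)" and right: "v = x \<Longrightarrow> y = n - 1 \<Longrightarrow> \<not> R 0 (n - 2)" for u v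
  proof (rule ccontr)
    assume neg: "\<not> F v \<le> F u + 1"
    define p where "p = F u + 1"
    have p: "0 < p" "p < F v" "F v \<le> m + 2" using neg Fle[of v] uv by (auto simp: p_def)
    have pu: "good R p u"
    proof (cases "u = y")
      case False
      show ?thesis by (rule good_fan_right; (intro down)?; use p uv False in \<open>auto simp: p_def\<close>)
    next
      case True
      have 1: "good R (x - 1) (x + 1)"
        by (rule good_skip) (use left[OF True] outer in auto)
      have 2: "good R (x + 1) y"
        by (rule good_fan_right; (intro down)?; use y2 True p_def p outer in \<open>auto\<close>)
      have 3: "\<not> R (x - 1) y"
        by (rule down) (use y2 True p_def p outer in auto)
      have "good R (x - 1) y" using good_join[OF 1 2 3] .
      then show ?thesis unfolding True
        by (rule good_extend_left; (intro down)?; use y2 True p_def p outer in \<open>auto\<close>)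
    qed
    have uv': "good R u v"
    proof (cases "u = x")
      case False
      show ?thesis by (rule good_fan_left; (intro up)?; use uv False in \<open>auto\<close>)
    next
      case True
      show ?thesis by (rule good_fan_right; (intro down)?; use uv True p in \<open>auto\<close>)
    qed
    have pv: "\<not> R j v" if "j \<le> p" for j using that p uv outer by (intro down) auto
    have "tri R n"
    proof (cases "v = x \<and> y = n - 1")
      case False
      show ?thesis
      proof (rule tri_three_fans[OF p(1) pu uv'])
        show "v = n - 1 \<or> good R v (n - 1)"
        proof (cases "v = x")
          case vx: False
          have "good R v (n - 1)" if "v \<noteq> n - 1"
            by (rule good_fan_left; (intro up)?; use that uv vx in \<open>auto\<close>)
          then show ?thesis by blast
        next
          case True
          have 1: "good R x (y - 1)"
            by (rule good_fan_left; (intro up)?; use y2 outer in \<open>auto\<close>)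
          have "\<not> R (y - 1) (y + 1)" by (rule up) (use y2 outer in auto)
          then have 2: "good R (y - 1) (y + 1)" using y2 by (intro good_skip) auto
          have "\<not> R x (y + 1)" by (rule up) (use y2 outer in auto)
          then have "good R x (y + 1)" using good_join[OF 1 2] by blast
          then have "good R x (n - 1)"
            by (rule good_extend_right; (intro up)?; use y2 outer xy True False in \<open>auto\<close>)
          then show ?thesis using True by simp
        qed
      qed (use pv in blast)
    next
      case True
      have "good R p v" using good_join[OF pu uv' pv] by simp
      then have 1: "good R 0 x" using True pv by (intro good_extend_left[of R p x 0]) auto
      have 2: "good R x (n - 2)"
        by (rule good_fan_left; (intro up)?; use True y2 outer in \<open>auto\<close>)
      have "good R 0 (n - 2)" using good_join[OF 1 2] right True by simp
      moreover have "good R (n - 2) (n - 1)" using mn3 by (intro good_side') simp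
      ultimately show ?thesis unfolding tri_def by blast
    qed
    then show False using nt by simp
  qed
  \<comment> \<open>There is no circularity: the pairs used for \<open>left\<close> and
    \<open>right\<close> have neither \<open>u = y\<close> nor \<open>v = x\<close>. Maximality of
    the run enters here as \<open>F (m + 3) \<le> m\<close> and
    \<open>2 \<le> F (n - 1)\<close>.\<close>
  have left: "\<not> R (x - 1) (x + 1)"
  proof (cases "x = m + 3")
    case True
    have "F (x + 1) \<le> F (m + 3) + 1" using pair1[of "m + 3" "x + 1"] True y2 xy by simp
    then have "F (x + 1) \<noteq> x - 1" using F3 True by simp
    then show ?thesis using True y2 by (intro down) auto
  next
    case False
    then show ?thesis using outer y2 by (intro up) auto
  qed
  have right: "\<not> R 0 (n - 2)" if y: "y = n - 1"
  proof -
    have "F (n - 1) \<le> F (n - 2) + 1" using pair1[of "n - 2" "n - 1"] y y2 outer by simp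
    then show ?thesis using Fn y y2 outer by (intro down) auto
  qed
  have pair: "F v \<le> F u + 1" if "m + 3 \<le> u" "u < v" "v < n" "u \<noteq> x \<or> v \<noteq> y" for u v
    using pair1[OF that] left right by blast
  have "F x + 1 < F y"
  proof (rule ccontr)
    assume "\<not> F x + 1 < F y"
    then have "tame n m F" unfolding tame_def using pair by (metis not_less)
    then show False using not_tame by simp
  qed
  \<comment> \<open>The centre of the bouquet: for \<open>z\<close> between \<open>x\<close> and
    \<open>y\<close> the inequalities \<open>F y - 1 \<le> F z \<le> F x + 1 < F y\<close> leave
    only \<open>F z = l\<close> and \<open>F y = l + 1\<close>. The statement's \<open>k\<close> and
    \<open>t\<close> are \<open>x\<close> and \<open>y - x\<close>.\<close>
  define l where "l = F x + 1"
  have between: "F z = l \<and> F y = l + 1" if z: "x < z" "z < y" for z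
    using pair[of x z] pair[of z y] z outer xy \<open>F x + 1 < F y\<close> l_def by simp
  have Fy: "F y = l + 1" using between[of "x + 1"] y2 by simp
  have lm: "l \<le> m + 1" using Fy Fle[of y] outer xy by simp
  have low: "l \<le> F z \<and> F z \<le> m + 1" if z: "m + 3 \<le> z" "z < x" for z
  proof -
    have "F y \<le> F z + 1" using pair[of z y] z xy by simp
    moreover have "F z \<le> F (m + 3) + 1" using pair[of "m + 3" z] z xy by (cases "z = m + 3") auto
    ultimately show ?thesis using Fy F3 by simp
  qed
  have high: "1 \<le> F z \<and> F z \<le> l" if z: "y < z" "z < n" for z
  proof -
    have "F z \<le> F x + 1" using pair[of x z] z xy outer by simp
    moreover have "F (n - 1) \<le> F z + 1" using pair[of z "n - 1"] z xy outer by (cases "z = n - 1") auto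
    ultimately show ?thesis using Fn l_def by simp
  qed
  define i where "i j = F (m + 2 + j)" for j
  have ed: "e \<in> edges R \<longleftrightarrow> e = {x, y} \<or> (\<exists>z. 2 \<le> z \<and> z < n \<and> e = {F z, z})" for e
  proof
    assume "e \<in> edges R"
    then obtain p q where pq: "e = {p, q}" "R p q" unfolding edges_def by auto
    have "\<exists>p q. e = {p, q} \<and> R p q \<and> p < q"
      using pq chordsD(1,4)[OF c pq(2)] by (metis insert_commute nat_neq_iff)
    then obtain p q where "e = {p, q}" "R p q" "p < q" by blast
    then show "e = {x, y} \<or> (\<exists>z. 2 \<le> z \<and> z < n \<and> e = {F z, z})" using iff[of p q] by auto
  next
    assume "e = {x, y} \<or> (\<exists>z. 2 \<le> z \<and> z < n \<and> e = {F z, z})"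
    then show "e \<in> edges R" using xy(3) RF unfolding edges_def by blast
  qed
  show ?thesis
    unfolding type3_def
  proof (rule exI[of _ l], rule exI[of _ m], rule exI[of _ x], rule exI[of _ "y - x"], rule exI[of _ i], intro conjI)
    show "0 < l" by (simp add: l_def)
    show "l < m + 2" using lm by simp
    show "m + 2 < x" using outer by simp
    show "x + 1 < x + (y - x)" using y2 by simp
    show "x + (y - x) \<le> n - 1" using xy by simp
    show "\<forall>j\<in>{1..x - m - 3}. i j \<in> {l..m + 1}"
    proof
      fix j assume "j \<in> {1..x - m - 3}"
      then show "i j \<in> {l..m + 1}" using low[of "m + 2 + j"] by (auto simp: i_def)
    qed
    show "\<forall>j\<in>{x + (y - x) - m - 1..n - 3 - m}. i j \<in> {1..l}"
    proof
      fix j assume "j \<in> {x + (y - x) - m - 1..n - 3 - m}"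
      then show "i j \<in> {1..l}" using high[of "m + 2 + j"] xy mn3 outer by (auto simp: i_def)
    qed
    show "B2_cond m i ({1..x - m - 3} \<union> {x + (y - x) - m - 1..n - 3 - m})"
      unfolding B2_cond_def
    proof (intro ballI impI)
      fix j1 j2 assume j: "j1 \<in> {1..x - m - 3} \<union> {x + (y - x) - m - 1..n - 3 - m}"
        "j2 \<in> {1..x - m - 3} \<union> {x + (y - x) - m - 1..n - 3 - m}" and d: "\<bar>int (i j1) - int (i j2)\<bar> \<ge> 2"
      define z1 z2 where "z1 = m + 2 + j1" and "z2 = m + 2 + j2"
      have z: "m + 3 \<le> z1" "z1 < n" "z1 \<noteq> x" "m + 3 \<le> z2" "z2 < n" "z2 \<noteq> x"
        using j xy outer mn3 by (auto simp: z1_def z2_def)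
      have d': "F z1 + 2 \<le> F z2 \<or> F z2 + 2 \<le> F z1" using d by (auto simp: i_def z1_def z2_def)
      have "\<not> (F z1 < F z2 \<and> z1 < z2)" using pair[of z1 z2] z d' by auto
      moreover have "\<not> (F z2 < F z1 \<and> z2 < z1)" using pair[of z2 z1] z d' by auto
      ultimately have "\<not> crosses {F z1, z1} {F z2, z2}"
        using Fle[of z1] Fle[of z2] z by (subst crosses_iff) auto
      then show "\<not> crosses (edge (m + 2 + j1) (i j1)) (edge (m + 2 + j2) (i j2))"
        by (simp add: edge_def i_def z1_def z2_def insert_commute)
    qed
    show "edges R = {edge (l - 1) (l + 1), edge x (l - 1), edge (x + (y - x)) (l + 1), edge x (x + (y - x))} \<union>
      {edge (x + s) l |s. 1 \<le> s \<and> s \<le> y - x - 1} \<union> {edge s (s + 2) |s. l \<le> s \<and> s \<le> m} \<union>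
      {edge s (s + 2) |s. s + 2 \<le> l} \<union> B2_set m i {1..x - m - 3} \<union>
      B2_set m i {x + (y - x) - m - 1..n - 3 - m}" (is "_ = ?X")
    proof (intro set_eqI iffI)
      fix e assume "e \<in> edges R"
      then consider "e = {x, y}" | z where "2 \<le> z" "z < n" "e = {F z, z}" using ed by blast
      then show "e \<in> ?X"
      proof cases
        case 1
        then show ?thesis using xy by (simp add: edge_def)
      next
        case (2 z)
        consider "z \<le> l" | "z = l + 1" | "l + 2 \<le> z" "z \<le> m + 2" | "m + 3 \<le> z" "z < x" | "z = x"
          | "x < z" "z < y" | "z = y" | "y < z" by linarith
        then show ?thesis
        proof cases
          case 1
          then have "e = edge (z - 2) (z - 2 + 2)" "z - 2 + 2 \<le> l" using 2 Fin[of z] lm by (auto simp: edge_def)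
          then show ?thesis by blast
        next
          case b: 2
          then have "e = edge (l - 1) (l + 1)" using 2 Fin[of z] lm by (auto simp: edge_def)
          then show ?thesis by blast
        next
          case 3
          then have "e = edge (z - 2) (z - 2 + 2)" "l \<le> z - 2 \<and> z - 2 \<le> m" using 2 Fin[of z] lm by (auto simp: edge_def)
          then show ?thesis by blast
        next
          case 4
          then obtain j where j: "z = m + 2 + j" using le_Suc_ex[of "m + 2" z] by auto
          then have "e = edge (m + 2 + j) (i j)" "j \<in> {1..x - m - 3}"
            using 2 4 by (auto simp: edge_def i_def)
          then show ?thesis unfolding B2_set_def by blast
        next
          case 5
          then have "e = edge x (l - 1)" using 2 by (auto simp: edge_def l_def)
          then show ?thesis by blast
        next
          case 6
          then have "e = edge (x + (z - x)) l" "1 \<le> z - x \<and> z - x \<le> y - x - 1" using 2 between[of z] by (auto simp: edge_def)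
          then show ?thesis by blast
        next
          case 7
          then have "e = edge (x + (y - x)) (l + 1)" using 2 Fy xy by (auto simp: edge_def)
          then show ?thesis by blast
        next
          case 8
          then obtain j where j: "z = m + 2 + j" using le_Suc_ex[of "m + 2" z] xy outer by auto
          then have "e = edge (m + 2 + j) (i j)" "j \<in> {x + (y - x) - m - 1..n - 3 - m}"
            using 2 8 xy outer by (auto simp: edge_def i_def)
          then show ?thesis unfolding B2_set_def by blast
        qed
      qed
    next
      fix e assume "e \<in> ?X"
      then consider "e = {x, y}" | "e = edge (l - 1) (l + 1)" | "e = edge x (l - 1)" | "e = edge y (l + 1)"
        | s where "e = edge (x + s) l" "1 \<le> s" "s \<le> y - x - 1" | s where "e = edge s (s + 2)" "s \<le> m"
        | j where "e = edge (m + 2 + j) (i j)" "1 \<le> j" "m + 2 + j < n"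
        unfolding B2_set_def using xy lm outer mn3 by (auto simp: edge_def)
      then show "e \<in> edges R"
      proof cases
        case 1 then show ?thesis using ed by simp
      next
        case 2
        then have "2 \<le> l + 1" "l + 1 < n" "e = {F (l + 1), l + 1}" using Fin[of "l + 1"] lm mn3 by (auto simp: edge_def l_def)
        then show ?thesis using ed by blast
      next
        case 3
        then have "2 \<le> x" "x < n" "e = {F x, x}" using outer xy by (auto simp: edge_def l_def)
        then show ?thesis using ed by blast
      next
        case 4
        then have "2 \<le> y" "y < n" "e = {F y, y}" using outer xy Fy by (auto simp: edge_def)
        then show ?thesis using ed by blast
      next
        case (5 s)
        then have "2 \<le> x + s" "x + s < n" "e = {F (x + s), x + s}" using outer xy between[of "x + s"] by (auto simp: edge_def)
        then show ?thesis using ed by blast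
      next
        case (6 s)
        then have "2 \<le> s + 2" "s + 2 < n" "e = {F (s + 2), s + 2}" using Fin[of "s + 2"] mn3 by (auto simp: edge_def)
        then show ?thesis using ed by blast
      next
        case (7 j)
        then have "2 \<le> m + 2 + j" "m + 2 + j < n" "e = {F (m + 2 + j), m + 2 + j}" by (auto simp: edge_def i_def)
        then show ?thesis using ed by blast
      qed
    qed
  qed
qed

text \<open>The given chord is the ear of \<open>m + 2\<close>. As \<open>arc\<close> only asks for
  containment in \<open>R\<close>, the former edge of \<open>m + 3\<close> may simply be
  forgotten.\<close>

lemma arc_extend:
  assumes a: "arc n R m F" and mn: "m + 3 < n" and R: "R (m + 1) (m + 3)"
  shows "arc n R (m + 1) (F(m + 3 := m + 1))"
  unfolding arc_def
proof (intro conjI allI impI)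
  fix z assume z: "2 \<le> z" "z \<le> m + 1 + 2"
  show "(F(m + 3 := m + 1)) z = z - 2" using arcD(2)[OF a, of z] z by auto
next
  fix z assume z: "m + 1 + 3 \<le> z" "z < n"
  show "(F(m + 3 := m + 1)) z \<le> m + 1 + 2" using arcD(3)[OF a, of z] z by auto
next
  fix z assume z: "2 \<le> z" "z < n"
  show "R ((F(m + 3 := m + 1)) z) z" using arcD(4)[OF a, of z] z R by auto
qed (use mn in simp)

lemma rot_last_iff:
  "rot n (n - 1) R i j \<longleftrightarrow> i < n \<and> j < n \<and> R (if i = 0 then n - 1 else i - 1) (if j = 0 then n - 1 else j - 1)"
proof -
  have "(i + (n - 1)) mod n = (if i = 0 then n - 1 else i - 1)" if "i < n" for i
  proof (cases "i = 0")
    case False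
    then have "i + (n - 1) = (i - 1) + n" using that by simp
    then have "(i + (n - 1)) mod n = (i - 1) mod n" by (simp only: mod_add_self2)
    then show ?thesis using False that by simp
  qed (use that in simp)
  then show ?thesis unfolding rot_def by auto
qed

lemmas rot_last_iff' = rot_last_iff[unfolded One_nat_def]

text \<open>Mirror image of \<open>arc_extend\<close>: the ear of \<open>0\<close> is put in front
  of the run, and the labels are shifted so that \<open>n - 1\<close> becomes
  \<open>0\<close>.\<close>

lemma arc_extend_left:
  assumes c: "chords n R" and a: "arc n R m F" and mn: "m + 3 < n" and R: "R (n - 1) 1"
  shows "\<exists>G. arc n (rot n (n - 1) R) (m + 1) G"
proof
  let ?G = "\<lambda>z. if z \<le> m + 3 then z - 2 else F (z - 1) + 1"
  show "arc n (rot n (n - 1) R) (m + 1) ?G"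
    unfolding arc_def
  proof (intro conjI allI impI)
    fix z assume z: "m + 1 + 3 \<le> z" "z < n"
    then show "?G z \<le> m + 1 + 2" using arcD(3)[OF a, of "z - 1"] by auto
  next
    fix z assume z: "2 \<le> z" "z < n"
    consider "z = 2" | "3 \<le> z" "z \<le> m + 3" | "m + 4 \<le> z" using z by linarith
    then show "rot n (n - 1) R (?G z) z"
    proof cases
      case 1
      then show ?thesis using R mn by (simp add: rot_last_iff')
    next
      case 2
      have "F (z - 1) = z - 3" using arcD(2)[OF a, of "z - 1"] 2 by simp
      then have "R (z - 3) (z - 1)" using arcD(4)[OF a, of "z - 1"] 2 z by simp
      then show ?thesis using 2 z by (simp add: rot_last_iff')
    next
      case 3
      then have "R (F (z - 1)) (z - 1)" "F (z - 1) \<le> m + 2" using arcD(3,4)[OF a, of "z - 1"] z by simp_all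
      then show ?thesis using 3 z by (simp add: rot_last_iff')
    qed
  qed (use mn in auto)
qed

text \<open>The run is prolonged on either side until it is maximal, as
  \<open>arc_type3_core\<close> requires; \<open>m + 3 \<le> n\<close> bounds its length.\<close>

lemma arc_type3:
  assumes "sat n R" "arc n R m F"
  shows "\<exists>r. type3 n (edges (rot n r R))"
  using assms
proof (induction "n - m" arbitrary: m F R rule: less_induct)
  case less
  have c: "chords n R" and n: "n > 0" using satD[OF less.prems(1)] by auto
  consider "m + 3 < n" "R (m + 1) (m + 3)" | "m + 3 < n" "R (n - 1) 1"
    | "m + 3 < n \<Longrightarrow> \<not> R (m + 1) (m + 3)" "m + 3 < n \<Longrightarrow> \<not> R (n - 1) 1" by blast
  then show ?case
  proof cases
    case 1
    show ?thesis
      by (rule less.hyps[OF _ less.prems(1) arc_extend[OF less.prems(2) 1]]) (use 1 in simp)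
  next
    case 2
    obtain G where G: "arc n (rot n (n - 1) R) (m + 1) G" using arc_extend_left[OF c less.prems(2) 2] by (elim exE)
    have "\<exists>r. type3 n (edges (rot n r (rot n (n - 1) R)))"
      by (rule less.hyps[OF _ sat_rot[OF less.prems(1)] G]) (use 2 in simp)
    then show ?thesis unfolding rot_add[OF n] by blast
  next
    case 3
    then have "type3 n (edges (rot n 0 R))" using arc_type3_core[OF less.prems] rot_0[OF c] by simp
    then show ?thesis by blast
  qed
qed

section \<open>Cutting off two vertices in succession\<close>

definition nx :: "nat \<Rightarrow> nat \<Rightarrow> nat" where "nx n x = (if x + 1 = n then 0 else x + 1)"
definition pv :: "nat \<Rightarrow> nat \<Rightarrow> nat" where "pv n x = (if x = 0 then n - 1 else x - 1)"

lemma nx_mod: "x < n \<Longrightarrow> nx n x = (x + 1) mod n"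
  by (auto simp: nx_def)

lemma pv_mod: "x < n \<Longrightarrow> pv n x = (x + n - 1) mod n"
proof -
  assume x: "x < n"
  show ?thesis
  proof (cases "x = 0")
    case False
    then have "x + n - 1 = (x - 1) + n" using x by simp
    then have "(x + n - 1) mod n = (x - 1) mod n" by (simp only: mod_add_self2)
    then show ?thesis using False x by (simp add: pv_def)
  qed (use x in \<open>simp add: pv_def\<close>)
qed

lemma ear_nx: "x < n \<Longrightarrow> ear n R x \<longleftrightarrow> R (pv n x) (nx n x)"
  by (simp add: nx_mod pv_mod ear_def)

lemma sat_deg_le_2:
  assumes s: "sat n R" and x: "x < n" "\<not> ear n R x"
  shows "card {j. R x j} \<le> 2"
  using deg_le[OF satD(1)[OF s] _ x satD(4)[OF s]] satD(2,3)[OF s] by simp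

lemma sat_third_nbr:
  assumes s: "sat n R" and x: "x < n" "\<not> ear n R x" and "R x a" "R x b" "a \<noteq> b" "R x j"
  shows "j = a \<or> j = b"
proof (rule ccontr)
  assume neg: "\<not> ?thesis"
  have "card {a, b, j} \<le> card {j. R x j}"
    by (rule card_mono[OF finite_nbrs[OF satD(1)[OF s]]]) (use assms in auto)
  then show False using sat_deg_le_2[OF s x] neg \<open>a \<noteq> b\<close> by auto
qed

text \<open>Once \<open>x\<close> has been cut off, \<open>y\<close> has no ear in \<open>R\<close>.\<close>

definition bare_after :: "nat \<Rightarrow> (nat \<Rightarrow> nat \<Rightarrow> bool) \<Rightarrow> nat \<Rightarrow> nat \<Rightarrow> bool" where
  "bare_after n R x y \<longleftrightarrow>
    (if y = nx n x then \<not> R (pv n x) (nx n y) else if x = nx n y then \<not> R (pv n y) (nx n x) else \<not> ear n R y)"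

text \<open>\<open>double_removal_last\<close> in the original labels. This is the main source of
  contradictions below.\<close>

lemma remove_two:
  assumes s: "sat n R" and x: "x < n" "\<not> ear n R x" and y: "y < n" "y \<noteq> x"
    and bare: "bare_after n R x y"
    and ab: "R x a" "R x b" "a \<noteq> b" and de: "R y d" "R y e" "d \<noteq> e" "d \<noteq> x" "e \<noteq> x"
  shows False
proof -
  note cond = bare[unfolded bare_after_def]
  have c: "chords n R" and n: "n \<ge> 6" "n \<ge> 5" and nt: "\<not> tri R n" and card: "card (edges R) = n - 1"
    using satD[OF s] by auto
  obtain y' where y': "y' < n" "(y' + (x + 1)) mod n = y" using rot_surj[OF y(1)] by blast
  have y'n: "y' \<noteq> n - 1" using y' y(2) rot_to_last[OF x(1)] by auto
  let ?R = "rot n (x + 1) R"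
  have "\<not> ear (n - 1) (cut n ?R) y'"
  proof -
    \<comment> \<open>In the polygon without \<open>x\<close> the successor of \<open>x\<close> has
      label \<open>0\<close> and its predecessor label \<open>n - 2\<close>. Only these two have an
      ear chord different from the one in the original polygon.\<close>
    consider "y' = 0" | "y' = n - 2" | "0 < y'" "y' < n - 2" using y' y'n by linarith
    then show ?thesis
    proof cases
      case 1
      then have yx: "y = nx n x" using y' x by (simp add: nx_mod)
      have "x + n - 1 = n - 2 + (x + 1)" using n by simp
      then have "pv n x = (n - 2 + (x + 1)) mod n" unfolding pv_mod[OF x(1)] by (simp only:)
      moreover have "nx n y = (1 + (x + 1)) mod n" using y yx x by (simp add: nx_mod mod_simps)
      ultimately have "\<not> ?R (n - 2) 1" using cond yx unfolding rot_def by simp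
      then show ?thesis using 1 ear_0[of "n - 1" "cut n ?R"] n by (simp add: cut_def numeral_2_eq_2)
    next
      case 2
      have "x = nx n y"
      proof -
        have "nx n y = (y + 1) mod n" using nx_mod[OF y(1)] .
        also have "\<dots> = (n - 2 + (x + 1) + 1) mod n" unfolding y'(2)[symmetric] 2 by (rule mod_add_left_eq)
        also have "n - 2 + (x + 1) + 1 = x + n" using n by simp
        finally show ?thesis using x by simp
      qed
      moreover have "y \<noteq> nx n x"
      proof
        assume "y = nx n x"
        then have "(0 + (x + 1)) mod n = (n - 2 + (x + 1)) mod n" using y' 2 x by (simp add: nx_mod)
        then have "0 = n - 2" using mod_add_right_eq_iff[of 0 n "n - 2" "x + 1"] n by linarith
        then show False using n by simp
      qed
      ultimately have "\<not> R (pv n y) (nx n x)" using cond by simp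
      moreover have "nx n x = (0 + (x + 1)) mod n" using x by (simp add: nx_mod)
      moreover have "pv n y = (n - 3 + (x + 1)) mod n"
      proof -
        have "pv n y = (y + (n - 1)) mod n" using y n by (simp add: pv_mod)
        also have "\<dots> = (n - 2 + (x + 1) + (n - 1)) mod n" unfolding y'(2)[symmetric] 2 by (rule mod_add_left_eq)
        also have "n - 2 + (x + 1) + (n - 1) = n - 3 + (x + 1) + n" using n by simp
        finally show ?thesis by (simp only: mod_add_self2)
      qed
      ultimately have "\<not> ?R (n - 3) 0" unfolding rot_def by simp
      moreover have "n - 1 - 2 = n - 3" "n - 1 - 1 = n - 2" by simp_all
      ultimately show ?thesis using 2 ear_last[of "n - 1" "cut n ?R"] n by (simp add: cut_def)
    next
      case 3
      have "y \<noteq> nx n x"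
      proof
        assume "y = nx n x"
        then have "(0 + (x + 1)) mod n = (y' + (x + 1)) mod n" using y' x by (simp add: nx_mod)
        then have "0 = y'" using mod_add_right_eq_iff[of 0 n y' "x + 1"] n y' by linarith
        then show False using 3 by simp
      qed
      moreover have "x \<noteq> nx n y"
      proof
        assume "x = nx n y"
        also have "nx n y = (y + 1) mod n" using nx_mod[OF y(1)] .
        also have "\<dots> = (y' + (x + 1) + 1) mod n" unfolding y'(2)[symmetric] by (rule mod_add_left_eq)
        also have "y' + (x + 1) + 1 = y' + 1 + (x + 1)" by simp
        finally have "(n - 1 + (x + 1)) mod n = (y' + 1 + (x + 1)) mod n" unfolding rot_to_last[OF x(1)] .
        then have "n - 1 = y' + 1" using mod_add_right_eq_iff[of "n - 1" n "y' + 1" "x + 1"] 3 by linarith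
        then show False using 3 by simp
      qed
      ultimately have "\<not> ear n R y" using cond by simp
      then have "\<not> ear n ?R y'" using ear_rot[OF y'(1), of "x + 1" R] y' by simp
      then show ?thesis using 3 ear_mid[of y' n ?R] ear_mid[of y' "n - 1" "cut n ?R"] by (simp add: cut_def)
    qed
  qed
  moreover have "y' < n - 1" using y' y'n by linarith
  ultimately show False
    using double_removal_last[OF c n(2) nt card x, of y' a b d e] y' y'n ab de by (simp add: add.assoc)
qed

section \<open>Reinserting a vertex of degree two\<close>

text \<open>The vertex \<open>y = q + 1\<close> has been inserted between the labels \<open>q\<close> and \<open>q + 1\<close> of an \<open>n - 1\<close>-gon; \<open>ins q\<close> maps
  old labels to new ones. All of \<open>F\<close>, \<open>m\<close>, \<open>proper\<close> and \<open>tame\<close> refer to old labels.\<close>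

definition ins :: "nat \<Rightarrow> nat \<Rightarrow> nat" where "ins q i = (if i \<le> q then i else i + 1)"

locale insertion =
  fixes n :: nat and P :: "nat \<Rightarrow> nat \<Rightarrow> bool" and q m :: nat and F :: "nat \<Rightarrow> nat"
  assumes sat: "sat n P" and q: "q \<le> n - 2" and m1: "1 \<le> m" and mn: "m + 4 \<le> n"
    and nonear: "\<not> ear n P (q + 1)" and deg2: "card {j. P (q + 1) j} = 2"
    and Fin: "\<And>z. 2 \<le> z \<Longrightarrow> z \<le> m + 2 \<Longrightarrow> F z = z - 2"
    and proper: "proper (n - 1) m F" and tame: "tame (n - 1) m F"
    and iff: "\<And>i j. i < j \<Longrightarrow> j < n - 1 \<Longrightarrow> P (ins q i) (ins q j) \<longleftrightarrow> 2 \<le> j \<and> i = F j"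

lemma insertion_exists:
  assumes s: "sat n R"
  shows "\<exists>r q m F. insertion n (rot n r R) q m F"
proof -
  have c: "chords n R" and n: "n \<ge> 6" "n > 0" and nt: "\<not> tri R n" and card: "card (edges R) = n - 1"
    using satD[OF s] by auto
  have "\<exists>y < n. \<not> ear n R y \<and> card {j. R y j} \<noteq> 1"
  proof (rule ccontr)
    assume neg: "\<not> ?thesis"
    have uniq: "i = j" if "x < n" "\<not> ear n R x" "R x i" "R x j" for x i j
    proof -
      have "card {j. R x j} \<le> 1" using neg that(1,2) by auto
      then show ?thesis using unique_if_card_le_1[OF finite_nbrs[OF c], of x i j] that(3,4) by simp
    qed
    have indep: "\<not> R x y" if xy: "x < n" "y < n" "\<not> ear n R x" "\<not> ear n R y" for x y
    proof
      assume R: "R x y"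
      then have yx: "R y x" "y \<noteq> x" using chordsD(1,4)[OF c R] by auto
      have "\<exists>j. R y j \<and> j \<noteq> x" by (rule other_nbr[OF c _ xy(1,3) nt xy(2) yx(2)]) (use n in simp)
      then show False using uniq[OF xy(2,4)] yx(1) by blast
    qed
    have "\<exists>x < n. \<not> ear n R x"
    proof (rule ccontr)
      assume "\<not> (\<exists>x < n. \<not> ear n R x)"
      then have "n \<le> card (edges R)" using all_ears_card[OF c] n by auto
      then show False using card n by simp
    qed
    then obtain x0 where x0: "x0 < n" "\<not> ear n R x0" by blast
    have "\<exists>r m F. r < n \<and> 1 \<le> m \<and> arc n (rot n r R) m F \<and> tame n m F \<and> proper n m F"
    proof (rule arc_exists[OF c _ nt x0])
      show "5 \<le> n" using n by simp
      show "i = j" if "x < n" "\<not> ear n R x" "R x i" "R x j" for x i j using uniq[OF that] .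
      show "\<not> R x y" if "x < n" "y < n" "\<not> ear n R x" "\<not> ear n R y" for x y using indep[OF that] .
    qed
    then obtain r m F where "arc n (rot n r R) m F" "tame n m F" by blast
    then show False using arc_not_tame[OF sat_rot[OF s]] by blast
  qed
  then obtain y where y: "y < n" "\<not> ear n R y" "card {j. R y j} \<noteq> 1" by blast
  have "{j. R y j} \<noteq> {}"
  proof
    assume "{j. R y j} = {}"
    then have "\<not> R y j" for j by simp
    then show False using isolated_tri[OF c _ y(1)] nt n by simp
  qed
  then have "card {j. R y j} \<noteq> 0" using finite_nbrs[OF c, of y] by simp
  then have deg: "card {j. R y j} = 2" using sat_deg_le_2[OF s y(1,2)] y(3) by linarith
  let ?Y = "rot n (y + 1) R"
  let ?Q = "cut n ?Y"
  have cb: "chords (n - 1) ?Q" "\<not> tri ?Q (n - 1)" "card (edges R) = card (edges ?Q) + card {j. R y j}"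
    using cut_blocked[OF c _ y(1,2) nt] n by simp_all
  have "\<exists>s m F. s < n - 1 \<and> 1 \<le> m \<and> arc (n - 1) (rot (n - 1) s ?Q) m F \<and> tame (n - 1) m F \<and> proper (n - 1) m F \<and>
    (\<forall>i j. i < j \<longrightarrow> (rot (n - 1) s ?Q i j \<longleftrightarrow> 2 \<le> j \<and> j < n - 1 \<and> i = F j))"
    by (rule minimum_blocker_structure[OF cb(1) _ cb(2)]) (use n cb(3) card deg in simp_all)
  then obtain s m F where sF: "s < n - 1" "1 \<le> m" "arc (n - 1) (rot (n - 1) s ?Q) m F" "tame (n - 1) m F" "proper (n - 1) m F"
    and eq: "\<forall>i j. i < j \<longrightarrow> (rot (n - 1) s ?Q i j \<longleftrightarrow> 2 \<le> j \<and> j < n - 1 \<and> i = F j)" by blast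
  \<comment> \<open>The deleted vertex has label \<open>n - 1\<close> before the rotation by
    \<open>s\<close>. The labels \<open>i\<close> for which \<open>i + s\<close> does not wrap
    around are exactly \<open>0, \<dots>, q\<close>, so it returns right after
    \<open>q\<close>.\<close>
  define q where "q = n - 2 - s"
  let ?P = "rot n (s + (y + 1)) R"
  have P: "?P = rot n s ?Y" by (rule rot_add[OF n(2), symmetric])
  have pos: "(ins q i + s) mod n = (i + s) mod (n - 1)" "ins q i < n" if i: "i < n - 1" for i
  proof -
    show "ins q i < n" using i unfolding ins_def by presburger
    show "(ins q i + s) mod n = (i + s) mod (n - 1)"
    proof (cases "i \<le> q")
      case True
      then show ?thesis using i sF(1) by (simp add: ins_def q_def)
    next
      case False
      define b where "b = i + s - (n - 1)"
      have b: "i + s = b + (n - 1)" "ins q i + s = b + n" "b < n - 1"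
        using False i sF(1) by (auto simp: ins_def q_def b_def)
      have "(i + s) mod (n - 1) = b" unfolding b(1) mod_add_self2 using b(3) by simp
      moreover have "(ins q i + s) mod n = b" unfolding b(2) mod_add_self2 using b(3) by simp
      ultimately show ?thesis by simp
    qed
  qed
  have last: "(q + 1 + s) mod n = n - 1" "q + 1 < n" using sF(1) n by (auto simp: q_def)
  have "insertion n ?P q m F"
  proof
    show "sat n ?P" using sat_rot[OF s] .
    show "q \<le> n - 2" by (simp add: q_def)
    show "1 \<le> m" by fact
    show "m + 4 \<le> n" using arcD(1)[OF sF(3)] by simp
    have e: "(q + 1 + (s + (y + 1))) mod n = y"
    proof -
      have "q + 1 + (s + (y + 1)) = (q + 1 + s) + (y + 1)" by simp
      then have "(q + 1 + (s + (y + 1))) mod n = ((q + 1 + s) mod n + (y + 1)) mod n" by (simp only: mod_add_left_eq)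
      then show ?thesis using last(1) rot_to_last[OF y(1)] by simp
    qed
    show "\<not> ear n ?P (q + 1)" using ear_rot[OF last(2), of "s + (y + 1)" R] e y(2) by simp
    show "card {j. ?P (q + 1) j} = 2" using nbrs_rot[OF c last(2), of "s + (y + 1)"] e deg by simp
    show "F z = z - 2" if "2 \<le> z" "z \<le> m + 2" for z using arcD(2)[OF sF(3) that] .
    show "proper (n - 1) m F" "tame (n - 1) m F" by fact+
    fix i j :: nat assume ij: "i < j" "j < n - 1"
    have "?P (ins q i) (ins q j) \<longleftrightarrow> ?Y ((i + s) mod (n - 1)) ((j + s) mod (n - 1))"
      unfolding P using pos[of i] pos[of j] ij by (auto simp: rot_def)
    also have "\<dots> \<longleftrightarrow> rot (n - 1) s ?Q i j" using ij by (auto simp: rot_def cut_def)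
    finally show "?P (ins q i) (ins q j) \<longleftrightarrow> 2 \<le> j \<and> i = F j" using eq ij by simp
  qed
  then show ?thesis by blast
qed

lemma edges_ordered:
  assumes "chords n R"
  shows "e \<in> edges R \<longleftrightarrow> (\<exists>i j. e = {i, j} \<and> i < j \<and> R i j)"
proof
  assume "e \<in> edges R"
  then obtain i j where ij: "e = {i, j}" "R i j" unfolding edges_def by blast
  then have "R j i" "i < j \<or> j < i" using chordsD(1,4)[OF assms ij(2)] by auto
  then show "\<exists>i j. e = {i, j} \<and> i < j \<and> R i j" using ij by (metis insert_commute)
next
  assume "\<exists>i j. e = {i, j} \<and> i < j \<and> R i j"
  then show "e \<in> edges R" unfolding edges_def by blast
qed

text \<open>Since \<open>G z \<le> M + 1 < z\<close>, two of these edges cross exactly when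
  \<open>G\<close> increases along with \<open>z\<close>, and \<open>tame\<close> forbids an
  increase by two or more.\<close>

lemma tame_B2_cond:
  assumes t: "tame n M G" and M: "M + 3 \<le> n"
    and G: "\<And>j. M + 3 \<le> j \<Longrightarrow> j < n \<Longrightarrow> G j \<le> M + 1"
  shows "B2_cond M (\<lambda>j. G (M + 2 + j)) {1..n - 3 - M}"
  unfolding B2_cond_def
proof (intro ballI impI)
  fix j1 j2 assume j: "j1 \<in> {1..n - 3 - M}" "j2 \<in> {1..n - 3 - M}"
    and d: "\<bar>int (G (M + 2 + j1)) - int (G (M + 2 + j2))\<bar> \<ge> 2"
  define z1 z2 where z12: "z1 = M + 2 + j1" "z2 = M + 2 + j2"
  have z: "M + 3 \<le> z1" "z1 < n" "M + 3 \<le> z2" "z2 < n" using j M by (auto simp: z12)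
  have d': "G z1 + 2 \<le> G z2 \<or> G z2 + 2 \<le> G z1" using d by (auto simp: z12)
  have tz: "u < v \<Longrightarrow> M + 3 \<le> u \<Longrightarrow> v < n \<Longrightarrow> G v \<le> G u + 1" for u v
    using t unfolding tame_def by simp
  have "\<not> (G z1 < G z2 \<and> z1 < z2)" "\<not> (G z2 < G z1 \<and> z2 < z1)"
    using tz[of z1 z2] tz[of z2 z1] z d' by auto
  then have "\<not> crosses {G z1, z1} {G z2, z2}"
    using G[of z1] G[of z2] z by (subst crosses_iff) auto
  then show "\<not> crosses (edge (M + 2 + j1) (G (M + 2 + j1))) (edge (M + 2 + j2) (G (M + 2 + j2)))"
    by (simp add: edge_def z12 insert_commute)
qed

lemma B2_set_iff:
  assumes "M + 3 \<le> n"
  shows "e \<in> B2_set M (\<lambda>j. G (M + 2 + j)) {1..n - 3 - M} \<longleftrightarrow> (\<exists>z. M + 3 \<le> z \<and> z < n \<and> e = {G z, z})"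
proof
  assume "e \<in> B2_set M (\<lambda>j. G (M + 2 + j)) {1..n - 3 - M}"
  then obtain j where "j \<in> {1..n - 3 - M}" "e = edge (M + 2 + j) (G (M + 2 + j))" unfolding B2_set_def by blast
  then show "\<exists>z. M + 3 \<le> z \<and> z < n \<and> e = {G z, z}"
    using assms by (intro exI[of _ "M + 2 + j"]) (auto simp: edge_def insert_commute)
next
  assume "\<exists>z. M + 3 \<le> z \<and> z < n \<and> e = {G z, z}"
  then obtain z where z: "M + 3 \<le> z" "z < n" "e = {G z, z}" by blast
  then obtain j where j: "z = M + 2 + j" using le_Suc_ex[of "M + 2" z] by auto
  then have "j \<in> {1..n - 3 - M}" "e = edge (M + 2 + j) (G (M + 2 + j))" using z by (auto simp: edge_def insert_commute)
  then show "e \<in> B2_set M (\<lambda>j. G (M + 2 + j)) {1..n - 3 - M}" unfolding B2_set_def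
    by (intro CollectI exI[of _ j] conjI)
qed

section \<open>The three types\<close>

text \<open>The subtractions of the statement are replaced by sums, so that in the applications the
  equivalence splits into linear arithmetic.\<close>

lemma type1I:
  assumes c: "chords n R" and b: "4 \<le> M" "M + 3 \<le> n" "2 < l" "l < M"
    and G: "\<And>j. M + 3 \<le> j \<Longrightarrow> j < n \<Longrightarrow> 1 \<le> G j \<and> G j \<le> M + 1 \<and> G j \<noteq> l" and t: "tame n M G"
    and iff: "\<And>i j. i < j \<Longrightarrow> R i j \<longleftrightarrow>
      i + 2 = l \<and> j = l \<or> i + 2 = l \<and> j = l + 1 \<or> i + 1 = l \<and> j = l + 2 \<or> i = l \<and> j = l + 2 \<or>
      j = i + 2 \<and> (j < l \<or> l < i \<and> i \<le> M) \<or> M + 3 \<le> j \<and> j < n \<and> i = G j"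
  shows "type1 n (edges R)"
  unfolding type1_def
proof (rule exI[of _ M], rule exI[of _ l], rule exI[of _ "\<lambda>j. G (M + 2 + j)"], intro conjI)
  show "4 \<le> M" "M \<le> n - 3" "2 < l" "l < M" using b by auto
  show "\<forall>j\<in>{1..n - 3 - M}. G (M + 2 + j) \<in> {1..l - 1} \<union> {l + 1..M + 1}"
  proof
    fix j assume "j \<in> {1..n - 3 - M}"
    then have "M + 3 \<le> M + 2 + j" "M + 2 + j < n" using b by auto
    then have "1 \<le> G (M + 2 + j) \<and> G (M + 2 + j) \<le> M + 1 \<and> G (M + 2 + j) \<noteq> l" by (rule G)
    then show "G (M + 2 + j) \<in> {1..l - 1} \<union> {l + 1..M + 1}" by auto
  qed
  show "B2_cond M (\<lambda>j. G (M + 2 + j)) {1..n - 3 - M}" by (rule tame_B2_cond[OF t b(2)]) (use G in auto)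
  show "edges R = {edge (l - 2) l, edge (l - 2) (l + 1), edge (l - 1) (l + 2), edge l (l + 2)} \<union>
    ({edge s (s + 2) |s. s \<le> l - 3} \<union> {edge s (s + 2) |s. l + 1 \<le> s \<and> s \<le> M}) \<union>
    B2_set M (\<lambda>j. G (M + 2 + j)) {1..n - 3 - M}" (is "_ = ?X")
  proof (intro set_eqI iffI)
    fix e assume "e \<in> edges R"
    then have "\<exists>i j. e = {i, j} \<and> i < j \<and> R i j" unfolding edges_ordered[OF c] .
    then obtain i j where ij: "e = {i, j}" "i < j" "R i j" by (elim exE conjE)
    have "i + 2 = l \<and> j = l \<or> i + 2 = l \<and> j = l + 1 \<or> i + 1 = l \<and> j = l + 2 \<or> i = l \<and> j = l + 2 \<or>
      j = i + 2 \<and> (j < l \<or> l < i \<and> i \<le> M) \<or> M + 3 \<le> j \<and> j < n \<and> i = G j"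
      using iff[OF ij(2)] ij(3) by (rule iffD1)
    then consider "i + 2 = l" "j = l" | "i + 2 = l" "j = l + 1" | "i + 1 = l" "j = l + 2" | "i = l" "j = l + 2"
      | "j = i + 2" "j < l" | "j = i + 2" "l < i" "i \<le> M" | "M + 3 \<le> j" "j < n" "i = G j"
      by argo
    then show "e \<in> ?X"
    proof cases
      case 5
      then have "e = edge i (i + 2) \<and> i \<le> l - 3" using ij(1) by (simp add: edge_def)
      then have "e \<in> {edge s (s + 2) |s. s \<le> l - 3}" by (intro CollectI exI[of _ i])
      then show ?thesis by blast
    next
      case 6
      then have "e = edge i (i + 2) \<and> l + 1 \<le> i \<and> i \<le> M" using ij(1) by (simp add: edge_def)
      then have "e \<in> {edge s (s + 2) |s. l + 1 \<le> s \<and> s \<le> M}" by (intro CollectI exI[of _ i])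
      then show ?thesis by blast
    next
      case 7
      then have "e \<in> B2_set M (\<lambda>j. G (M + 2 + j)) {1..n - 3 - M}" using B2_set_iff[OF b(2)] ij(1) by blast
      then show ?thesis by blast
    next
      case 1
      then have "e = edge (l - 2) (l)" using ij(1) by (auto simp: edge_def)
      then show ?thesis by simp
    next
      case 2
      then have "e = edge (l - 2) (l + 1)" using ij(1) by (auto simp: edge_def)
      then show ?thesis by simp
    next
      case 3
      then have "e = edge (l - 1) (l + 2)" using ij(1) by (auto simp: edge_def)
      then show ?thesis by simp
    next
      case 4
      then have "e = edge (l) (l + 2)" using ij(1) by (auto simp: edge_def)
      then show ?thesis by simp
    qed
  next
    fix e assume "e \<in> ?X"
    then consider "e = {l - 2, l}" | "e = {l - 2, l + 1}" | "e = {l - 1, l + 2}" | "e = {l, l + 2}"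
      | s where "e = {s, s + 2}" "s \<le> l - 3" | s where "e = {s, s + 2}" "l + 1 \<le> s" "s \<le> M"
      | "e \<in> B2_set M (\<lambda>j. G (M + 2 + j)) {1..n - 3 - M}"
      unfolding edge_def by (elim UnE insertE emptyE CollectE exE conjE) simp_all
    moreover have ll: "l - 2 + 2 = l" "l - 1 + 1 = l" "l - 2 < l" using b by auto
    ultimately have "\<exists>i j. e = {i, j} \<and> i < j \<and> R i j"
    proof cases
      case 1
      have "R (l - 2) (l)" by (rule iff[THEN iffD2]) (use ll in simp_all)
      with 1 show ?thesis using ll by (intro exI[of _ "l - 2"] exI[of _ l]) simp
    next
      case 2
      have "R (l - 2) (l + 1)" by (rule iff[THEN iffD2]) (use ll in simp_all)
      with 2 show ?thesis using ll by (intro exI[of _ "l - 2"] exI[of _ "l + 1"]) simp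
    next
      case 3
      have "R (l - 1) (l + 2)" by (rule iff[THEN iffD2]) (use ll in simp_all)
      with 3 show ?thesis using ll by (intro exI[of _ "l - 1"] exI[of _ "l + 2"]) simp
    next
      case 4
      have "R (l) (l + 2)" by (rule iff[THEN iffD2]) (use ll in simp_all)
      with 4 show ?thesis using ll by (intro exI[of _ l] exI[of _ "l + 2"]) simp
    next
      case (5 s)
      then have "s + 2 < l \<or> l < s \<and> s \<le> M" using b by linarith
      then have "R s (s + 2)" by (intro iff[THEN iffD2]) simp_all
      then show ?thesis using 5 by (intro exI[of _ s] exI[of _ "s + 2"]) simp
    next
      case (6 s)
      then have "s + 2 < l \<or> l < s \<and> s \<le> M" using b by linarith
      then have "R s (s + 2)" by (intro iff[THEN iffD2]) simp_all
      then show ?thesis using 6 by (intro exI[of _ s] exI[of _ "s + 2"]) simp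
    next
      case 7
      then obtain z where z: "M + 3 \<le> z" "z < n" "e = {G z, z}" using B2_set_iff[OF b(2)] by blast
      then have "G z < z" using G[of z] by simp
      then have "R (G z) z" using z by (intro iff[THEN iffD2]) simp_all
      then show ?thesis using z \<open>G z < z\<close> by (intro exI[of _ "G z"] exI[of _ z]) simp
    qed
    then show "e \<in> edges R" unfolding edges_ordered[OF c] .
  qed
qed

lemma type2I:
  assumes c: "chords n R" and b: "5 \<le> M" "M + 3 \<le> n" "2 < l" "l + 1 < M"
    and G: "\<And>j. M + 3 \<le> j \<Longrightarrow> j < n \<Longrightarrow> 1 \<le> G j \<and> G j \<le> M + 1 \<and> G j \<noteq> l \<and> G j \<noteq> l + 1" and t: "tame n M G"
    and iff: "\<And>i j. i < j \<Longrightarrow> R i j \<longleftrightarrow>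
      i + 2 = l \<and> j = l \<or> i + 2 = l \<and> j = l + 1 \<or> i + 1 = l \<and> j = l + 2 \<or> i = l \<and> j = l + 3 \<or>
      i = l + 1 \<and> j = l + 3 \<or>
      j = i + 2 \<and> (j < l \<or> l + 1 < i \<and> i \<le> M) \<or> M + 3 \<le> j \<and> j < n \<and> i = G j"
  shows "type2 n (edges R)"
  unfolding type2_def
proof (rule exI[of _ M], rule exI[of _ l], rule exI[of _ "\<lambda>j. G (M + 2 + j)"], intro conjI)
  show "5 \<le> M" "M \<le> n - 3" "2 < l" "l + 1 < M" using b by auto
  show "\<forall>j\<in>{1..n - 3 - M}. G (M + 2 + j) \<in> {1..l - 1} \<union> {l + 2..M + 1}"
  proof
    fix j assume "j \<in> {1..n - 3 - M}"
    then have "M + 3 \<le> M + 2 + j" "M + 2 + j < n" using b by auto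
    then have "1 \<le> G (M + 2 + j) \<and> G (M + 2 + j) \<le> M + 1 \<and> G (M + 2 + j) \<noteq> l \<and> G (M + 2 + j) \<noteq> l + 1" by (rule G)
    then show "G (M + 2 + j) \<in> {1..l - 1} \<union> {l + 2..M + 1}" by auto
  qed
  show "B2_cond M (\<lambda>j. G (M + 2 + j)) {1..n - 3 - M}" by (rule tame_B2_cond[OF t b(2)]) (use G in auto)
  show "edges R = {edge (l - 2) l, edge (l - 2) (l + 1), edge (l - 1) (l + 2), edge l (l + 3), edge (l + 1) (l + 3)} \<union>
    ({edge s (s + 2) |s. s \<le> l - 3} \<union> {edge s (s + 2) |s. l + 2 \<le> s \<and> s \<le> M}) \<union>
    B2_set M (\<lambda>j. G (M + 2 + j)) {1..n - 3 - M}" (is "_ = ?X")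
  proof (intro set_eqI iffI)
    fix e assume "e \<in> edges R"
    then have "\<exists>i j. e = {i, j} \<and> i < j \<and> R i j" unfolding edges_ordered[OF c] .
    then obtain i j where ij: "e = {i, j}" "i < j" "R i j" by (elim exE conjE)
    have "i + 2 = l \<and> j = l \<or> i + 2 = l \<and> j = l + 1 \<or> i + 1 = l \<and> j = l + 2 \<or> i = l \<and> j = l + 3 \<or>
      i = l + 1 \<and> j = l + 3 \<or>
      j = i + 2 \<and> (j < l \<or> l + 1 < i \<and> i \<le> M) \<or> M + 3 \<le> j \<and> j < n \<and> i = G j"
      using iff[OF ij(2)] ij(3) by (rule iffD1)
    then consider "i + 2 = l" "j = l" | "i + 2 = l" "j = l + 1" | "i + 1 = l" "j = l + 2" | "i = l" "j = l + 3"
      | "i = l + 1" "j = l + 3"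
      | "j = i + 2" "j < l" | "j = i + 2" "l + 1 < i" "i \<le> M" | "M + 3 \<le> j" "j < n" "i = G j"
      by argo
    then show "e \<in> ?X"
    proof cases
      case 6
      then have "e = edge i (i + 2) \<and> i \<le> l - 3" using ij(1) by (simp add: edge_def)
      then have "e \<in> {edge s (s + 2) |s. s \<le> l - 3}" by (intro CollectI exI[of _ i])
      then show ?thesis by blast
    next
      case 7
      then have "e = edge i (i + 2) \<and> l + 2 \<le> i \<and> i \<le> M" using ij(1) by (simp add: edge_def)
      then have "e \<in> {edge s (s + 2) |s. l + 2 \<le> s \<and> s \<le> M}" by (intro CollectI exI[of _ i])
      then show ?thesis by blast
    next
      case 8
      then have "e \<in> B2_set M (\<lambda>j. G (M + 2 + j)) {1..n - 3 - M}" using B2_set_iff[OF b(2)] ij(1) by blast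
      then show ?thesis by blast
    next
      case 1
      then have "e = edge (l - 2) (l)" using ij(1) by (auto simp: edge_def)
      then show ?thesis by simp
    next
      case 2
      then have "e = edge (l - 2) (l + 1)" using ij(1) by (auto simp: edge_def)
      then show ?thesis by simp
    next
      case 3
      then have "e = edge (l - 1) (l + 2)" using ij(1) by (auto simp: edge_def)
      then show ?thesis by simp
    next
      case 4
      then have "e = edge (l) (l + 3)" using ij(1) by (auto simp: edge_def)
      then show ?thesis by simp
    next
      case 5
      then have "e = edge (l + 1) (l + 3)" using ij(1) by (auto simp: edge_def)
      then show ?thesis by simp
    qed
  next
    fix e assume "e \<in> ?X"
    then consider "e = {l - 2, l}" | "e = {l - 2, l + 1}" | "e = {l - 1, l + 2}" | "e = {l, l + 3}" | "e = {l + 1, l + 3}"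
      | s where "e = {s, s + 2}" "s \<le> l - 3" | s where "e = {s, s + 2}" "l + 2 \<le> s" "s \<le> M"
      | "e \<in> B2_set M (\<lambda>j. G (M + 2 + j)) {1..n - 3 - M}"
      unfolding edge_def by (elim UnE insertE emptyE CollectE exE conjE) simp_all
    moreover have ll: "l - 2 + 2 = l" "l - 1 + 1 = l" "l - 2 < l" using b by auto
    ultimately have "\<exists>i j. e = {i, j} \<and> i < j \<and> R i j"
    proof cases
      case 1
      have "R (l - 2) (l)" by (rule iff[THEN iffD2]) (use ll in simp_all)
      with 1 show ?thesis using ll by (intro exI[of _ "l - 2"] exI[of _ l]) simp
    next
      case 2
      have "R (l - 2) (l + 1)" by (rule iff[THEN iffD2]) (use ll in simp_all)
      with 2 show ?thesis using ll by (intro exI[of _ "l - 2"] exI[of _ "l + 1"]) simp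
    next
      case 3
      have "R (l - 1) (l + 2)" by (rule iff[THEN iffD2]) (use ll in simp_all)
      with 3 show ?thesis using ll by (intro exI[of _ "l - 1"] exI[of _ "l + 2"]) simp
    next
      case 4
      have "R (l) (l + 3)" by (rule iff[THEN iffD2]) (use ll in simp_all)
      with 4 show ?thesis using ll by (intro exI[of _ l] exI[of _ "l + 3"]) simp
    next
      case 5
      have "R (l + 1) (l + 3)" by (rule iff[THEN iffD2]) (use ll in simp_all)
      with 5 show ?thesis using ll by (intro exI[of _ "l + 1"] exI[of _ "l + 3"]) simp
    next
      case (6 s)
      then have "s + 2 < l \<or> l + 1 < s \<and> s \<le> M" using b by linarith
      then have "R s (s + 2)" by (intro iff[THEN iffD2]) simp_all
      then show ?thesis using 6 by (intro exI[of _ s] exI[of _ "s + 2"]) simp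
    next
      case (7 s)
      then have "s + 2 < l \<or> l + 1 < s \<and> s \<le> M" using b by linarith
      then have "R s (s + 2)" by (intro iff[THEN iffD2]) simp_all
      then show ?thesis using 7 by (intro exI[of _ s] exI[of _ "s + 2"]) simp
    next
      case 8
      then obtain z where z: "M + 3 \<le> z" "z < n" "e = {G z, z}" using B2_set_iff[OF b(2)] by blast
      then have "G z < z" using G[of z] by simp
      then have "R (G z) z" using z by (intro iff[THEN iffD2]) simp_all
      then show ?thesis using z \<open>G z < z\<close> by (intro exI[of _ "G z"] exI[of _ z]) simp
    qed
    then show "e \<in> edges R" unfolding edges_ordered[OF c] .
  qed
qed

definition typed :: "nat \<Rightarrow> (nat \<Rightarrow> nat \<Rightarrow> bool) \<Rightarrow> bool" where
  "typed n R \<longleftrightarrow> (\<exists>r. type1 n (edges (rot n r R)) \<or> type2 n (edges (rot n r R)) \<or> type3 n (edges (rot n r R)))"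

lemma arc_typed:
  assumes s: "sat n R" and a: "arc n (rot n r R) m F"
  shows "typed n R"
proof -
  have n: "n > 0" using satD[OF s] by simp
  obtain r' where "type3 n (edges (rot n r' (rot n r R)))" using arc_type3[OF sat_rot[OF s] a] by blast
  then show ?thesis unfolding typed_def rot_add[OF n] by blast
qed

lemma arc_typed_0: "sat n R \<Longrightarrow> arc n R m F \<Longrightarrow> typed n R"
  using arc_typed[of n R 0] rot_0 satD(1) by simp

lemma rot_iff:
  assumes "r \<le> n" "i < n" "j < n"
  shows "rot n r R i j \<longleftrightarrow> R (if i + r < n then i + r else i + r - n) (if j + r < n then j + r else j + r - n)"
proof -
  have "(k + r) mod n = (if k + r < n then k + r else k + r - n)" if "k < n" for k
  proof (cases "k + r < n")
    case False
    then have "k + r = (k + r - n) + n" by simp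
    then have "(k + r) mod n = (k + r - n) mod n" by (metis mod_add_self2)
    then show ?thesis using False that assms by simp
  qed simp
  then show ?thesis using assms by (simp add: rot_def)
qed

section \<open>The inserted vertex lies outside the run of ears or at one of its ends\<close>

context insertion
begin

lemma chords_P: "chords n P" and n6: "6 \<le> n"
  using satD[OF sat] by auto

lemma sym: "P i j \<Longrightarrow> P j i"
  using chordsD(1)[OF chords_P] .

lemma Fout: "m + 3 \<le> z \<Longrightarrow> Suc z < n \<Longrightarrow> 1 \<le> F z \<and> F z \<le> m + 1"
  using proper unfolding proper_def by simp

lemma Fends: "m + 4 < n \<Longrightarrow> F (m + 3) \<noteq> m + 1" "m + 4 < n \<Longrightarrow> F (n - 2) \<noteq> 1"
proof -
  assume "m + 4 < n"
  then have "m + 3 < n - 1" by simp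
  then show "F (m + 3) \<noteq> m + 1" "F (n - 2) \<noteq> 1" using proper unfolding proper_def by (simp_all add: numeral_2_eq_2)
qed

lemma Fbound: "2 \<le> z \<Longrightarrow> Suc z < n \<Longrightarrow> F z \<le> m + 1 \<and> F z < z"
  using Fin[of z] Fout[of z] by (cases "z \<le> m + 2") auto

lemma Fpred:
  assumes "3 \<le> z" "z < n"
  shows "F (z - 1) \<le> m + 1" "F (z - 1) < z - 1" "z \<le> m + 3 \<Longrightarrow> F (z - 1) = z - 3" "m + 4 \<le> z \<Longrightarrow> 1 \<le> F (z - 1)"
proof -
  obtain k where k: "z = Suc k" using assms(1) by (cases z) auto
  show "F (z - 1) \<le> m + 1" "F (z - 1) < z - 1" "z \<le> m + 3 \<Longrightarrow> F (z - 1) = z - 3" "m + 4 \<le> z \<Longrightarrow> 1 \<le> F (z - 1)"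
    using Fbound[of k] Fin[of k] Fout[of k] assms k by auto
qed

lemma iff': "i < j \<Longrightarrow> Suc j < n \<Longrightarrow> P (ins q i) (ins q j) \<longleftrightarrow> 2 \<le> j \<and> i = F j"
  by (rule iff) auto

lemma PF: "2 \<le> z \<Longrightarrow> Suc z < n \<Longrightarrow> P (ins q (F z)) (ins q z)"
  using iff'[of "F z" z] Fbound[of z] by simp

lemma qn: "Suc q < n"
  using q n6 by simp

lemma low_low: "u < v \<Longrightarrow> v \<le> q \<Longrightarrow> P u v \<longleftrightarrow> 2 \<le> v \<and> u = F v"
  using iff'[of u v] qn by (simp add: ins_def)

text \<open>These chords pass over the inserted vertex, so the old ear \<open>{v - 3, v - 1}\<close>
  is now \<open>{v - 3, v}\<close>.\<close>

lemma low_high: "u \<le> q \<Longrightarrow> q + 2 \<le> v \<Longrightarrow> v < n \<Longrightarrow> P u v \<longleftrightarrow> 3 \<le> v \<and> u = F (v - 1)"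
proof -
  assume a: "u \<le> q" "q + 2 \<le> v" "v < n"
  then obtain k where k: "v = Suc k" by (cases v) auto
  show ?thesis using a iff'[of u k] k by (auto simp: ins_def)
qed

lemma high_high: "q + 2 \<le> u \<Longrightarrow> u < v \<Longrightarrow> v < n \<Longrightarrow> P u v \<longleftrightarrow> 3 \<le> v \<and> u - 1 = F (v - 1)"
proof -
  assume a: "q + 2 \<le> u" "u < v" "v < n"
  then obtain k l where k: "v = Suc k" "u = Suc l" by (cases v; cases u) auto
  show ?thesis using a iff'[of l k] k by (auto simp: ins_def)
qed

lemma nbrs_y: "\<exists>g h. g \<noteq> h \<and> P (q + 1) g \<and> P (q + 1) h \<and> (\<forall>j. P (q + 1) j \<longrightarrow> j = g \<or> j = h)"
proof -
  obtain g h where gh: "{j. P (q + 1) j} = {g, h}" "g \<noteq> h" using deg2 by (auto simp: card_2_iff)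
  then have "P (q + 1) j \<longleftrightarrow> j = g \<or> j = h" for j by blast
  then show ?thesis using gh(2) by blast
qed

lemma third_nbr: "P (q + 1) a \<Longrightarrow> P (q + 1) b \<Longrightarrow> a \<noteq> b \<Longrightarrow> P (q + 1) j \<Longrightarrow> j = a \<or> j = b"
proof -
  obtain g h where "g \<noteq> h" "\<forall>j. P (q + 1) j \<longrightarrow> j = g \<or> j = h" using nbrs_y by blast
  then show "P (q + 1) a \<Longrightarrow> P (q + 1) b \<Longrightarrow> a \<noteq> b \<Longrightarrow> P (q + 1) j \<Longrightarrow> j = a \<or> j = b" by metis
qed

lemma nbr_y_not_adjacent: "P (q + 1) j \<Longrightarrow> j \<noteq> q \<and> j \<noteq> q + 1 \<and> j \<noteq> q + 2 \<and> j < n \<and> (q + 1 = n - 1 \<longrightarrow> j \<noteq> 0)"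
  using chordsD(3)[OF chords_P, of "q + 1" j] chordsD(4)[OF chords_P, of "q + 1" j]
    chordsD(5)[OF chords_P, of "q + 1" j] chordsD(6)[OF chords_P, of "q + 1" j] chordsD(8)[OF chords_P, of "q + 1" j]
  by (cases "j = 0") auto

lemma ins_less: "Suc i < n \<Longrightarrow> ins q i < n"
  by (simp add: ins_def)

lemma not_outer: "P (ins q i) (ins q j) \<Longrightarrow> i < j \<Longrightarrow> Suc j < n \<Longrightarrow> m + 2 \<le> i \<Longrightarrow> False"
  using iff'[of i j] Fbound[of j] by auto

lemma not_zero: "P 0 (ins q i) \<Longrightarrow> m + 2 \<le> i \<Longrightarrow> Suc i < n \<Longrightarrow> False"
  using iff'[of 0 i] Fin[of i] Fout[of i] m1 by (cases "i = m + 2") (auto simp: ins_def)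

lemma pv_outer:
  assumes "m + 3 \<le> i" "i \<noteq> q + 1" shows "pv n (ins q i) = ins q (i - 1)"
  using assms by (auto simp: pv_def ins_def)

lemma nx_outer:
  assumes "i \<noteq> q" "Suc i < n" shows "nx n (ins q i) = (if Suc (Suc i) = n then 0 else ins q (Suc i))"
  using assms qn by (auto simp: nx_def ins_def)

lemma outer_not_ear:
  assumes i: "m + 3 \<le> i" "Suc i < n" "i \<noteq> q" "i \<noteq> q + 1"
  shows "\<not> ear n P (ins q i)"
proof
  assume "ear n P (ins q i)"
  then have e: "P (ins q (i - 1)) (if Suc (Suc i) = n then 0 else ins q (Suc i))"
    using ear_nx[OF ins_less[OF i(2)]] pv_outer[OF i(1,4)] nx_outer[OF i(3,2)] by simp
  have "m + 2 \<le> i - 1" "i - 1 < Suc i" "Suc (i - 1) < n" using i by auto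
  then show False
    using not_outer[of "i - 1" "Suc i"] not_zero[of "i - 1"] sym[of "ins q (i - 1)" 0] e i(2)
    by (cases "Suc (Suc i) = n") auto
qed

lemma ins_eq_iff: "ins q i = ins q j \<longleftrightarrow> i = j"
  by (auto simp: ins_def)

lemma ins_neq_y: "ins q i \<noteq> q + 1"
  by (simp add: ins_def)

lemma position_label:
  assumes "g < n" "g \<noteq> q + 1" shows "\<exists>i. Suc i < n \<and> ins q i = g"
proof (cases "g \<le> q")
  case True
  then show ?thesis using qn by (intro exI[of _ g]) (simp add: ins_def)
next
  case False
  then obtain k where "g = Suc k" "q < k" using assms(2) by (cases g) auto
  then show ?thesis using assms(1) by (intro exI[of _ k]) (simp add: ins_def)
qed

lemma nbr_label:
  assumes "P (q + 1) g" shows "\<exists>i. Suc i < n \<and> i \<noteq> q \<and> i \<noteq> q + 1 \<and> ins q i = g"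
proof -
  have a: "g \<noteq> q" "g \<noteq> q + 1" "g \<noteq> q + 2" "g < n" using nbr_y_not_adjacent[OF assms] by auto
  obtain i where i: "Suc i < n" "ins q i = g" using position_label[OF a(4,2)] by blast
  then have "i \<noteq> q" "i \<noteq> q + 1" using a by (auto simp: ins_def)
  then show ?thesis using i by blast
qed

text \<open>Each of the two vertices has degree two, through the inserted vertex and through its
  value under \<open>F\<close>, and neither has an ear. They are not joined to each other, so
  \<open>remove_two\<close> applies.\<close>

lemma outer_pair:
  assumes ij: "P (q + 1) (ins q i)" "P (q + 1) (ins q j)" "i < j" "m + 3 \<le> i" "Suc j < n"
    "i \<noteq> q" "i \<noteq> q + 1" "j \<noteq> q" "j \<noteq> q + 1"
  shows False
proof (rule remove_two[OF sat, of "ins q i" "ins q j"])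
  have i: "Suc i < n" "2 \<le> i" and j: "m + 3 \<le> j" "2 \<le> j" using ij by auto
  show "ins q i < n" "ins q j < n" using ins_less i ij by auto
  show "ins q j \<noteq> ins q i" using ij by (simp add: ins_eq_iff)
  show "\<not> ear n P (ins q i)" using outer_not_ear i ij by simp
  have ej: "\<not> ear n P (ins q j)" using outer_not_ear j ij by simp
  show "bare_after n P (ins q i) (ins q j)"
  proof (cases "j = Suc i")
    case True
    have m: "m + 2 \<le> i - 1" "i - 1 < Suc j" "Suc (i - 1) < n" using ij i by auto
    have "\<not> P (ins q (i - 1)) (if Suc (Suc j) = n then 0 else ins q (Suc j))"
      using not_outer[of "i - 1" "Suc j"] not_zero[of "i - 1"] sym[of "ins q (i - 1)" 0] m ij(5)
      by (cases "Suc (Suc j) = n") auto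
    moreover have "ins q j = nx n (ins q i)" using True ij(5) nx_outer[OF ij(6) i(1)] by simp
    ultimately show ?thesis using pv_outer[OF ij(4,7)] nx_outer[OF ij(8,5)] by (simp add: bare_after_def)
  next
    case False
    have "ins q j \<noteq> nx n (ins q i)" using False nx_outer[OF ij(6) i(1)] ij(3) ins_eq_iff[of j "Suc i"] by (auto simp: ins_def)
    moreover have "ins q i \<noteq> nx n (ins q j)" using nx_outer[OF ij(8,5)] ij(3,4) ins_eq_iff[of i "Suc j"] by (auto simp: ins_def)
    ultimately show ?thesis using ej by (simp add: bare_after_def)
  qed
  show "P (ins q i) (q + 1)" "P (ins q j) (q + 1)" using ij sym by auto
  show "P (ins q i) (ins q (F i))" "P (ins q j) (ins q (F j))"
    using PF[OF i(2,1)] PF[OF j(2) ij(5)] sym by auto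
  show "q + 1 \<noteq> ins q (F i)" "q + 1 \<noteq> ins q (F j)" "q + 1 \<noteq> ins q i" using ins_neq_y by metis+
  show "ins q (F j) \<noteq> ins q i" using Fout[OF j(1) ij(5)] ij(4) by (simp add: ins_eq_iff)
qed

lemma nbr_inner: "\<exists>i \<le> m + 2. P (q + 1) (ins q i)"
proof (rule ccontr)
  assume neg: "\<not> ?thesis"
  obtain g h where gh: "g \<noteq> h" "P (q + 1) g" "P (q + 1) h" using nbrs_y by blast
  obtain i where i: "Suc i < n" "i \<noteq> q" "i \<noteq> q + 1" "ins q i = g" using nbr_label[OF gh(2)] by blast
  obtain j where j: "Suc j < n" "j \<noteq> q" "j \<noteq> q + 1" "ins q j = h" using nbr_label[OF gh(3)] by blast
  have P: "P (q + 1) (ins q i)" "P (q + 1) (ins q j)" using gh i j by auto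
  then have "\<not> i \<le> m + 2" "\<not> j \<le> m + 2" using neg by blast+
  moreover have "i \<noteq> j" using gh(1) i(4) j(4) by auto
  ultimately have ij: "m + 3 \<le> i" "m + 3 \<le> j" "i \<noteq> j" by auto
  show False
  proof (cases "i < j")
    case True
    then show False using outer_pair[OF P True ij(1) j(1) i(2,3) j(2,3)] by simp
  next
    case False
    then have "j < i" using ij by simp
    then show False using outer_pair[OF P(2,1) _ ij(2) i(1) j(2,3) i(2,3)] by simp
  qed
qed

text \<open>The run is untouched, and the inserted vertex is just one more outer vertex with an edge
  to the run. So \<open>F\<close> extends by its inner neighbour.\<close>

lemma typed_outside:
  assumes "m + 2 \<le> q" shows "typed n P"
proof -
  obtain g where g: "g \<le> m + 2" "P (q + 1) (ins q g)" using nbr_inner by blast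
  then have Pg: "P g (q + 1)" using sym assms by (simp add: ins_def)
  have "arc n P m (\<lambda>z. if z \<le> q then F z else if z = q + 1 then g else F (z - 1))"
    unfolding arc_def
  proof (intro conjI allI impI)
    fix z assume z: "2 \<le> z" "z < n"
    consider "z \<le> q" | "z = q + 1" | "q + 1 < z" by linarith
    then show "P (if z \<le> q then F z else if z = q + 1 then g else F (z - 1)) z"
    proof cases
      case 1 then show ?thesis using low_low[of "F z" z] Fbound[of z] z qn by simp
    next
      case 2 then show ?thesis using Pg by simp
    next
      case 3 then show ?thesis using low_high[of "F (z - 1)" z] Fpred[of z] z assms by simp
    qed
  next
    fix z assume z: "m + 3 \<le> z" "z < n"
    then show "(if z \<le> q then F z else if z = q + 1 then g else F (z - 1)) \<le> m + 2"
      using Fbound[of z] Fpred[of z] g qn assms by auto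
  qed (use mn Fin assms in auto)
  then show ?thesis using arc_typed_0[OF sat] by blast
qed

text \<open>The last ear \<open>{m, m + 2}\<close> of the run is stretched to
  \<open>{m, m + 3}\<close> and becomes the edge of an outer vertex. If the inserted vertex is
  joined to \<open>m\<close>, it takes over as the end of the run; otherwise the run ends one vertex
  earlier.\<close>

lemma typed_right_end:
  assumes q1: "q = m + 1" shows "typed n P"
proof (cases "P m (q + 1)")
  case True
  have "arc n P m (\<lambda>z. if z \<le> m + 2 then z - 2 else F (z - 1))"
    unfolding arc_def
  proof (intro conjI allI impI)
    fix z assume z: "2 \<le> z" "z < n"
    consider "z \<le> m + 1" | "z = m + 2" | "m + 2 < z" by linarith
    then show "P (if z \<le> m + 2 then z - 2 else F (z - 1)) z"
    proof cases
      case 1 then show ?thesis using low_low[of "z - 2" z] Fin[of z] z q1 by simp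
    next
      case 2 then show ?thesis using True q1 by simp
    next
      case 3 then show ?thesis using low_high[of "F (z - 1)" z] Fpred[of z] z q1 by simp
    qed
  next
    fix z assume z: "m + 3 \<le> z" "z < n"
    then show "(if z \<le> m + 2 then z - 2 else F (z - 1)) \<le> m + 2" using Fpred[of z] by auto
  qed (use mn in auto)
  then show ?thesis using arc_typed_0[OF sat] by blast
next
  case False
  obtain i where i: "i \<le> m + 2" "P (q + 1) (ins q i)" using nbr_inner by blast
  have "ins q i \<noteq> m" using False sym i by metis
  then have g: "i < m" "P i (q + 1)" using i nbr_y_not_adjacent[OF i(2)] sym q1 by (auto simp: ins_def split: if_splits)
  have "arc n P (m - 1) (\<lambda>z. if z \<le> m + 1 then z - 2 else if z = m + 2 then i else F (z - 1))"
    unfolding arc_def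
  proof (intro conjI allI impI)
    fix z assume z: "2 \<le> z" "z < n"
    consider "z \<le> m + 1" | "z = m + 2" | "m + 2 < z" by linarith
    then show "P (if z \<le> m + 1 then z - 2 else if z = m + 2 then i else F (z - 1)) z"
    proof cases
      case 1 then show ?thesis using low_low[of "z - 2" z] Fin[of z] z q1 by simp
    next
      case 2 then show ?thesis using g q1 by simp
    next
      case 3 then show ?thesis using low_high[of "F (z - 1)" z] Fpred[of z] z q1 by simp
    qed
  next
    fix z assume z: "m - 1 + 3 \<le> z" "z < n"
    then show "(if z \<le> m + 1 then z - 2 else if z = m + 2 then i else F (z - 1)) \<le> m - 1 + 2"
      using Fpred[of z] g m1 by auto
  qed (use mn m1 in auto)
  then show ?thesis using arc_typed_0[OF sat] by blast
qed

text \<open>Mirror image of \<open>typed_right_end\<close>. The run starts at the inserted vertex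
  \<open>1\<close> if \<open>{1, 3}\<close> is present and at \<open>2\<close> otherwise; the
  rotation puts the vertices in front of it at the end of the labels, which gives the special values
  of \<open>?G\<close>.\<close>

lemma typed_left_end:
  assumes q0: "q = 0" shows "typed n P"
proof (cases "P 1 3")
  case True
  have "arc n (rot n 1 P) m (\<lambda>z. if z \<le> m + 2 then z - 2 else if z + 1 = n then 2 else F z)"
    (is "arc _ _ _ ?G") unfolding arc_def
  proof (intro conjI allI impI)
    fix z assume z: "2 \<le> z" "z < n"
    obtain k where k: "z = k + 2" using z(1) le_Suc_ex[of 2 z] by auto
    consider "k = 0" | "1 \<le> k" "k \<le> m" | "m + 1 \<le> k" "k + 3 < n" | "m + 1 \<le> k" "k + 3 = n" using z k by linarith
    then show "rot n 1 P (?G z) z"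
    proof cases
      case 1 then show ?thesis using True n6 k by (simp add: rot_iff numeral_3_eq_3)
    next
      case 2
      then have "P (k + 1) (k + 3)" using high_high[of "k + 1" "k + 3"] Fin[of "k + 2"] q0 mn by simp
      then show ?thesis using 2 mn k by (simp add: rot_iff numeral_3_eq_3)
    next
      case 3
      then have F: "1 \<le> F (k + 2)" "F (k + 2) \<le> m + 1" using Fout[of "k + 2"] by auto
      then have "P (F (k + 2) + 1) (k + 3)" using high_high[of "F (k + 2) + 1" "k + 3"] 3 q0 by simp
      then show ?thesis using 3 k F by (simp add: rot_iff numeral_3_eq_3)
    next
      case 4
      have "P 3 0" using low_high[of 0 3] Fin[of 2] q0 n6 sym by simp
      then show ?thesis using 4 n6 mn k by (simp add: rot_iff numeral_3_eq_3)
    qed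
  next
    fix z assume z: "m + 3 \<le> z" "z < n"
    then show "?G z \<le> m + 2" using Fbound[of z] by auto
  qed (use mn in auto)
  then show ?thesis using arc_typed[OF sat] by blast
next
  case False
  obtain i where i: "i \<le> m + 2" "P (q + 1) (ins q i)" using nbr_inner by blast
  have "i \<noteq> 0" "i \<noteq> 1" using nbr_y_not_adjacent[OF i(2)] q0 by (auto simp: ins_def split: if_splits)
  moreover have "i \<noteq> 2" using i(2) False q0 by (auto simp: ins_def numeral_3_eq_3)
  ultimately have i3: "3 \<le> i" "P (i + 1) 1" using i sym q0 by (auto simp: ins_def)
  have "arc n (rot n 2 P) (m - 1) (\<lambda>z. if z \<le> m + 1 then z - 2 else if z + 2 = n then 1
      else if z + 1 = n then i - 1 else F (z + 1) - 1)" (is "arc _ _ _ ?G")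
    unfolding arc_def
  proof (intro conjI allI impI)
    fix z assume z: "2 \<le> z" "z < n"
    obtain k where k: "z = k + 2" using z(1) le_Suc_ex[of 2 z] by auto
    consider "k + 1 \<le> m" | "m \<le> k" "k + 4 < n" | "k + 4 = n" | "k + 3 = n" using z k by linarith
    then show "rot n 2 P (?G z) z"
    proof cases
      case 1
      then have "P (k + 2) (k + 4)" using high_high[of "k + 2" "k + 4"] Fin[of "3 + k"] q0 mn z by simp
      then show ?thesis using 1 k mn by (simp add: rot_iff eval_nat_numeral)
    next
      case 2
      then obtain f where f: "F (3 + k) = Suc f" "f \<le> m" using Fout[of "3 + k"] by (cases "F (3 + k)") auto
      then have "P (f + 2) (k + 4)" using high_high[of "f + 2" "k + 4"] 2 q0 by simp
      then show ?thesis using 2 mn k f by (simp add: rot_iff eval_nat_numeral)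
    next
      case 3
      have "P 3 0" using low_high[of 0 3] Fin[of 2] q0 n6 sym by simp
      then show ?thesis using 3 n6 mn k by (simp add: rot_iff numeral_3_eq_3)
    next
      case 4
      obtain i' where "i = Suc i'" using i3(1) by (cases i) auto
      moreover have "Suc (Suc (Suc (Suc k))) - n = Suc 0" using 4 by simp
      ultimately show ?thesis using i3 i(1) mn 4 k by (simp add: rot_iff)
    qed
  next
    fix z assume z: "m - 1 + 3 \<le> z" "z < n"
    then show "?G z \<le> m - 1 + 2" using Fbound[of "z + 1"] i m1 by auto
  qed (use mn m1 in auto)
  then show ?thesis using arc_typed[OF sat] by blast
qed

section \<open>The inserted vertex lies inside the run of ears\<close>

lemma outer_nbr:
  assumes z: "m + 4 \<le> z" "z < n" "q \<le> m" and P: "P z j"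
  shows "j = q + 1 \<or> j = ins q (F (z - 1))"
proof (cases "j = q + 1")
  case False
  have "j < n" using chordsD(3)[OF chords_P P] .
  then obtain i where i: "Suc i < n" "ins q i = j" using position_label False by blast
  obtain k where k: "z = Suc k" using z by (cases z) auto
  have zk: "ins q k = z" using k z by (simp add: ins_def)
  have Pk: "P (ins q i) (ins q k)" "P (ins q k) (ins q i)" using P i zk sym by auto
  consider "i < k" | "i = k" | "k < i" by linarith
  then show ?thesis
  proof cases
    case 1
    then show ?thesis using iff'[of i k] Pk i k z by auto
  next
    case 2
    then show ?thesis using chordsD(4)[OF chords_P Pk(1)] by simp
  next
    case 3
    then show ?thesis using not_outer[of k i] Pk i k z by auto
  qed
qed simp

text \<open>The end \<open>m + 3\<close> keeps a single edge of the smaller polygon, so a second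
  neighbour forced by \<open>other_nbr_P\<close> can only be the inserted vertex. The same holds for
  \<open>0\<close> in \<open>zero_nbr\<close> and for the outer vertices in
  \<open>outer_nbr\<close>.\<close>

lemma right_nbr:
  assumes q: "q \<le> m" and P: "P (m + 3) j"
  shows "j = q + 1 \<or> j = ins q m"
proof (cases "j = q + 1")
  case False
  have "j < n" using chordsD(3)[OF chords_P P] .
  then obtain i where i: "Suc i < n" "ins q i = j" using position_label False by blast
  have zk: "ins q (m + 2) = m + 3" using q by (simp add: ins_def)
  have Pk: "P (ins q i) (ins q (m + 2))" "P (ins q (m + 2)) (ins q i)" using P i zk sym by auto
  consider "i < m + 2" | "i = m + 2" | "m + 2 < i" by linarith
  then show ?thesis
  proof cases
    case 1
    then have "i = F (m + 2)" using iff'[of i "m + 2"] Pk mn by simp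
    then show ?thesis using Fin[of "m + 2"] i by simp
  next
    case 2
    then show ?thesis using chordsD(4)[OF chords_P Pk(1)] by simp
  next
    case 3
    then show ?thesis using not_outer[of "m + 2" i] Pk i by auto
  qed
qed simp

lemma zero_nbr:
  assumes P: "P 0 j"
  shows "j = q + 1 \<or> j = ins q 2"
proof (cases "j = q + 1")
  case False
  have "j < n" using chordsD(3)[OF chords_P P] .
  then obtain i where i: "Suc i < n" "ins q i = j" using position_label False by blast
  have Pk: "P (ins q 0) (ins q i)" using P i by (simp add: ins_def)
  have "i \<noteq> 0"
  proof
    assume "i = 0"
    then show False using chordsD(4)[OF chords_P Pk] by simp
  qed
  then have "2 \<le> i" "F i = 0" using iff'[of 0 i] Pk i by auto
  then have "i = 2" using Fin[of i] Fout[of i] i by (cases "i \<le> m + 2") auto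
  then show ?thesis using i by simp
qed simp

text \<open>The condition of \<open>proper\<close> at this end, in new labels. It allows
  \<open>0\<close> to be cut off first in \<open>remove_two\<close>.\<close>

lemma zero_not_ear: "1 \<le> q \<Longrightarrow> q \<le> m \<Longrightarrow> \<not> ear n P 0"
proof
  assume q: "1 \<le> q" "q \<le> m" and "ear n P 0"
  then have "P (n - 1) 1" using ear_0[of n P] n6 by simp
  then have P: "P 1 (n - 1)" by (rule sym)
  have "n - 1 = m + 3 \<or> m + 4 \<le> n - 1" using mn by linarith
  then show False
  proof
    assume e: "n - 1 = m + 3"
    then have "1 = F (m + 2)" using low_high[of 1 "m + 3"] P q mn by simp
    then show False using Fin[of "m + 2"] e n6 by simp
  next
    assume e: "m + 4 \<le> n - 1"
    have "n - 1 - 1 = n - 2" by simp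
    then have "1 = F (n - 2)" using low_high[of 1 "n - 1"] P q e by simp
    then show False using Fends(2) e by linarith
  qed
qed

lemma right_not_ear: "q \<le> m \<Longrightarrow> \<not> ear n P (m + 3)"
proof
  assume q: "q \<le> m" and e: "ear n P (m + 3)"
  have "n = m + 4 \<or> m + 4 < n" using mn by linarith
  then show False
  proof
    assume n: "n = m + 4"
    then have "n - 1 = m + 3" "n - 2 = m + 2" "1 < n" by simp_all
    then have "P (m + 2) 0" using ear_last[of n P] e by metis
    then have "0 = F (m + 1)" using low_high[of 0 "m + 2"] sym[of "m + 2" 0] q n m1 by simp
    then show False using Fin[of "m + 1"] n n6 by simp
  next
    assume n: "m + 4 < n"
    then have "P (m + 2) (m + 4)" using ear_mid[of "m + 3" n P] e by (simp add: eval_nat_numeral)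
    then have "m + 1 = F (m + 3)" using high_high[of "m + 2" "m + 4"] q n by (simp add: eval_nat_numeral)
    then show False using Fends(1) n by simp
  qed
qed

text \<open>The inserted vertex \<open>2\<close> replaces \<open>1\<close> as the start of the run.
  The vertices \<open>0\<close> and \<open>1\<close> become outer, with the stretched ears
  \<open>{0, 3}\<close> and \<open>{1, 4}\<close>; the last hypothesis redirects to \<open>2\<close>
  the outer vertices that were joined to \<open>1\<close>.\<close>

lemma arc_gap_1:
  assumes q1: "q = 1" and P24: "P 2 4" and P1: "\<And>z. m + 4 \<le> z \<Longrightarrow> z < n \<Longrightarrow> F (z - 1) = 1 \<Longrightarrow> P 2 z"
  shows "typed n P"
proof -
  have "arc n (rot n 2 P) (m - 1) (\<lambda>z. if z \<le> m + 1 then z - 2 else if z + 2 = n then 1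
      else if z + 1 = n then 2 else F (z + 1) - 1)" (is "arc _ _ _ ?G")
    unfolding arc_def
  proof (intro conjI allI impI)
    fix z assume z: "2 \<le> z" "z < n"
    obtain k where k: "z = k + 2" using z(1) le_Suc_ex[of 2 z] by auto
    consider "k = 0" | "1 \<le> k" "k + 1 \<le> m" | "m \<le> k" "k + 4 < n" | "m \<le> k" "k + 4 = n" | "m \<le> k" "k + 3 = n" using z k m1 by linarith
    then show "rot n 2 P (?G z) z"
    proof cases
      case 1
      then show ?thesis using P24 k n6 m1 by (simp add: rot_iff eval_nat_numeral)
    next
      case 2
      then have "P (k + 2) (k + 4)" using high_high[of "k + 2" "k + 4"] Fin[of "3 + k"] q1 mn z by simp
      then show ?thesis using 2 k mn by (simp add: rot_iff eval_nat_numeral)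
    next
      case 3
      then obtain f where f: "F (3 + k) = Suc f" "f \<le> m" using Fout[of "3 + k"] by (cases "F (3 + k)") auto
      have "P (f + 2) (k + 4)"
      proof (cases "f = 0")
        case True
        have "F (k + 4 - 1) = 1" using f(1) True by (simp add: eval_nat_numeral)
        then have "P 2 (k + 4)" using P1[of "k + 4"] 3 by simp
        then show ?thesis using True by (simp add: numeral_2_eq_2)
      next
        case False
        then show ?thesis using high_high[of "f + 2" "k + 4"] 3 q1 f by simp
      qed
      then show ?thesis using 3 mn k f by (simp add: rot_iff eval_nat_numeral)
    next
      case 4
      have "P 3 0" using low_high[of 0 3] Fin[of 2] q1 n6 sym by simp
      then show ?thesis using 4 n6 mn k by (simp add: rot_iff eval_nat_numeral)
    next
      case 5
      have "P 4 1" using low_high[of 1 4] Fin[of 3] q1 n6 sym m1 by simp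
      moreover have "Suc (Suc (Suc (Suc k))) - n = Suc 0" using 5 by simp
      ultimately show ?thesis using 5 n6 mn k by (simp add: rot_iff eval_nat_numeral)
    qed
  next
    fix z assume z: "m - 1 + 3 \<le> z" "z < n"
    then show "?G z \<le> m - 1 + 2" using Fbound[of "z + 1"] m1 by auto
  qed (use mn m1 in auto)
  then show ?thesis using arc_typed[OF sat] by blast
qed

text \<open>Mirror image of \<open>arc_gap_1\<close>: the run ends at the inserted vertex
  \<open>m + 1\<close>, and \<open>m + 2\<close>, \<open>m + 3\<close> become outer.\<close>

lemma arc_gap_m:
  assumes qm: "q = m" and Py: "P (m - 1) (m + 1)"
    and P1: "\<And>z. m + 4 \<le> z \<Longrightarrow> z < n \<Longrightarrow> F (z - 1) = m + 1 \<Longrightarrow> P (m + 1) z"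
  shows "typed n P"
proof -
  have "arc n P (m - 1) (\<lambda>z. if z \<le> m + 1 then z - 2 else F (z - 1))"
    unfolding arc_def
  proof (intro conjI allI impI)
    fix z assume z: "2 \<le> z" "z < n"
    consider "z \<le> m" | "z = m + 1" | "m + 2 \<le> z" "z \<le> m + 3" | "m + 4 \<le> z" by linarith
    then show "P (if z \<le> m + 1 then z - 2 else F (z - 1)) z"
    proof cases
      case 1 then show ?thesis using low_low[of "z - 2" z] Fin[of z] z qm by simp
    next
      case 2 then show ?thesis using Py m1 by simp
    next
      case 3
      then have "F (z - 1) \<le> m" using Fpred(3)[of z] z m1 by simp
      then show ?thesis using low_high[of "F (z - 1)" z] 3 z qm m1 by simp
    next
      case 4
      then have "F (z - 1) \<le> m \<or> F (z - 1) = m + 1" using Fpred(1)[of z] z by auto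
      then show ?thesis using low_high[of "F (z - 1)" z] P1[of z] 4 z qm by auto
    qed
  next
    fix z assume z: "m - 1 + 3 \<le> z" "z < n"
    then show "(if z \<le> m + 1 then z - 2 else F (z - 1)) \<le> m - 1 + 2" using Fpred(1)[of z] m1 by auto
  qed (use mn m1 in auto)
  then show ?thesis using arc_typed_0[OF sat] by blast
qed

text \<open>The chords \<open>{i, i + 3}\<close> are the two stretched ears
  \<open>{q - 1, q + 2}\<close> and \<open>{q, q + 3}\<close>.\<close>

lemma gap_iff:
  assumes q: "1 \<le> q" "q \<le> m" and ij: "i < j" "i \<noteq> q + 1" "j \<noteq> q + 1"
  shows "P i j \<longleftrightarrow> j = i + 2 \<and> (j \<le> q \<or> q + 2 \<le> i \<and> j \<le> m + 3) \<or>
    j = i + 3 \<and> i \<le> q \<and> q + 2 \<le> j \<and> j \<le> m + 3 \<or> m + 4 \<le> j \<and> j < n \<and> i = ins q (F (j - 1))"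
proof -
  consider "j \<le> q" | "i \<le> q" "q + 2 \<le> j" "j \<le> m + 3"
    | "i \<le> q" "m + 4 \<le> j" "j < n" | "q + 2 \<le> i" "j \<le> m + 3" | "q + 2 \<le> i" "m + 4 \<le> j" "j < n" | "n \<le> j"
    using ij by linarith
  then show ?thesis
  proof cases
    case 1
    then show ?thesis using low_low[of i j] Fin[of j] ij q by auto
  next
    case 2
    then have "P i j \<longleftrightarrow> 3 \<le> j \<and> i = j - 3" using low_high[of i j] Fpred(3)[of j] mn q by auto
    then show ?thesis using 2 q by auto
  next
    case 3
    then have "P i j \<longleftrightarrow> i = F (j - 1)" using low_high[of i j] q by auto
    then show ?thesis using 3 q by (auto simp: ins_def)
  next
    case 4
    then have "P i j \<longleftrightarrow> 3 \<le> j \<and> i - 1 = j - 3" using high_high[of i j] Fpred(3)[of j] ij mn q by auto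
    then show ?thesis using 4 q ij by auto
  next
    case 5
    then have "P i j \<longleftrightarrow> i - 1 = F (j - 1)" using high_high[of i j] ij q by auto
    then show ?thesis using 5 q ij by (auto simp: ins_def)
  next
    case 6
    then show ?thesis using chordsD(3)[OF chords_P, of i j] mn q by auto
  qed
qed

text \<open>Vertex \<open>0\<close> takes the edges to \<open>2\<close> and \<open>3\<close> with
  it. After that the ear chord of \<open>1\<close> is \<open>{n - 1, 2}\<close>, and
  \<open>1\<close> still has the neighbours \<open>4\<close> and \<open>z\<close>.\<close>

lemma zero_end_contradiction:
  assumes q: "1 \<le> q" "q \<le> m" and "P 0 2" "P 0 3" "P 1 4" "P 1 z" "\<not> P (n - 1) 2" and z: "4 < z" "z < n"
  shows False
proof (rule remove_two[OF sat, of 0 1 2 3 4 z])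
  show "\<not> ear n P 0" using zero_not_ear q by simp
  show "bare_after n P 0 1" using n6 assms by (simp add: bare_after_def nx_def pv_def numeral_2_eq_2)
qed (use assms n6 in auto)

text \<open>The same at the other end: \<open>m + 3\<close> is cut off before \<open>m + 2\<close>,
  whose ear chord has then become \<open>{m + 1, m + 4}\<close>.\<close>

lemma right_end_contradiction:
  assumes q: "1 \<le> q" "q \<le> m" and qm: "m \<le> q + 1" and "P (m + 3) m" "P (m + 3) (m + 1)" "\<not> P (m + 1) (m + 4)" "P (m + 2) z"
    and z: "m + 4 \<le> z" "z < n"
  shows False
proof (rule remove_two[OF sat, of "m + 3" "m + 2" m "m + 1" "m - 1" z])
  show "\<not> ear n P (m + 3)" using right_not_ear q by simp
  show "bare_after n P (m + 3) (m + 2)"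
    using z assms(6) by (simp add: bare_after_def nx_def pv_def eval_nat_numeral)
  have "P (m - 1) (m + 2)" using gap_iff[OF q, of "m - 1" "m + 2"] q qm by auto
  then show "P (m + 2) (m - 1)" by (rule sym)
qed (use assms m1 in auto)

text \<open>The inserted vertex is the centre \<open>l = q + 1\<close> of type 1: its two edges and
  the two stretched ears form the seahorse. The run is one vertex longer than in the smaller
  polygon, hence \<open>m + 1\<close>.\<close>

lemma gap_seahorse:
  assumes q: "2 \<le> q" "q + 1 \<le> m" and y1: "P (q - 1) (q + 1)" and y2: "P (q + 1) (q + 3)"
  shows "typed n P"
proof -
  define G where "G j = ins q (F (j - 1))" for j
  have ynbr: "P (q + 1) j \<longleftrightarrow> j = q - 1 \<or> j = q + 3" for j
    using third_nbr[of "q - 1" "q + 3" j] y1 y2 sym by auto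
  have G: "1 \<le> G j \<and> G j \<le> m + 2 \<and> G j \<noteq> q + 1" if "m + 4 \<le> j" "j < n" for j
    using Fpred(1,4)[of j] that by (auto simp: G_def ins_def)
  have tameG: "tame n (m + 1) G"
    unfolding tame_def
  proof (intro allI impI)
    fix u v assume uv: "m + 1 + 3 \<le> u" "u < v" "v < n"
    then obtain u' v' where u': "u = Suc u'" "v = Suc v'" by (cases u; cases v) auto
    have F: "F v' \<le> F u' + 1" using tame uv u' unfolding tame_def by simp
    show "G v \<le> G u + 1"
    proof (rule ccontr)
      assume neg: "\<not> G v \<le> G u + 1"
      \<comment> \<open>Only a jump from \<open>q\<close> to \<open>q + 1\<close> grows beyond one
        under the renumbering. The inserted vertex lies in the gap and is joined to neither
        \<open>u\<close> nor \<open>v\<close>, so three fans with \<open>p = q + 1\<close> avoid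
        \<open>P\<close>.\<close>
      then have Fq: "F u' = q" "F v' = q + 1" using F u' by (auto simp: G_def ins_def split: if_splits)
      have down: "\<not> P j v" if "j \<le> q + 1" for j
        using low_high[of j v] ynbr[of v] that uv q Fq u' by (cases "j = q + 1") auto
      have up: "\<not> P i j" if "m + 4 \<le> i" "i < j" "j < n" for i j
        using high_high[of i j] Fpred(1)[of j] that q by auto
      have "tri P n"
      proof (rule tri_three_fans[of "q + 1" P u v])
        show "good P (q + 1) u"
        proof (rule good_fan_right)
          fix j assume j: "q + 1 \<le> j" "Suc j < u"
          show "\<not> P j u"
            using ynbr[of u] high_high[of j u] uv j Fq u' q by (cases "j = q + 1") auto
        qed (use uv q in simp)
        show "good P u v" by (rule good_fan_left) (use uv up in auto)
        have "good P v (n - 1)" if "v \<noteq> n - 1" by (rule good_fan_left) (use uv up that in auto)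
        then show "v = n - 1 \<or> good P v (n - 1)" by blast
      qed (use down in auto)
      then show False using satD(4)[OF sat] by simp
    qed
  qed
  have "type1 n (edges P)"
  proof (rule type1I[OF chords_P, of "m + 1" "q + 1" G])
    show "4 \<le> m + 1" "m + 1 + 3 \<le> n" "2 < q + 1" "q + 1 < m + 1" using q mn by auto
    show "1 \<le> G j \<and> G j \<le> m + 1 + 1 \<and> G j \<noteq> q + 1" if "m + 1 + 3 \<le> j" "j < n" for j
      using G[of j] that by simp
    show "tame n (m + 1) G" by fact
    fix i j :: nat assume ij: "i < j"
    consider "j = q + 1" | "i = q + 1" | "i \<noteq> q + 1" "j \<noteq> q + 1" by blast
    then show "P i j \<longleftrightarrow>
      i + 2 = q + 1 \<and> j = q + 1 \<or> i + 2 = q + 1 \<and> j = q + 1 + 1 \<or> i + 1 = q + 1 \<and> j = q + 1 + 2 \<or>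
      i = q + 1 \<and> j = q + 1 + 2 \<or>
      j = i + 2 \<and> (j < q + 1 \<or> q + 1 < i \<and> i \<le> m + 1) \<or> m + 1 + 3 \<le> j \<and> j < n \<and> i = G j"
    proof cases
      case 1
      then have "P i j \<longleftrightarrow> i = q - 1 \<or> i = q + 3" using ynbr[of i] sym by blast
      then show ?thesis using 1 ij q by auto
    next
      case 2
      then show ?thesis using ynbr[of j] ij q G[of j] by auto
    next
      case 3
      define c where "c = G j"
      have H: "P i j \<longleftrightarrow> j = i + 2 \<and> (j \<le> q \<or> q + 2 \<le> i \<and> j \<le> m + 3) \<or>
        j = i + 3 \<and> i \<le> q \<and> q + 2 \<le> j \<and> j \<le> m + 3 \<or> m + 4 \<le> j \<and> j < n \<and> i = c"
        unfolding c_def G_def by (rule gap_iff[OF _ _ ij 3]) (use q in auto)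
      consider "j \<le> q" | "i \<le> q" "q + 2 \<le> j" "j \<le> m + 3" | "q + 2 \<le> i" "j \<le> m + 3" | "m + 4 \<le> j"
        using ij 3 by linarith
      then show ?thesis unfolding c_def[symmetric] H by cases (use ij q 3 in auto)
    qed
  qed
  then show ?thesis unfolding typed_def using rot_0[OF chords_P] by metis
qed

text \<open>The only jump that the insertion stretches is the one from \<open>q\<close> to
  \<open>q + 1\<close>, and one of these values does not occur.\<close>

lemma tame_ins:
  assumes ne: "(\<forall>z. m + 4 \<le> z \<longrightarrow> z < n \<longrightarrow> F (z - 1) \<noteq> q) \<or> (\<forall>z. m + 4 \<le> z \<longrightarrow> z < n \<longrightarrow> F (z - 1) \<noteq> q + 1)"
  shows "tame n (m + 1) (\<lambda>j. ins q (F (j - 1)))"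
  unfolding tame_def
proof (intro allI impI)
  fix u v assume uv: "m + 1 + 3 \<le> u" "u < v" "v < n"
  then obtain u' v' where u': "u = Suc u'" "v = Suc v'" by (cases u; cases v) auto
  have F: "F v' \<le> F u' + 1" using tame uv u' unfolding tame_def by simp
  have "\<not> (F u' = q \<and> F v' = q + 1)"
    using ne
  proof
    assume *: "\<forall>z. m + 4 \<le> z \<longrightarrow> z < n \<longrightarrow> F (z - 1) \<noteq> q"
    show ?thesis using *[rule_format, of u] uv u' by simp
  next
    assume *: "\<forall>z. m + 4 \<le> z \<longrightarrow> z < n \<longrightarrow> F (z - 1) \<noteq> q + 1"
    show ?thesis using *[rule_format, of v] uv u' by simp
  qed
  then show "ins q (F (v - 1)) \<le> ins q (F (u - 1)) + 1" using F u' by (auto simp: ins_def)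
qed

text \<open>The inserted vertex is one of the two centres \<open>l\<close>, \<open>l + 1\<close> of
  type 2: the second if \<open>l = q\<close>, the first if \<open>l = q + 1\<close>. In both cases
  the old label \<open>l\<close> belongs to the other centre, so \<open>ne\<close> keeps outer edges
  away from it.\<close>

lemma gap_buffalo:
  assumes l: "l = q \<or> l = q + 1" "3 \<le> l" "l + 1 \<le> m" and y1: "P (q + 1) (l - 2)" and y2: "P (q + 1) (l + 3)"
    and ne: "\<And>z. m + 4 \<le> z \<Longrightarrow> z < n \<Longrightarrow> F (z - 1) \<noteq> l"
  shows "typed n P"
proof -
  define G where "G j = ins q (F (j - 1))" for j
  have ynbr: "P (q + 1) j \<longleftrightarrow> j = l - 2 \<or> j = l + 3" for j
    using third_nbr[of "l - 2" "l + 3" j] y1 y2 by auto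
  have G: "1 \<le> G j \<and> G j \<le> m + 2 \<and> G j \<noteq> l \<and> G j \<noteq> l + 1" if "m + 4 \<le> j" "j < n" for j
    using Fpred(1,4)[of j] ne[of j] l(1) that by (auto simp: G_def ins_def)
  have tameG: "tame n (m + 1) G" unfolding G_def by (rule tame_ins) (use ne l(1) in metis)
  have "type2 n (edges P)"
  proof (rule type2I[OF chords_P, of "m + 1" l G])
    show "5 \<le> m + 1" "m + 1 + 3 \<le> n" "2 < l" "l + 1 < m + 1" using l mn by auto
    show "1 \<le> G j \<and> G j \<le> m + 1 + 1 \<and> G j \<noteq> l \<and> G j \<noteq> l + 1" if "m + 1 + 3 \<le> j" "j < n" for j
      using G[of j] that by simp
    show "tame n (m + 1) G" by fact
    fix i j :: nat assume ij: "i < j"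
    consider "j = q + 1" | "i = q + 1" | "i \<noteq> q + 1" "j \<noteq> q + 1" by blast
    then show "P i j \<longleftrightarrow>
      i + 2 = l \<and> j = l \<or> i + 2 = l \<and> j = l + 1 \<or> i + 1 = l \<and> j = l + 2 \<or> i = l \<and> j = l + 3 \<or>
      i = l + 1 \<and> j = l + 3 \<or>
      j = i + 2 \<and> (j < l \<or> l + 1 < i \<and> i \<le> m + 1) \<or> m + 1 + 3 \<le> j \<and> j < n \<and> i = G j"
    proof cases
      case 1
      then have "P i j \<longleftrightarrow> i = l - 2 \<or> i = l + 3" using ynbr[of i] sym by blast
      then show ?thesis by (simp only:) (rule disjE[OF l(1)]; use 1 ij l(2,3) in auto)
    next
      case 2
      then have "P i j \<longleftrightarrow> j = l - 2 \<or> j = l + 3" using ynbr[of j] by blast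
      then show ?thesis by (simp only:) (rule disjE[OF l(1)]; use 2 ij l(2,3) G[of j] in auto)
    next
      case 3
      define c where "c = G j"
      have H: "P i j \<longleftrightarrow> j = i + 2 \<and> (j \<le> q \<or> q + 2 \<le> i \<and> j \<le> m + 3) \<or>
        j = i + 3 \<and> i \<le> q \<and> q + 2 \<le> j \<and> j \<le> m + 3 \<or> m + 4 \<le> j \<and> j < n \<and> i = c"
        unfolding c_def G_def by (rule gap_iff[OF _ _ ij 3]) (use l in auto)
      consider "j \<le> q" | "i \<le> q" "q + 2 \<le> j" "j \<le> m + 3" | "q + 2 \<le> i" "j \<le> m + 3" | "m + 4 \<le> j"
        using ij 3 by linarith
      then show ?thesis unfolding c_def[symmetric] H by cases (rule disjE[OF l(1)]; use ij l(2,3) 3 in auto)+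
    qed
  qed
  then show ?thesis unfolding typed_def using rot_0[OF chords_P] by metis
qed

text \<open>Type 1 needs \<open>2 \<le> q < m\<close>. For \<open>q = 1\<close> or
  \<open>q = m\<close> the inserted vertex starts or ends a run, and an outer vertex that would have
  to be redirected is excluded by the end contradictions.\<close>

lemma gap_two_ears:
  assumes q: "1 \<le> q" "q \<le> m" and y1: "P (q - 1) (q + 1)" and y2: "P (q + 1) (q + 3)"
  shows "typed n P"
proof -
  have ynbr: "P (q + 1) j \<longleftrightarrow> j = q - 1 \<or> j = q + 3" for j
    using third_nbr[of "q - 1" "q + 3" j] y1 y2 sym by auto
  consider "2 \<le> q" "q + 1 \<le> m" | "q = 1" | "q = m" using q by linarith
  then show ?thesis
  proof cases
    case 1
    then show ?thesis using gap_seahorse y1 y2 by blast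
  next
    case 2
    show ?thesis
    proof (rule arc_gap_1[OF 2])
      show "P 2 4" using y2 2 by (simp add: eval_nat_numeral)
      fix z assume z: "m + 4 \<le> z" "z < n" "F (z - 1) = 1"
      have False
      proof (rule zero_end_contradiction[of z])
        have "\<not> P (n - 1) 2" using ynbr[of "n - 1"] sym[of "n - 1" 2] 2 n6 by (auto simp: numeral_2_eq_2)
        then show "\<not> P (n - 1) 2" .
        show "P 0 2" using y1 2 by (simp add: numeral_2_eq_2)
        show "P 0 3" using low_high[of 0 3] Fin[of 2] 2 n6 by simp
        show "P 1 4" using low_high[of 1 4] Fin[of 3] 2 n6 m1 by simp
        show "P 1 z" using low_high[of 1 z] z 2 m1 by simp
      qed (use z n6 m1 q in auto)
      then show "P 2 z" ..
    qed
  next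
    case 3
    show ?thesis
    proof (rule arc_gap_m[OF 3])
      show "P (m - 1) (m + 1)" using y1 3 by simp
      fix z assume z: "m + 4 \<le> z" "z < n" "F (z - 1) = m + 1"
      have False
      proof (rule right_end_contradiction[of z])
        have "\<not> P (m + 1) (m + 4)" using ynbr[of "m + 4"] 3 by auto
        then show "\<not> P (m + 1) (m + 4)" .
        show "P (m + 3) (m + 1)" using ynbr[of "m + 3"] 3 sym by simp
        show "P (m + 3) m" using low_high[of m "m + 3"] Fin[of "m + 2"] 3 mn sym by simp
        show "P (m + 2) z" using high_high[of "m + 2" z] z 3 by simp
      qed (use z m1 q 3 in auto)
      then show "P (m + 1) z" ..
    qed
  qed
qed

text \<open>The run starts at \<open>3\<close>, with the inserted vertex being \<open>2\<close> or
  \<open>3\<close>. The vertices \<open>0\<close>, \<open>1\<close>, \<open>2\<close> become the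
  last three labels, with edges to \<open>3\<close>, \<open>4\<close>, \<open>5\<close>. Outer edges
  ending before the new run are excluded by \<open>F3\<close>.\<close>

lemma arc_rotate_3:
  assumes q: "q = 1 \<or> q = 2" and m3: "3 \<le> m" and P35: "P 3 5" and P30: "P 3 0" and P41: "P 4 1" and P52: "P 5 2"
    and F3: "\<And>z. m + 4 \<le> z \<Longrightarrow> z < n \<Longrightarrow> 3 \<le> F (z - 1)"
  shows "typed n P"
proof -
  have "arc n (rot n 3 P) (m - 2) (\<lambda>z. if z \<le> m then z - 2 else if z + 3 = n then 0 else if z + 2 = n then 1
      else if z + 1 = n then 2 else F (z + 2) - 2)" (is "arc _ _ _ ?G")
    unfolding arc_def
  proof (intro conjI allI impI)
    fix z assume z: "2 \<le> z" "z < n"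
    obtain k where k: "z = k + 2" using z(1) le_Suc_ex[of 2 z] by auto
    consider "k = 0" | "1 \<le> k" "k + 2 \<le> m" | "m \<le> k + 1" "k + 5 < n" | "m \<le> k + 1" "k + 5 = n"
      | "m \<le> k + 1" "k + 4 = n" | "m \<le> k + 1" "k + 3 = n" using z k m1 m3 by linarith
    then show "rot n 3 P (?G z) z"
    proof cases
      case 1
      then show ?thesis using P35 k n6 m3 mn by (simp add: rot_iff eval_nat_numeral)
    next
      case 2
      then have "P (k + 3) (k + 5)" using high_high[of "k + 3" "k + 5"] Fin[of "4 + k"] q mn z by auto
      then show ?thesis using 2 k mn by (simp add: rot_iff eval_nat_numeral)
    next
      case 3
      have "3 \<le> F (k + 5 - 1)" using F3[of "k + 5"] 3 by simp
      moreover have "k + 5 - 1 = 4 + k" by simp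
      ultimately have "3 \<le> F (4 + k)" by simp
      then obtain f where f: "F (4 + k) = f + 2" "1 \<le> f" using le_Suc_ex[of 2 "F (4 + k)"] by auto
      have fm: "f + 2 \<le> m + 1" using Fout[of "4 + k"] f 3 by simp
      have "P (f + 3) (k + 5)" using high_high[of "f + 3" "k + 5"] 3 q f fm by auto
      then show ?thesis using 3 mn k f fm by (simp add: rot_iff eval_nat_numeral)
    next
      case 4
      have e: "Suc (Suc (Suc (Suc (Suc k)))) - n = 0" using 4 by simp
      show ?thesis using P30 4 n6 m3 mn k e by (simp add: rot_iff eval_nat_numeral)
    next
      case 5
      have e: "Suc (Suc (Suc (Suc (Suc k)))) - n = Suc 0" using 5 by simp
      show ?thesis using P41 5 n6 m3 mn k e by (simp add: rot_iff eval_nat_numeral)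
    next
      case 6
      have e: "Suc (Suc (Suc (Suc (Suc k)))) - n = Suc (Suc 0)" using 6 by simp
      show ?thesis using P52 6 n6 m3 mn k e by (simp add: rot_iff eval_nat_numeral)
    qed
  next
    fix z assume z: "m - 2 + 3 \<le> z" "z < n"
    then show "?G z \<le> m - 2 + 2" using Fbound[of "z + 2"] m3 by auto
  qed (use mn m3 in auto)
  then show ?thesis using arc_typed[OF sat] by blast
qed

text \<open>A run consisting of the single ear \<open>{0, 2}\<close>; the vertices \<open>3\<close>,
  \<open>4\<close>, \<open>5\<close> are joined to \<open>0\<close>, \<open>1\<close>,
  \<open>2\<close>.\<close>

lemma arc_hexagon:
  assumes "n = 6" "P 0 2" "P 0 3" "P 1 4" "P 2 5"
  shows "typed n P"
proof -
  have "arc n P 0 (\<lambda>z. if z \<le> 3 then 0 else z - 3)"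
    unfolding arc_def
  proof (intro conjI allI impI)
    fix z assume z: "2 \<le> z" "z < n"
    then have "z = 2 \<or> z = 3 \<or> z = 4 \<or> z = 5" using assms(1) by auto
    then show "P (if z \<le> 3 then 0 else z - 3) z" using assms by (auto simp: numeral_2_eq_2)
  qed (use assms(1) in auto)
  then show ?thesis using arc_typed_0[OF sat] by blast
qed

text \<open>For \<open>n > 6\<close> the vertices \<open>0\<close> and \<open>5\<close> are not
  adjacent, so cutting off \<open>0\<close> does not change the ear chord of \<open>5\<close>, and
  both have the neighbours \<open>2\<close> and \<open>3\<close>.\<close>

lemma hexagon_if_common_nbrs:
  assumes q: "1 \<le> q" "q \<le> m" "m = 2" and "P 0 2" "P 0 3" "P 5 2" "P 5 3"
  shows "n = 6"
proof (rule ccontr)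
  assume "n \<noteq> 6"
  then have n: "6 < n" using n6 by simp
  show False
  proof (rule remove_two[OF sat, of 0 5 2 3 2 3])
    show "\<not> ear n P 0" using zero_not_ear q by simp
    have "m + 3 = 5" using q by simp
    then have "\<not> ear n P 5" using right_not_ear[OF q(2)] by metis
    then show "bare_after n P 0 5"
      using n by (simp add: bare_after_def nx_def)
  qed (use n assms in auto)
qed

lemma outer_position:
  assumes "m + 4 \<le> z" "z < n" "q \<le> m"
  shows "\<not> ear n P z"
proof -
  obtain k where k: "z = Suc k" using assms by (cases z) auto
  have "ins q k = z" using k assms by (simp add: ins_def)
  then show ?thesis using outer_not_ear[of k] k assms by auto
qed

lemma low_outer: "m + 4 \<le> z \<Longrightarrow> z < n \<Longrightarrow> F (z - 1) \<le> q \<Longrightarrow> q \<le> m \<Longrightarrow> P (F (z - 1)) z"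
  using low_high[of "F (z - 1)" z] by simp

lemma high_outer: "m + 4 \<le> z \<Longrightarrow> z < n \<Longrightarrow> q < F (z - 1) \<Longrightarrow> q \<le> m \<Longrightarrow> P (F (z - 1) + 1) z"
  using high_high[of "F (z - 1) + 1" z] Fpred(1)[of z] by simp

section \<open>An ear next to the inserted vertex is missing\<close>

lemma other_nbr_P: "x < n \<Longrightarrow> \<not> ear n P x \<Longrightarrow> y < n \<Longrightarrow> y \<noteq> x \<Longrightarrow> \<exists>j. P y j \<and> j \<noteq> x"
  using other_nbr[OF chords_P _ _ _ satD(4)[OF sat]] n6 by simp

text \<open>Vertex \<open>1\<close> has no ear, so every outer vertex joined to it has a second
  neighbour, which is the inserted vertex \<open>2\<close>. This is the redirection that
  \<open>arc_gap_1\<close> asks for. The ear \<open>{2, 4}\<close> is present, as otherwise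
  \<open>0\<close> would need a neighbour besides \<open>3\<close>.\<close>

lemma gap_left_free_1:
  assumes q: "q = 1" and y: "\<not> P 0 2"
  shows "typed n P"
proof -
  have e1: "\<not> ear n P 1" using ear_mid[of 1 n P] y n6 by (simp add: numeral_2_eq_2)
  have "P 2 4"
  proof (rule ccontr)
    assume "\<not> P 2 4"
    then have "\<not> ear n P 3" using ear_mid[of 3 n P] n6 by (simp add: eval_nat_numeral)
    then obtain j where j: "P 0 j" "j \<noteq> 3" using other_nbr_P[of 3 0] n6 by auto
    then have "j = 2" using zero_nbr[OF j(1)] q by (auto simp: ins_def)
    then show False using j y by simp
  qed
  then show ?thesis
  proof (rule arc_gap_1[OF q])
    fix z assume z: "m + 4 \<le> z" "z < n" "F (z - 1) = 1"
    obtain j where j: "P z j" "j \<noteq> 1" using other_nbr_P[OF _ e1 z(2)] z n6 by auto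
    then have "j = 2" using outer_nbr[OF z(1,2) _ j(1)] z q m1 by (auto simp: ins_def)
    then show "P 2 z" using j sym by simp
  qed
qed

text \<open>The missing ear bounds the degree of \<open>2\<close>, leaving it only \<open>0\<close>
  and \<open>5\<close>; in turn \<open>0\<close> needs another neighbour than \<open>2\<close>, the
  inserted vertex \<open>3\<close>. A new run starts at \<open>3\<close>, except that for
  \<open>m = 2\<close> counting leaves only the hexagon.\<close>

lemma gap_left_free_2:
  assumes q: "q = 2" "2 \<le> m" and y: "\<not> P 1 3"
  shows "typed n P"
proof -
  have e2: "\<not> ear n P 2" using ear_mid[of 2 n P] y n6 by (simp add: eval_nat_numeral)
  have P02: "P 0 2" using low_low[of 0 2] Fin[of 2] q by simp
  have P25: "P 2 5" using low_high[of 2 5] Fin[of 4] q mn by simp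
  have P14: "P 1 4" using low_high[of 1 4] Fin[of 3] q mn by simp
  obtain j where j: "P 0 j" "j \<noteq> 2" using other_nbr_P[OF _ e2, of 0] n6 by auto
  then have P03: "P 0 3" using zero_nbr[OF j(1)] q by (auto simp: ins_def eval_nat_numeral)
  have no2: "F (z - 1) \<noteq> 2" if z: "m + 4 \<le> z" "z < n" for z
  proof
    assume "F (z - 1) = 2"
    then have "P 2 z" using low_outer[of z] z q by simp
    then have "z = 0 \<or> z = 5" using sat_third_nbr[OF sat _ e2, of 0 5 z] P02 P25 sym n6 by auto
    then show False using z q by auto
  qed
  show ?thesis
  proof (cases "m = 2")
    case True
    obtain j where j: "P 5 j" "j \<noteq> 2" using other_nbr_P[OF _ e2, of 5] n6 by auto
    have "m + 3 = 5" using True by simp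
    then have "j = q + 1 \<or> j = ins q m" using right_nbr[of j] j(1) q True by auto
    then have P53: "P 5 3" using j q True by (auto simp: ins_def eval_nat_numeral)
    have "n = 6" by (rule hexagon_if_common_nbrs) (use q True P02 P03 P25 P53 sym in auto)
    then show ?thesis using arc_hexagon P02 P03 P14 P25 by simp
  next
    case False
    then have m3: "3 \<le> m" using q by simp
    have P35: "P 3 5"
    proof (rule ccontr)
      assume neg: "\<not> P 3 5"
      show False
      proof (rule remove_two[OF sat _ e2, of 4 0 5 1 6])
        have "\<not> ear n P 4" using ear_mid[of 4 n P] neg mn m3 by (simp add: eval_nat_numeral)
        then show "bare_after n P 2 4"
          using n6 by (simp add: bare_after_def nx_def)
        show "P 4 6" using high_high[of 4 6] Fin[of 5] q mn m3 by simp
      qed (use P02 P25 P14 sym mn m3 in auto)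
    qed
    have ynbr: "P 3 j \<longleftrightarrow> j = 0 \<or> j = 5" for j
      using third_nbr[of 0 5 j] P03 P35 sym q by (auto simp: eval_nat_numeral)
    show ?thesis
    proof (rule arc_rotate_3)
      show "P 3 0" "P 3 5" using ynbr by auto
      show "P 4 1" "P 5 2" using P14 P25 sym by auto
      fix z assume z: "m + 4 \<le> z" "z < n"
      have "F (z - 1) \<noteq> 1"
      proof
        assume F1: "F (z - 1) = 1"
        show False
        proof (rule zero_end_contradiction[of z])
          have "\<not> P (n - 1) 2"
          proof
            assume "P (n - 1) 2"
            then have "n - 1 = 0 \<or> n - 1 = 5" using sat_third_nbr[OF sat _ e2, of 0 5 "n - 1"] P02 P25 sym n6 by auto
            then show False using mn m3 by auto
          qed
          then show "\<not> P (n - 1) 2" .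
          show "P 1 z" using low_outer[OF z] F1 q by simp
        qed (use P02 P03 P14 z n6 m3 q in auto)
      qed
      then show "3 \<le> F (z - 1)" using no2[OF z] Fpred(4)[of z] z by simp
    qed (use q m3 in auto)
  qed
qed

text \<open>Without ear, \<open>q\<close> has only the neighbours \<open>q - 2\<close> and
  \<open>q + 3\<close>. Cutting off \<open>q\<close> together with \<open>q - 1\<close> or
  \<open>q + 2\<close> shows that the inserted vertex is joined to \<open>q - 2\<close> and, for
  \<open>q < m\<close>, to \<open>q + 3\<close>. This is type 2 with \<open>l = q\<close>; for
  \<open>q = m\<close> a run ends at \<open>m\<close>.\<close>

lemma gap_left_free_large:
  assumes q: "3 \<le> q" "q \<le> m" and y: "\<not> P (q - 1) (q + 1)"
  shows "typed n P"
proof -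
  have eq: "\<not> ear n P q" using ear_mid[of q n P] y q qn by simp
  have A: "P (q - 2) q" using low_low[of "q - 2" q] Fin[of q] q by simp
  have B: "P q (q + 3)" using low_high[of q "q + 3"] Fin[of "q + 2"] q mn by simp
  have noq: "F (z - 1) \<noteq> q" if z: "m + 4 \<le> z" "z < n" for z
  proof
    assume "F (z - 1) = q"
    then have "P q z" using low_outer[of z] z q by simp
    then have "z = q - 2 \<or> z = q + 3" using sat_third_nbr[OF sat _ eq, of "q - 2" "q + 3" z] A B sym qn by auto
    then show False using z q by auto
  qed
  have C: "P (q - 2) (q + 1)"
  proof (rule ccontr)
    assume neg: "\<not> P (q - 2) (q + 1)"
    obtain k where k: "q = k + 3" using q le_Suc_ex[of 3 q] by auto
    show False
    proof (rule remove_two[OF sat _ eq, of "q - 1" "q - 2" "q + 3" "q - 3" "q + 2"])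
      show "bare_after n P q (q - 1)"
        using neg k qn by (simp add: bare_after_def nx_def pv_def eval_nat_numeral)
      show "P (q - 1) (q - 3)" using low_low[of k "k + 2"] Fin[of "k + 2"] q k sym by simp
      show "P (q - 1) (q + 2)" using low_high[of "q - 1" "q + 2"] Fin[of "q + 1"] q mn by simp
    qed (use A B sym q qn in auto)
  qed
  show ?thesis
  proof (cases "q = m")
    case False
    have "P (q + 1) (q + 3)"
    proof (rule ccontr)
      assume neg: "\<not> P (q + 1) (q + 3)"
      show False
      proof (rule remove_two[OF sat _ eq, of "q + 2" "q - 2" "q + 3" "q - 1" "q + 4"])
        have "\<not> ear n P (q + 2)" using ear_mid[of "q + 2" n P] neg q False mn by (simp add: eval_nat_numeral)
        then show "bare_after n P q (q + 2)"
          using q mn by (simp add: bare_after_def nx_def)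
        show "P (q + 2) (q - 1)" using low_high[of "q - 1" "q + 2"] Fin[of "q + 1"] q mn sym by simp
        show "P (q + 2) (q + 4)" using high_high[of "q + 2" "q + 4"] Fin[of "q + 3"] q False mn by (simp add: eval_nat_numeral)
      qed (use A B sym q qn mn in auto)
    qed
    then show ?thesis using gap_buffalo[of q, OF _ q(1) _ _ _ noq] C sym q False by simp
  next
    case qm: True
    \<comment> \<open>An outer neighbour of \<open>m + 2\<close> would not fit the run
      \<open>0, \<dots>, m\<close>. It is excluded by cutting off \<open>m + 3\<close> and
      \<open>m + 2\<close>, or else \<open>q\<close> and \<open>z\<close>.\<close>
    have no1: "F (z - 1) \<noteq> m + 1" if z: "m + 4 \<le> z" "z < n" for z
    proof
      assume F1: "F (z - 1) = m + 1"
      have zP: "P (m + 2) z" using high_outer[OF z] F1 qm by simp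
      show False
      proof (cases "P (q + 1) (q + 3)")
        case True
        have ynbr: "P (q + 1) j \<longleftrightarrow> j = q - 2 \<or> j = q + 3" for j
          using third_nbr[of "q - 2" "q + 3" j] C True sym by auto
        show False
        proof (rule right_end_contradiction[of z])
          have "\<not> P (m + 1) (m + 4)" using ynbr[of "m + 4"] qm by auto
          then show "\<not> P (m + 1) (m + 4)" .
          show "P (m + 3) (m + 1)" using ynbr[of "m + 3"] qm sym by simp
          show "P (m + 3) m" using B qm sym by simp
          show "P (m + 2) z" by fact
        qed (use z m1 q qm in auto)
      next
        case False
        then have e: "\<not> ear n P (m + 2)" using ear_mid[of "m + 2" n P] qm mn by (simp add: eval_nat_numeral)
        obtain j where j: "P z j" "j \<noteq> m + 2" using other_nbr_P[OF _ e z(2)] z by auto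
        then have "j = m + 1" using outer_nbr[OF z _ j(1)] F1 qm by (auto simp: ins_def)
        then have zy: "P z (m + 1)" using j by simp
        show False
        proof (rule remove_two[OF sat _ eq, of z "q - 2" "q + 3" "m + 1" "m + 2"])
          have "\<not> ear n P z" using outer_position z q by simp
          then show "bare_after n P q z"
            using z q qm by (auto simp: bare_after_def nx_def)
        qed (use A B zy zP sym z q qm qn in auto)
      qed
    qed
    have "arc n P (m - 2) (\<lambda>z. if z \<le> m then z - 2 else if z = m + 1 then m - 2 else F (z - 1))"
      unfolding arc_def
    proof (intro conjI allI impI)
      fix z assume z: "2 \<le> z" "z < n"
      consider "z \<le> m" | "z = m + 1" | "m + 2 \<le> z" "z \<le> m + 3" | "m + 4 \<le> z" by linarith
      then show "P (if z \<le> m then z - 2 else if z = m + 1 then m - 2 else F (z - 1)) z"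
      proof cases
        case 1 then show ?thesis using low_low[of "z - 2" z] Fin[of z] z qm by simp
      next
        case 2 then show ?thesis using C qm by simp
      next
        case 3
        then have "F (z - 1) \<le> m" using Fpred(3)[of z] z m1 by simp
        then show ?thesis using low_high[of "F (z - 1)" z] 3 z qm m1 by simp
      next
        case 4
        then have "F (z - 1) \<le> m" using Fpred(1)[of z] no1[of z] z by simp
        then show ?thesis using low_outer[of z] 4 z qm by simp
      qed
    next
      fix z assume z: "m - 2 + 3 \<le> z" "z < n"
      show "(if z \<le> m then z - 2 else if z = m + 1 then m - 2 else F (z - 1)) \<le> m - 2 + 2"
      proof (cases "m + 4 \<le> z")
        case True
        then show ?thesis using Fpred(1)[of z] no1[of z] z q qm by simp
      next
        case False
        then show ?thesis using Fpred(3)[of z] z q qm by auto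
      qed
    qed (use mn q qm in auto)
    then show ?thesis using arc_typed_0[OF sat] by blast
  qed
qed

text \<open>Here \<open>q + 2\<close> lacks its ear. Away from the ends of the run this leads to
  type 2 with centres \<open>q + 1\<close> and \<open>q + 2\<close>. Near an end, that is for
  \<open>q = 1\<close> or \<open>m \<le> q + 1\<close>, a run starts next to the inserted vertex or
  ends at it, unless only the hexagon is left.\<close>

lemma gap_right_free:
  assumes q: "1 \<le> q" "q \<le> m" and y1: "P (q - 1) (q + 1)" and y: "\<not> P (q + 1) (q + 3)"
  shows "typed n P"
proof -
  have e: "\<not> ear n P (q + 2)" using ear_mid[of "q + 2" n P] y q mn by (simp add: eval_nat_numeral)
  show ?thesis
  proof (cases "q = m")
    case True
    show ?thesis
    proof (rule arc_gap_m[OF True])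
      show "P (m - 1) (m + 1)" using y1 True by simp
      fix z assume z: "m + 4 \<le> z" "z < n" "F (z - 1) = m + 1"
      obtain j where j: "P z j" "j \<noteq> q + 2" using other_nbr_P[OF _ e z(2)] z q by auto
      then have "j = m + 1" using outer_nbr[OF z(1,2) q(2) j(1)] z True by (auto simp: ins_def)
      then show "P (m + 1) z" using j sym by simp
    qed
  next
    case False
    then have qm: "q + 1 \<le> m" using q by simp
    have A: "P (q + 2) (q - 1)" using low_high[of "q - 1" "q + 2"] Fin[of "q + 1"] q mn sym by simp
    have B: "P (q + 2) (q + 4)" using high_high[of "q + 2" "q + 4"] Fin[of "q + 3"] q qm mn by (simp add: eval_nat_numeral)
    have noq: "F (z - 1) \<noteq> q + 1" if z: "m + 4 \<le> z" "z < n" for z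
    proof
      assume "F (z - 1) = q + 1"
      then have "P (q + 2) z" using high_outer[of z] z q by simp
      then have "z = q - 1 \<or> z = q + 4" using sat_third_nbr[OF sat _ e, of "q - 1" "q + 4" z] A B mn q by auto
      then show False using z qm by auto
    qed
    show ?thesis
    proof (cases "q + 2 \<le> m")
      case True
      have C: "P (q + 1) (q + 4)"
      proof (rule ccontr)
        assume neg: "\<not> P (q + 1) (q + 4)"
        show False
        proof (rule remove_two[OF sat _ e, of "q + 3" "q - 1" "q + 4" q "q + 5"])
          show "bare_after n P (q + 2) (q + 3)"
            using neg True mn by (simp add: bare_after_def nx_def pv_def eval_nat_numeral)
          show "P (q + 3) q" using low_high[of q "q + 3"] Fin[of "q + 2"] q mn sym by simp
          show "P (q + 3) (q + 5)" using high_high[of "q + 3" "q + 5"] Fin[of "q + 4"] True mn by (simp add: eval_nat_numeral)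
        qed (use A B True mn q in auto)
      qed
      show ?thesis
      proof (cases "q = 1")
        case False
        then show ?thesis using gap_buffalo[of "q + 1", OF _ _ _ _ _ noq] sym[OF y1] C True q by (simp add: eval_nat_numeral)
      next
        case q1: True
        have P02: "P 0 2" and P25: "P 2 5" using y1 C q1 by (simp_all add: eval_nat_numeral)
        have ynbr: "P 2 j \<longleftrightarrow> j = 0 \<or> j = 5" for j
          using third_nbr[of 0 5 j] P02 P25 sym q1 by (auto simp: eval_nat_numeral)
        have m3: "3 \<le> m" using True q1 by simp
        have P03: "P 0 3" using low_high[of 0 3] Fin[of 2] q1 n6 by simp
        have P14: "P 1 4" using low_high[of 1 4] Fin[of 3] q1 n6 m1 by simp
        show ?thesis
        proof (rule arc_rotate_3)
          show "P 3 5" using high_high[of 3 5] Fin[of 4] q1 mn m3 by simp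
          show "P 3 0" "P 4 1" "P 5 2" using P03 P14 P25 sym by auto
          fix z assume z: "m + 4 \<le> z" "z < n"
          have "F (z - 1) \<noteq> 1"
          proof
            assume F1: "F (z - 1) = 1"
            show False
            proof (rule zero_end_contradiction[of z])
              have "\<not> P (n - 1) 2" using ynbr[of "n - 1"] sym[of "n - 1" 2] mn m3 by auto
              then show "\<not> P (n - 1) 2" .
              show "P 1 z" using low_outer[OF z] F1 q1 m1 by simp
            qed (use P02 P03 P14 z n6 m1 q in auto)
          qed
          then show "3 \<le> F (z - 1)" using noq[OF z] q1 Fpred(4)[of z] z by simp
        qed (use q1 m3 in auto)
      qed
    next
      case False
      then have qm': "m = q + 1" using qm by simp
      obtain j where j: "P (m + 3) j" "j \<noteq> q + 2" using other_nbr_P[OF _ e, of "m + 3"] mn qm' by auto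
      then have D: "P (q + 1) (q + 4)" using right_nbr[OF q(2) j(1)] qm' sym by (auto simp: ins_def eval_nat_numeral)
      show ?thesis
      proof (cases "q = 1")
        case q1: True
        have P02: "P 0 2" and P25: "P 2 5" using y1 D q1 by (simp_all add: eval_nat_numeral)
        have P03: "P 0 3" using low_high[of 0 3] Fin[of 2] q1 n6 by simp
        have P14: "P 1 4" using low_high[of 1 4] Fin[of 3] q1 n6 m1 by simp
        have P35: "P 3 5" using B q1 by (simp add: eval_nat_numeral)
        have "n = 6" by (rule hexagon_if_common_nbrs) (use q q1 qm' P02 P03 P25 P35 sym in auto)
        then show ?thesis using arc_hexagon P02 P03 P14 P25 by simp
      next
        case False
        have no1: "F (z - 1) \<noteq> m + 1" if z: "m + 4 \<le> z" "z < n" for z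
        proof
          assume F1: "F (z - 1) = m + 1"
          show False
          proof (rule right_end_contradiction[of z])
            have "\<not> P (m + 1) (m + 4)"
              using high_high[of "m + 1" "m + 4"] noq[of "m + 4"] z qm' by (simp add: eval_nat_numeral)
            then show "\<not> P (m + 1) (m + 4)" .
            show "P (m + 3) m" using D qm' sym by (simp add: eval_nat_numeral)
            show "P (m + 3) (m + 1)" using B qm' sym by (simp add: eval_nat_numeral)
            show "P (m + 2) z" using high_outer[OF z] F1 qm' by simp
          qed (use z m1 q qm' in auto)
        qed
        \<comment> \<open>The run ends at the inserted vertex \<open>m = q + 1\<close>. Vertex
          \<open>m + 3\<close> uses its edge to it, since its edge from the smaller polygon leads to
          \<open>m + 1\<close>, beyond the run.\<close>
        have "arc n P (m - 2) (\<lambda>z. if z \<le> m then z - 2 else if z = m + 3 then m else F (z - 1))"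
          unfolding arc_def
        proof (intro conjI allI impI)
          fix z assume z: "2 \<le> z" "z < n"
          consider "z < m" | "z = m" | "m + 1 \<le> z" "z \<le> m + 2" | "z = m + 3" | "m + 4 \<le> z" by linarith
          then show "P (if z \<le> m then z - 2 else if z = m + 3 then m else F (z - 1)) z"
          proof cases
            case 1 then show ?thesis using low_low[of "z - 2" z] Fin[of z] z qm' by simp
          next
            case 2 then show ?thesis using y1 qm' by (simp add: numeral_2_eq_2)
          next
            case 3
            then have "F (z - 1) = z - 3" using Fpred(3)[of z] z q qm' by simp
            then show ?thesis using low_high[of "z - 3" z] 3 z qm' q by simp
          next
            case 4 then show ?thesis using D qm' by (simp add: eval_nat_numeral)
          next
            case 5
            then have "F (z - 1) \<le> q" using Fpred(1)[of z] no1[of z] noq[of z] z qm' by simp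
            then show ?thesis using low_outer[of z] 5 z q by simp
          qed
        next
          fix z assume z: "m - 2 + 3 \<le> z" "z < n"
          show "(if z \<le> m then z - 2 else if z = m + 3 then m else F (z - 1)) \<le> m - 2 + 2"
          proof (cases "m + 4 \<le> z")
            case True
            then show ?thesis using Fpred(1)[of z] no1[of z] z q qm' by simp
          next
            case False
            then show ?thesis using Fpred(3)[of z] z q qm' by auto
          qed
        qed (use mn q qm' \<open>q \<noteq> 1\<close> in auto)
        then show ?thesis using arc_typed_0[OF sat] by blast
      qed
    qed
  qed
qed

lemma typed_all: "typed n P"
proof -
  consider "m + 2 \<le> q" | "q = m + 1" | "q = 0" | "1 \<le> q" "q \<le> m" by linarith
  then show ?thesis
  proof cases
    case 4
    show ?thesis
    proof (cases "P (q - 1) (q + 1)")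
      case True
      then show ?thesis using gap_two_ears[OF 4] gap_right_free[OF 4] by blast
    next
      case False
      consider "q = 1" | "q = 2" | "3 \<le> q" using 4 by linarith
      then show ?thesis
      proof cases
        case 1 then show ?thesis using gap_left_free_1 False by (simp add: numeral_2_eq_2)
      next
        case 2 then show ?thesis using gap_left_free_2 4 False by (simp add: eval_nat_numeral)
      next
        case 3 then show ?thesis using gap_left_free_large 4 False by blast
      qed
    qed
  qed (use typed_outside typed_right_end typed_left_end in blast)+
qed

end

lemma sat_typed:
  assumes s: "sat n R"
  shows "\<exists>r < n. type1 n (edges (rot n r R)) \<or> type2 n (edges (rot n r R)) \<or> type3 n (edges (rot n r R))"
    (is "\<exists>r < n. ?T (rot n r R)")
proof -
  have n: "n > 0" using satD[OF s] by simp
  obtain r q m F where "insertion n (rot n r R) q m F" using insertion_exists[OF s] by blast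
  then have "typed n (rot n r R)" by (rule insertion.typed_all)
  then obtain r' where "?T (rot n r' (rot n r R))" unfolding typed_def by blast
  then have "?T (rot n ((r' + r) mod n) R)" unfolding rot_add[OF n] rot_mod .
  then show ?thesis using n by (intro exI[of _ "(r' + r) mod n"]) simp
qed

lemma edges_rot_rotate_edges:
  assumes B: "B \<subseteq> diagonals n" and r: "r < n"
  shows "\<exists>r' < n. edges (rot n r (adj B)) = rotate_edges n r' B"
proof -
  have c: "chords n (adj B)" using chords_adj[OF B] .
  have n: "n > 0" using r by simp
  have "rotate_edges n ((n - r) mod n) B = edges (rot n r (adj B))"
  proof -
    have "rot n ((n - r) mod n) (rot n r (adj B)) = adj B"
      using rot_inverse[OF c r] rot_mod[of n "n - r"] by simp
    then show ?thesis
      using edges_rot(1)[OF chords_rot[OF c] n, of "(n - r) mod n" r] edges_adj[OF B] by simp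
  qed
  then show ?thesis using n by (intro exI[of _ "(n - r) mod n"]) simp
qed

theorem theorem1p4:
  fixes n :: nat and B :: "nat set set"
  assumes "n > 5"
    and "saturated_blocker n B"
    and "card B = n - 1"
  shows "\<exists>r<n. type1 n (rotate_edges n r B) \<or> type2 n (rotate_edges n r B)
                \<or> type3 n (rotate_edges n r B)"
proof -
  have b: "blocker n B" and bs: "\<And>e. e \<in> B \<Longrightarrow> \<not> blocker n (B - {e})"
    using assms(2) unfolding saturated_blocker_def by auto
  have B: "B \<subseteq> diagonals n" using b unfolding blocker_def by simp
  have "sat n (adj B)"
    unfolding sat_def
  proof (intro conjI allI impI)
    show "chords n (adj B)" using chords_adj[OF B] .
    show "6 \<le> n" using assms(1) by simp
    show "card (edges (adj B)) = n - 1" using edges_adj[OF B] assms(3) by simp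
    show "\<not> tri (adj B) n" using blocker_iff[of n B] b B assms(1) by simp
    fix i j assume "adj B i j"
    then have "{i, j} \<in> B" by (simp add: adj_def)
    then have "tri (adj (B - {{i, j}})) n"
      using blocker_iff[of n "B - {{i, j}}"] bs[of "{i, j}"] B assms(1) by auto
    then show "tri (del (adj B) i j) n"
      by (rule tri_mono) (simp add: del_def adj_def)
  qed
  then obtain r where r: "r < n" "type1 n (edges (rot n r (adj B))) \<or> type2 n (edges (rot n r (adj B)))
    \<or> type3 n (edges (rot n r (adj B)))" using sat_typed by blast
  obtain r' where "r' < n" "edges (rot n r (adj B)) = rotate_edges n r' B"
    using edges_rot_rotate_edges[OF B r(1)] by blast
  then show ?thesis using r(2) by (intro exI[of _ r']) simp
qed

end
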